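(* Let $d\ge3$, $\eta=(\eta_1,\dots,\eta_d)\in\mathbb{R}^d$, $0<\alpha\le (d-2)/2$, and $$f(\theta)=\sum_{a\in\{1,-1\}^d}\Bigl(\sum_{i=1}^d(a_i\theta_i-\eta_i)^2\Bigr)^{-\alpha}.$$ Then, for the prediction of independent Poisson processes with the same duration (where $\theta_i=\sqrt{\lambda_i}$) or with different durations (where $\theta_i=\sqrt{\lambda_i/\gamma_i}$), the Bayesian predictive distribution based on $\pi_{f,\mathrm J}(\lambda)$ dominates that based on the Jeffreys prior, and is thus nearly minimax.
   Context: $\mathbb{N}=\{0,1,2,\dots\}$. Model: for unknown $\lambda\in(0,\infty)^d$ and known $r_i,s_i>0$, $x$ and $y$ are independent with $p(x\mid\lambda)=\prod_{i=1}^d (r_i\lambda_i)^{x_i}e^{-r_i\lambda_i}/x_i!$ and $p(y\mid\lambda)=\prod_{i=1}^d (s_i\lambda_i)^{y_i}e^{-s_i\lambda_i}/y_i!$, $x,y\in\mathbb{N}^d$. "Same duration" means $r_1=\dots=r_d=r$ and $s_1=\dots=s_d=s$, and then $\theta_i:=\sqrt{\lambda_i}$; "different durations" means general $r_i,s_i>0$, and then $\theta_i:=\sqrt{\lambda_i/\gamma_i}$ with $\gamma_i:=1/r_i-1/(r_i+s_i)$. For a (possibly improper) prior density $\pi(\lambda)$, the Bayesian predictive distribution is $p_\pi(y\mid x)=\int p(x\mid\lambda)p(y\mid\lambda)\pi(\lambda)\,\mathrm{d}\lambda\big/\int p(x\mid\lambda)\pi(\lambda)\,\mathrm{d}\lambda$.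 The Jeffreys prior is $\pi_{\mathrm J}(\lambda)\propto\prod_{i=1}^d\lambda_i^{-1/2}$, and $\pi_{f,\mathrm J}(\lambda)\propto f(\theta_1,\dots,\theta_d)\prod_{i=1}^d\lambda_i^{-1/2}$. The Kullback–Leibler (K-L) risk of a predictive distribution $q(y\mid x)$ at $\lambda$ is $\sum_x p(x\mid\lambda)\sum_y p(y\mid\lambda)\log\frac{p(y\mid\lambda)}{q(y\mid x)}$. $q_1$ dominates $q_2$ if the K-L risk of $q_1$ is at most that of $q_2$ at every $\lambda$, with strict inequality for some $\lambda$. $q$ is nearly minimax if, for every $\lambda$, its K-L risk is less than $1.04$ times the minimax lower bound $0.5\sum_{i=1}^d\log\bigl((r_i+s_i)/r_i\bigr)$. *)

theory Defs
  imports "HOL-Probability.Probability"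
begin

definition orthant :: "(real ^ 'd) set" where
  "orthant = {lam. \<forall>i. lam $ i > 0}"

definition poisson_prob :: "real ^ 'd \<Rightarrow> real ^ 'd \<Rightarrow> nat ^ 'd \<Rightarrow> real" where
  "poisson_prob r lam x =
     (\<Prod>i\<in>UNIV. (r $ i * lam $ i) ^ (x $ i) * exp (- (r $ i * lam $ i)) / fact (x $ i))"

lemma poisson_prob_eq_prod_poisson_pmf:
  assumes "r \<in> orthant" and "lam \<in> orthant"
  shows "poisson_prob r lam x = (\<Prod>i\<in>UNIV. pmf (poisson_pmf (r $ i * lam $ i)) (x $ i))"
  using assms by (simp add: poisson_prob_def orthant_def field_simps)

text \<open>The predictive distribution is unchanged when the prior is multiplied by a positive
  constant, so priors given up to proportionality are represented by a fixed unnormalized density.\<close>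

definition predictive ::
  "real ^ 'd \<Rightarrow> real ^ 'd \<Rightarrow> (real ^ 'd \<Rightarrow> real) \<Rightarrow> nat ^ 'd \<Rightarrow> nat ^ 'd \<Rightarrow> real" where
  "predictive r s \<pi> x y =
     (LINT lam:orthant|lborel. poisson_prob r lam x * poisson_prob s lam y * \<pi> lam) /
     (LINT lam:orthant|lborel. poisson_prob r lam x * \<pi> lam)"

definition jeffreys :: "real ^ 'd \<Rightarrow> real" where
  "jeffreys lam = (\<Prod>i\<in>UNIV. lam $ i powr (- (1 / 2)))"

text \<open>In \<open>shrinkage_prior \<theta> f\<close>, the map \<open>\<theta>\<close> is the coordinate change from \<open>lam\<close> in which \<open>f\<close> is
  expressed: \<open>theta_same\<close> or \<open>theta_diff r s\<close>.\<close>

definition shrinkage_prior ::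
  "(real ^ 'd \<Rightarrow> real ^ 'd) \<Rightarrow> (real ^ 'd \<Rightarrow> real) \<Rightarrow> real ^ 'd \<Rightarrow> real" where
  "shrinkage_prior \<theta> f lam = f (\<theta> lam) * jeffreys lam"

definition theta_same :: "real ^ 'd \<Rightarrow> real ^ 'd" where
  "theta_same lam = (\<chi> i. sqrt (lam $ i))"

definition gam :: "real ^ 'd \<Rightarrow> real ^ 'd \<Rightarrow> real ^ 'd" where
  "gam r s = (\<chi> i. 1 / r $ i - 1 / (r $ i + s $ i))"

definition theta_diff :: "real ^ 'd \<Rightarrow> real ^ 'd \<Rightarrow> real ^ 'd \<Rightarrow> real ^ 'd" where
  "theta_diff r s lam = (\<chi> i. sqrt (lam $ i / gam r s $ i))"

text \<open>The sums are taken in the extended reals, so that a divergent risk is \<open>\<infinity>\<close> and not the default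
  value of an undefined sum. For a predictive distribution \<open>q\<close>, both sums exist: the terms with
  negative sign in the inner sum are dominated by \<open>q x y\<close>, because \<open>p ln (p / q) \<ge> p - q\<close>, and the
  inner sum is nonnegative by Gibbs' inequality.\<close>

definition kl_loss ::
  "real ^ 'd \<Rightarrow> (nat ^ 'd \<Rightarrow> nat ^ 'd \<Rightarrow> real) \<Rightarrow> real ^ 'd \<Rightarrow> nat ^ 'd \<Rightarrow> ereal" where
  "kl_loss s q lam x =
     (\<Sum>\<^sub>\<infinity>y. if q x y > 0
           then ereal (poisson_prob s lam y * ln (poisson_prob s lam y / q x y)) else \<infinity>)"

definition kl_risk ::
  "real ^ 'd \<Rightarrow> real ^ 'd \<Rightarrow> (nat ^ 'd \<Rightarrow> nat ^ 'd \<Rightarrow> real) \<Rightarrow> real ^ 'd \<Rightarrow> ereal" where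
  "kl_risk r s q lam = (\<Sum>\<^sub>\<infinity>x. ereal (poisson_prob r lam x) * kl_loss s q lam x)"

definition dominates ::
  "real ^ 'd \<Rightarrow> real ^ 'd \<Rightarrow> (nat ^ 'd \<Rightarrow> nat ^ 'd \<Rightarrow> real) \<Rightarrow>
    (nat ^ 'd \<Rightarrow> nat ^ 'd \<Rightarrow> real) \<Rightarrow> bool" where
  "dominates r s q1 q2 \<longleftrightarrow>
     (\<forall>lam\<in>orthant. kl_risk r s q1 lam \<le> kl_risk r s q2 lam) \<and>
     (\<exists>lam\<in>orthant. kl_risk r s q1 lam < kl_risk r s q2 lam)"

definition minimax_lower_bound :: "real ^ 'd \<Rightarrow> real ^ 'd \<Rightarrow> real" where
  "minimax_lower_bound r s = 0.5 * (\<Sum>i\<in>UNIV. ln ((r $ i + s $ i) / r $ i))"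

definition nearly_minimax ::
  "real ^ 'd \<Rightarrow> real ^ 'd \<Rightarrow> (nat ^ 'd \<Rightarrow> nat ^ 'd \<Rightarrow> real) \<Rightarrow> bool" where
  "nearly_minimax r s q \<longleftrightarrow>
     (\<forall>lam\<in>orthant. kl_risk r s q lam < ereal (1.04 * minimax_lower_bound r s))"

definition sign_vectors :: "(real ^ 'd) set" where
  "sign_vectors = {a. \<forall>i. a $ i \<in> {1, - 1}}"

text \<open>At the finitely many points \<open>\<theta>\<close> where some summand is singular, that summand gets the
  value \<open>0 powr (- \<alpha>) = 0\<close>. These points form a null set, so the predictive distribution
  is not affected.\<close>

definition f_sym :: "real ^ 'd \<Rightarrow> real \<Rightarrow> real ^ 'd \<Rightarrow> real" where
  "f_sym \<eta> \<alpha> \<theta> =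
     (\<Sum>a\<in>sign_vectors. (\<Sum>i\<in>UNIV. (a $ i * \<theta> $ i - \<eta> $ i)\<^sup>2) powr (- \<alpha>))"

end

theory Submission
  imports Defs
begin

text \<open>
  For the Jeffreys prior the posterior of \<open>\<lambda>\<^sub>i\<close> given \<open>x\<close> is a gamma distribution, so each signed root
  \<open>\<plusminus>\<theta>\<^sub>i\<close> has a density proportional to \<open>\<theta> ^ (2 x\<^sub>i) exp (- \<theta>\<^sup>2 / v\<^sub>i)\<close> with
  \<open>v\<^sub>i = 1 / (r\<^sub>i \<gamma>\<^sub>i)\<close>. The predictive distribution of the shrinkage prior is that of the Jeffreys
  prior times \<open>F' (x + y) / F x\<close>, where \<open>F x\<close> is the mean of \<open>\<bar>\<theta> - \<eta>\<bar> powr (- 2 \<alpha>)\<close> under this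
  product density and \<open>F'\<close> is the same mean for \<open>v'\<^sub>i = 1 / ((r\<^sub>i + s\<^sub>i) \<gamma>\<^sub>i) = v\<^sub>i - 1\<close>.
  The risk difference is the expectation of \<open>ln (F' (x + y) / F x) \<ge> 1 - F x / F' (x + y)\<close>. Given
  \<open>n = x + y\<close>, the vector \<open>x\<close> is a binomial thinning of \<open>n\<close> that does not depend on \<open>\<lambda>\<close>, and thinning
  convolves the density for \<open>v'\<close> with a centred Gaussian of variance \<open>1 / 2\<close> per coordinate. Hence
  the conditional mean of \<open>F x\<close> is less than \<open>F' n\<close>, because \<open>\<bar>\<theta> - \<eta>\<bar> powr (- 2 \<alpha>)\<close> is superharmonic.

  For the Jeffreys prior the risk is a sum over the coordinates of \<open>\<psi> (r\<^sub>i \<lambda>\<^sub>i) - \<psi> ((r\<^sub>i + s\<^sub>i) \<lambda>\<^sub>i)\<close>,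
  and near minimaxity says that \<open>\<psi> \<mu> + 0.52 ln \<mu>\<close> is strictly increasing. Its derivative
  \<open>E ln (Z + 1 / 2) - ln \<mu> + 1 / (50 \<mu>)\<close>, where \<open>Z\<close> is Poisson with mean \<open>\<mu>\<close>, is decreasing with a
  nonnegative limit, which follows from a comparison of power series.
\<close>

section \<open>Gaussian convolution and binomial thinning\<close>

text \<open>The roots \<open>sqrt (lam $ i)\<close> fill only a half line. Summing over all signs
  unfolds each half line, so that \<open>f_sym\<close> becomes one singularity at \<eta> integrated
  over the whole space, where Gaussian smoothing meets no boundary. The choice of \<open>gam\<close>
  gives v_i = (r_i + s_i) / s_i and v'_i = r_i / s_i: whatever the durations, the added variance is
  the same in every coordinate, and the thinning probability r_i / (r_i + s_i) is v'_i / v_i. A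
  power of the distance does not factor over coordinates, but the Gaussians exp (- u S) in its
  mixture representation do. Smoothing sends u to u / (1 + u) at the cost of (1 + u) powr (- d / 2),
  so superharmonicity is used without derivatives: \<alpha> \<le> (d - 2) / 2 says that an exponent
  is nonnegative. Strictness comes from the mixture parameters above 1, which u / (1 + u) cannot
  reach. The factor 1.04 turns 0.5 into 0.52. The surplus 0.02 is the 1 / 50 of the later estimates
  and has to pay for what ln (k + 3 / 2) - ln (k + 1 / 2) exceeds 1 / (k + 1).\<close>

text \<open>\<open>half_gamma k\<close> is \<open>Gamma (k + 1 / 2)\<close>.\<close>

definition half_gamma :: "nat \<Rightarrow> real" where
  "half_gamma k = sqrt pi * fact (2 * k) / (4 ^ k * fact k)"

lemma half_gamma_pos [simp]: "half_gamma k > 0"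
  by (simp add: half_gamma_def)

lemma half_gamma_0 [simp]: "half_gamma 0 = sqrt pi"
  by (simp add: half_gamma_def)

lemma half_gamma_Suc: "half_gamma (Suc k) = (real k + 1 / 2) * half_gamma k"
proof -
  have "fact (2 * Suc k) = (2 * real k + 2) * (2 * real k + 1) * fact (2 * k)"
    by (simp add: algebra_simps)
  moreover have "fact (Suc k) = (real k + 1) * fact k" by (simp add: algebra_simps)
  moreover have "real k + 1 \<noteq> 0" by linarith
  ultimately show ?thesis
    unfolding half_gamma_def by (simp only: power_Suc) (simp add: divide_simps, simp add: algebra_simps)
qed

lemma sum_even_terms:
  fixes g :: "nat \<Rightarrow> 'a::comm_monoid_add"
  assumes "\<And>k. g (2 * k + 1) = 0"
  shows "(\<Sum>j\<le>2 * n. g j) = (\<Sum>k\<le>n. g (2 * k))"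
proof (induction n)
  case (Suc n)
  have "{..2 * Suc n} = insert (2 * Suc n) (insert (2 * n + 1) {..2 * n})" by auto
  then show ?case using Suc assms[of n] by (simp add: add.commute)
qed simp

text \<open>Expanding ((x - m) + m)^(2n) leaves only the even central moments of a normal law of
  variance w / 2. The nonnegative integral lets Tonelli apply later without integrability
  conditions.\<close>

lemma nn_integral_shifted_gaussian_moment:
  fixes m w :: real
  assumes w: "w > 0"
  shows "(\<integral>\<^sup>+x. ennreal (x ^ (2 * n) * exp (- ((x - m)\<^sup>2 / w))) \<partial>lborel) =
    ennreal (\<Sum>k\<le>n. real ((2 * n) choose (2 * k)) * m ^ (2 * (n - k)) * (w ^ k * sqrt w * half_gamma k))"
proof -
  define \<sigma> where "\<sigma> = sqrt (w / 2)"
  have \<sigma>: "\<sigma> > 0" "2 * \<sigma>\<^sup>2 = w" "\<sigma>\<^sup>2 = w / 2" using w by (auto simp: \<sigma>_def)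
  define M :: "nat \<Rightarrow> real" where
    "M j = (if even j then fact j / ((2 / \<sigma>\<^sup>2) ^ (j div 2) * fact (j div 2)) else 0)" for j
  have M: "has_bochner_integral lborel (\<lambda>x. normal_density m \<sigma> x * (x - m) ^ j) (M j)" for j
  proof (cases "even j")
    case True
    then obtain k where "j = 2 * k" by (elim evenE)
    then show ?thesis using normal_moment_even[OF \<sigma>(1), of m k] by (simp add: M_def)
  next
    case False
    then obtain k where "j = 2 * k + 1" by (elim oddE)
    then show ?thesis using normal_moment_odd[OF \<sigma>(1), of m k] by (simp add: M_def)
  qed
  define c where "c j = sqrt (pi * w) * (real ((2 * n) choose j) * m ^ (2 * n - j))" for j
  have dens: "exp (- ((x - m)\<^sup>2 / w)) = sqrt (pi * w) * normal_density m \<sigma> x" for x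
    using w by (simp add: normal_density_def \<sigma>(2) mult.assoc[symmetric]) (simp add: \<sigma>(3))
  have expand: "x ^ (2 * n) * exp (- ((x - m)\<^sup>2 / w)) =
      (\<Sum>j\<le>2 * n. c j * (normal_density m \<sigma> x * (x - m) ^ j))" for x
  proof -
    have "x ^ (2 * n) = ((x - m) + m) ^ (2 * n)" by simp
    also have "\<dots> = (\<Sum>j\<le>2 * n. real ((2 * n) choose j) * (x - m) ^ j * m ^ (2 * n - j))"
      by (rule binomial_ring)
    finally show ?thesis
      by (simp add: dens c_def sum_distrib_left sum_distrib_right mult_ac)
  qed
  have "has_bochner_integral lborel (\<lambda>x. x ^ (2 * n) * exp (- ((x - m)\<^sup>2 / w)))
      (\<Sum>j\<le>2 * n. c j * M j)"
    unfolding expand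
    by (intro has_bochner_integral_sum has_bochner_integral_mult_right M)
  then have "(\<integral>\<^sup>+x. ennreal (x ^ (2 * n) * exp (- ((x - m)\<^sup>2 / w))) \<partial>lborel)
      = ennreal (\<Sum>j\<le>2 * n. c j * M j)"
    by (subst nn_integral_eq_integral)
       (auto simp: has_bochner_integral_iff zero_le_power_eq intro!: AE_I2)
  also have "(\<Sum>j\<le>2 * n. c j * M j) = (\<Sum>k\<le>n. c (2 * k) * M (2 * k))"
    by (rule sum_even_terms) (simp add: M_def)
  also have "\<dots> = (\<Sum>k\<le>n. real ((2 * n) choose (2 * k)) * m ^ (2 * (n - k)) * (w ^ k * sqrt w * half_gamma k))"
  proof (rule sum.cong)
    fix k
    have "(4::real) ^ k = 2 ^ k * 2 ^ k" by (simp flip: power_mult_distrib)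
    moreover have "2 / \<sigma>\<^sup>2 = 4 / w" using w by (simp add: \<sigma>(3))
    ultimately show "c (2 * k) * M (2 * k) =
        real ((2 * n) choose (2 * k)) * m ^ (2 * (n - k)) * (w ^ k * sqrt w * half_gamma k)"
      using w by (simp add: c_def M_def half_gamma_def real_sqrt_mult power_divide diff_mult_distrib2)
  qed simp
  finally show ?thesis .
qed

text \<open>The density of \<open>\<plusminus>sqrt (v G)\<close> for a random sign and \<open>G\<close> gamma distributed with shape \<open>k + 1 / 2\<close>.\<close>

definition sqrt_gamma_density :: "real \<Rightarrow> nat \<Rightarrow> real \<Rightarrow> real" where
  "sqrt_gamma_density v k x = x ^ (2 * k) * exp (- (x\<^sup>2 / v)) / (v ^ k * sqrt v * half_gamma k)"

lemma sqrt_gamma_density_nonneg: "v > 0 \<Longrightarrow> sqrt_gamma_density v k x \<ge> 0"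
  unfolding sqrt_gamma_density_def by (intro divide_nonneg_pos mult_nonneg_nonneg) (auto simp: zero_le_power_eq)

lemma borel_measurable_sqrt_gamma_density [measurable]: "sqrt_gamma_density v k \<in> borel_measurable borel"
  unfolding sqrt_gamma_density_def[abs_def] by measurable

lemma nn_integral_sqrt_gamma_density:
  assumes "v > 0"
  shows "(\<integral>\<^sup>+x. ennreal (sqrt_gamma_density v k x) \<partial>lborel) = 1"
proof -
  have 0: "(0::real) ^ (2 * (k - j)) = (if k = j then 1 else 0)" if "j \<le> k" for j
    using that by auto
  have "(\<integral>\<^sup>+x. ennreal (sqrt_gamma_density v k x) \<partial>lborel) =
     (\<integral>\<^sup>+x. ennreal (inverse (v ^ k * sqrt v * half_gamma k)) * ennreal (x ^ (2 * k) * exp (- ((x - 0)\<^sup>2 / v))) \<partial>lborel)"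
    using assms by (intro nn_integral_cong, subst ennreal_mult[symmetric])
      (auto simp: sqrt_gamma_density_def field_simps zero_le_power_eq less_imp_le[OF half_gamma_pos])
  also have "\<dots> = ennreal (inverse (v ^ k * sqrt v * half_gamma k)) * ennreal (v ^ k * sqrt v * half_gamma k)"
    by (subst nn_integral_cmult, measurable, subst nn_integral_shifted_gaussian_moment[OF assms])
       (simp add: 0 if_distrib if_distribR cong: if_cong)
  also have "\<dots> = 1"
    using assms half_gamma_pos[of k] less_imp_neq[OF half_gamma_pos, of k]
    by (subst ennreal_mult[symmetric]) (auto simp: less_imp_le field_simps)
  finally show ?thesis .
qed

text \<open>Up to powers of 4, which cancel, \<open>half_gamma k\<close> is (2k)! / k! (duplication
  formula). This turns the even binomial coefficients of a Gaussian moment into the binomial weights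
  of thinning.\<close>

lemma binomial_half_gamma:
  assumes "k \<le> n"
  shows "real (n choose k) * half_gamma n / half_gamma (n - k) * sqrt pi =
    real ((2 * n) choose (2 * k)) * half_gamma k"
proof -
  have "2 * n - 2 * k = 2 * (n - k)" by simp
  moreover have "(4::real) ^ n = 4 ^ k * 4 ^ (n - k)" using assms by (simp flip: power_add)
  ultimately show ?thesis using assms
    by (simp add: half_gamma_def binomial_fact field_simps)
qed

text \<open>Completing the square gives a Gaussian in y of width \<open>p\<close> centred at
  \<open>p * x\<close>, times exp (- x^2 / v). Its moments are polynomials in x^2, whose terms are
  the densities for \<open>v\<close>. Variances add: v' / 2 + 1 / 2 = v / 2.\<close>

lemma sqrt_gamma_density_convolution:
  fixes v' x :: real
  assumes v': "v' > 0"
  defines "v \<equiv> v' + 1" and "p \<equiv> v' / (v' + 1)"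
  shows "(\<integral>\<^sup>+y. ennreal (sqrt_gamma_density v' n y * (exp (- (x - y)\<^sup>2) / sqrt pi)) \<partial>lborel) =
    ennreal (\<Sum>j\<le>n. real (n choose j) * p ^ j * (1 - p) ^ (n - j) * sqrt_gamma_density v j x)"
proof -
  have p: "0 < p" "p < 1" "v' = p * v" "1 - p = 1 / v" "v > 0"
    using v' by (auto simp: p_def v_def field_simps)
  define C where "C = exp (- (x\<^sup>2 / v)) / (v' ^ n * sqrt v' * half_gamma n * sqrt pi)"
  have C: "C > 0" using v' by (simp add: C_def)
  have sq: "y\<^sup>2 / v' + (x - y)\<^sup>2 = (y - p * x)\<^sup>2 / p + x\<^sup>2 / v" for y
    using v' unfolding v_def p_def by (simp add: divide_simps) (simp add: power2_eq_square algebra_simps)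
  have e: "exp (- (y\<^sup>2 / v')) * exp (- (x - y)\<^sup>2) = exp (- ((y - p * x)\<^sup>2 / p)) * exp (- (x\<^sup>2 / v))" for y
    using sq[of y] by (simp flip: exp_add)
  have "sqrt_gamma_density v' n y * (exp (- (x - y)\<^sup>2) / sqrt pi) = C * (y ^ (2 * n) * exp (- ((y - p * x)\<^sup>2 / p)))" for y
  proof -
    have "sqrt_gamma_density v' n y * (exp (- (x - y)\<^sup>2) / sqrt pi) =
       y ^ (2 * n) * (exp (- (y\<^sup>2 / v')) * exp (- (x - y)\<^sup>2)) / (v' ^ n * sqrt v' * half_gamma n * sqrt pi)"
      by (simp add: sqrt_gamma_density_def)
    then show ?thesis unfolding e by (simp add: C_def)
  qed
  then have "(\<integral>\<^sup>+y. ennreal (sqrt_gamma_density v' n y * (exp (- (x - y)\<^sup>2) / sqrt pi)) \<partial>lborel) =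
     (\<integral>\<^sup>+y. ennreal C * ennreal (y ^ (2 * n) * exp (- ((y - p * x)\<^sup>2 / p))) \<partial>lborel)"
    using C by (simp add: ennreal_mult')
  also have "\<dots> = ennreal C * ennreal (\<Sum>k\<le>n. real ((2 * n) choose (2 * k)) * (p * x) ^ (2 * (n - k)) * (p ^ k * sqrt p * half_gamma k))"
    by (subst nn_integral_cmult, measurable, subst nn_integral_shifted_gaussian_moment[OF p(1)]) simp
  also have "\<dots> = ennreal (\<Sum>k\<le>n. C * (real ((2 * n) choose (2 * k)) * (p * x) ^ (2 * (n - k)) * (p ^ k * sqrt p * half_gamma k)))"
    using C by (simp only: ennreal_mult'[symmetric] sum_distrib_left less_imp_le)
  \<comment> \<open>The central moment of order 2 k leaves x^(2 (n - k)), so it belongs to the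
    thinned count n - k; the index is reversed afterwards.\<close>
  also have "(\<Sum>k\<le>n. C * (real ((2 * n) choose (2 * k)) * (p * x) ^ (2 * (n - k)) * (p ^ k * sqrt p * half_gamma k)))
     = (\<Sum>k\<le>n. real (n choose (n - k)) * p ^ (n - k) * (1 - p) ^ (n - (n - k)) * sqrt_gamma_density v (n - k) x)"
  proof (rule sum.cong)
    fix k assume "k \<in> {..n}"
    then have k: "k \<le> n" by simp
    have pn: "p ^ n = p ^ k * p ^ (n - k)" "v ^ n = v ^ k * v ^ (n - k)" using k by (simp_all flip: power_add)
    have "C * (real ((2 * n) choose (2 * k)) * (p * x) ^ (2 * (n - k)) * (p ^ k * sqrt p * half_gamma k))
       = C * ((p * x) ^ (2 * (n - k)) * (p ^ k * sqrt p)) * (real ((2 * n) choose (2 * k)) * half_gamma k)"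
      by simp
    also have "\<dots> = C * ((p * x) ^ (2 * (n - k)) * (p ^ k * sqrt p)) * (real (n choose k) * half_gamma n / half_gamma (n - k) * sqrt pi)"
      by (simp only: binomial_half_gamma[OF k])
    also have "\<dots> = real (n choose k) * p ^ (n - k) * (1 / v) ^ k * sqrt_gamma_density v (n - k) x"
      using p(1,5) unfolding C_def sqrt_gamma_density_def p(3) power_mult_distrib pn real_sqrt_mult
      by (simp add: divide_simps power_mult power2_eq_square power_mult_distrib less_imp_neq[OF half_gamma_pos, symmetric])
    finally show "C * (real ((2 * n) choose (2 * k)) * (p * x) ^ (2 * (n - k)) * (p ^ k * sqrt p * half_gamma k)) =
       real (n choose (n - k)) * p ^ (n - k) * (1 - p) ^ (n - (n - k)) * sqrt_gamma_density v (n - k) x"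
      using k by (simp add: p(4) binomial_symmetric[symmetric])
  qed simp
  also have "\<dots> = (\<Sum>j\<le>n. real (n choose j) * p ^ j * (1 - p) ^ (n - j) * sqrt_gamma_density v j x)"
    by (rule sum.reindex_bij_witness[where i = "\<lambda>j. n - j" and j = "\<lambda>j. n - j"]) auto
  finally show ?thesis .
qed

text \<open>The Laplace transform in \<open>u\<close> of (x - \<eta>)^2. Since Gaussian factors
  multiply over coordinates, the smoothing computation can be done on this scalar function.\<close>

definition gaussian_average :: "real \<Rightarrow> real \<Rightarrow> nat \<Rightarrow> real \<Rightarrow> ennreal" where
  "gaussian_average \<eta> v k u = (\<integral>\<^sup>+x. ennreal (sqrt_gamma_density v k x * exp (- (u * (x - \<eta>)\<^sup>2))) \<partial>lborel)"

lemma borel_measurable_gaussian_average [measurable]: "gaussian_average \<eta> v k \<in> borel_measurable borel"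
  unfolding gaussian_average_def[abs_def] by measurable

text \<open>A Gaussian of rate \<open>u\<close> smoothed with variance 1 / 2 stays Gaussian: the
  inverse rate grows by 1, which turns \<open>u\<close> into \<open>u / (1 + u)\<close>, and the
  height drops by \<open>1 / sqrt (1 + u)\<close>.\<close>

lemma nn_integral_gaussian_product:
  fixes u \<eta> y :: real
  assumes u: "u > 0"
  shows "(\<integral>\<^sup>+x. ennreal (exp (- (x - y)\<^sup>2) / sqrt pi * exp (- (u * (x - \<eta>)\<^sup>2))) \<partial>lborel) =
    ennreal (1 / sqrt (1 + u) * exp (- (u / (1 + u) * (y - \<eta>)\<^sup>2)))"
proof -
  define m where "m = (y + u * \<eta>) / (1 + u)"
  define w where "w = 1 / (1 + u)"
  have w: "w > 0" using u by (simp add: w_def)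
  have sq: "(x - y)\<^sup>2 + u * (x - \<eta>)\<^sup>2 = (x - m)\<^sup>2 / w + u / (1 + u) * (y - \<eta>)\<^sup>2" for x
    using u unfolding m_def w_def by (simp add: divide_simps) (simp add: power2_eq_square algebra_simps)
  have e: "exp (- (x - y)\<^sup>2) / sqrt pi * exp (- (u * (x - \<eta>)\<^sup>2)) =
     exp (- (u / (1 + u) * (y - \<eta>)\<^sup>2)) / sqrt pi * (x ^ (2 * 0) * exp (- ((x - m)\<^sup>2 / w)))" for x
    using sq[of x] by (simp flip: exp_add add: field_simps)
  have "(\<integral>\<^sup>+x. ennreal (exp (- (x - y)\<^sup>2) / sqrt pi * exp (- (u * (x - \<eta>)\<^sup>2))) \<partial>lborel) =
    (\<integral>\<^sup>+x. ennreal (exp (- (u / (1 + u) * (y - \<eta>)\<^sup>2)) / sqrt pi) * ennreal (x ^ (2 * 0) * exp (- ((x - m)\<^sup>2 / w))) \<partial>lborel)"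
    unfolding e by (simp only: ennreal_mult'[symmetric] divide_nonneg_nonneg exp_ge_zero real_sqrt_ge_zero pi_ge_zero)
  also have "\<dots> = ennreal (exp (- (u / (1 + u) * (y - \<eta>)\<^sup>2)) / sqrt pi) * ennreal (sqrt w * sqrt pi)"
    by (subst nn_integral_cmult, measurable, subst nn_integral_shifted_gaussian_moment[OF w]) simp
  also have "\<dots> = ennreal (1 / sqrt (1 + u) * exp (- (u / (1 + u) * (y - \<eta>)\<^sup>2)))"
    using u by (simp add: ennreal_mult'[symmetric] w_def real_sqrt_divide field_simps)
  finally show ?thesis .
qed

text \<open>Thinning acts on the density as a convolution. Exchanging the integrals moves the
  convolution to the Gaussian factor, where it only changes \<open>u\<close>.\<close>

lemma gaussian_average_thinning:
  fixes v' u :: real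
  assumes v': "v' > 0" and u: "u > 0"
  defines "v \<equiv> v' + 1" and "p \<equiv> v' / (v' + 1)"
  shows "(\<Sum>j\<le>n. ennreal (real (n choose j) * p ^ j * (1 - p) ^ (n - j)) * gaussian_average \<eta> v j u) =
    ennreal (1 / sqrt (1 + u)) * gaussian_average \<eta> v' n (u / (1 + u))"
proof -
  have p: "0 < p" "p < 1" "v > 0" using v' by (auto simp: p_def v_def)
  let ?b = "\<lambda>j. real (n choose j) * p ^ j * (1 - p) ^ (n - j)"
  have "(\<Sum>j\<le>n. ennreal (?b j) * gaussian_average \<eta> v j u) =
    (\<integral>\<^sup>+x. (\<Sum>j\<le>n. ennreal (?b j) * ennreal (sqrt_gamma_density v j x * exp (- (u * (x - \<eta>)\<^sup>2)))) \<partial>lborel)"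
    unfolding gaussian_average_def by (subst nn_integral_sum) (auto simp: nn_integral_cmult)
  also have "\<dots> = (\<integral>\<^sup>+x. ennreal (\<Sum>j\<le>n. ?b j * sqrt_gamma_density v j x) * ennreal (exp (- (u * (x - \<eta>)\<^sup>2))) \<partial>lborel)"
  proof (intro nn_integral_cong)
    fix x
    have "(\<Sum>j\<le>n. ennreal (?b j) * ennreal (sqrt_gamma_density v j x * exp (- (u * (x - \<eta>)\<^sup>2)))) =
      (\<Sum>j\<le>n. ennreal (?b j * sqrt_gamma_density v j x * exp (- (u * (x - \<eta>)\<^sup>2))))"
      using p sqrt_gamma_density_nonneg[of v] by (simp add: ennreal_mult'[symmetric] mult.assoc)
    also have "\<dots> = ennreal (\<Sum>j\<le>n. ?b j * sqrt_gamma_density v j x * exp (- (u * (x - \<eta>)\<^sup>2)))"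
      using p sqrt_gamma_density_nonneg[of v] by (intro sum_ennreal) auto
    also have "\<dots> = ennreal (\<Sum>j\<le>n. ?b j * sqrt_gamma_density v j x) * ennreal (exp (- (u * (x - \<eta>)\<^sup>2)))"
      by (simp only: sum_distrib_right[symmetric] ennreal_mult'' exp_ge_zero)
    finally show "(\<Sum>j\<le>n. ennreal (?b j) * ennreal (sqrt_gamma_density v j x * exp (- (u * (x - \<eta>)\<^sup>2)))) = \<dots>" .
  qed
  also have "\<dots> = (\<integral>\<^sup>+x. (\<integral>\<^sup>+y. ennreal (sqrt_gamma_density v' n y * (exp (- (x - y)\<^sup>2) / sqrt pi)) \<partial>lborel)
      * ennreal (exp (- (u * (x - \<eta>)\<^sup>2))) \<partial>lborel)"
    unfolding v_def p_def sqrt_gamma_density_convolution[OF v'] ..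
  also have "\<dots> = (\<integral>\<^sup>+x. \<integral>\<^sup>+y. ennreal (sqrt_gamma_density v' n y) * ennreal (exp (- (x - y)\<^sup>2) / sqrt pi * exp (- (u * (x - \<eta>)\<^sup>2))) \<partial>lborel \<partial>lborel)"
    using sqrt_gamma_density_nonneg[OF v'] by (subst nn_integral_multc[symmetric]) (auto intro!: nn_integral_cong simp: ennreal_mult''[symmetric] ennreal_mult'[symmetric] mult.assoc)
  also have "\<dots> = (\<integral>\<^sup>+y. \<integral>\<^sup>+x. ennreal (sqrt_gamma_density v' n y) * ennreal (exp (- (x - y)\<^sup>2) / sqrt pi * exp (- (u * (x - \<eta>)\<^sup>2))) \<partial>lborel \<partial>lborel)"
    by (rule lborel_pair.Fubini') measurable
  also have "\<dots> = (\<integral>\<^sup>+y. ennreal (1 / sqrt (1 + u)) * ennreal (sqrt_gamma_density v' n y * exp (- (u / (1 + u) * (y - \<eta>)\<^sup>2))) \<partial>lborel)"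
  proof (intro nn_integral_cong)
    fix y
    have "(\<integral>\<^sup>+x. ennreal (sqrt_gamma_density v' n y) * ennreal (exp (- (x - y)\<^sup>2) / sqrt pi * exp (- (u * (x - \<eta>)\<^sup>2))) \<partial>lborel) =
      ennreal (sqrt_gamma_density v' n y) * ennreal (1 / sqrt (1 + u) * exp (- (u / (1 + u) * (y - \<eta>)\<^sup>2)))"
      by (subst nn_integral_cmult, measurable, subst nn_integral_gaussian_product[OF u]) simp
    also have "\<dots> = ennreal (1 / sqrt (1 + u)) * ennreal (sqrt_gamma_density v' n y * exp (- (u / (1 + u) * (y - \<eta>)\<^sup>2)))"
      using sqrt_gamma_density_nonneg[OF v'] u by (simp add: ennreal_mult'[symmetric] mult_ac)
    finally show "(\<integral>\<^sup>+x. ennreal (sqrt_gamma_density v' n y) * ennreal (exp (- (x - y)\<^sup>2) / sqrt pi * exp (- (u * (x - \<eta>)\<^sup>2))) \<partial>lborel) = \<dots>" .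
  qed
  also have "\<dots> = ennreal (1 / sqrt (1 + u)) * gaussian_average \<eta> v' n (u / (1 + u))"
    unfolding gaussian_average_def by (subst nn_integral_cmult) auto
  finally show ?thesis .
qed

section \<open>Inverse powers as mixtures of Gaussians\<close>

lemma set_nn_integral_incseq:
  fixes f :: "'a \<Rightarrow> ennreal"
  assumes [measurable]: "f \<in> borel_measurable M" and A: "\<And>n. A n \<in> sets M" and "incseq A"
  shows "(\<integral>\<^sup>+x\<in>(\<Union>n. A n). f x \<partial>M) = (SUP n. \<integral>\<^sup>+x\<in>A n. f x \<partial>M)"
proof -
  have "(SUP n. emeasure (density M f) (A n)) = emeasure (density M f) (\<Union>n. A n)"
    using assms by (intro SUP_emeasure_incseq) auto
  then show ?thesis using A by (simp add: emeasure_density)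
qed

text \<open>Exhausts the half line by compact intervals. The range stays a union of images because
  it may be bounded, as for \<open>u / (1 + u)\<close>, or unbounded, as for
  \<open>\<gamma> * x\<^sup>2\<close>.\<close>

lemma nn_integral_substitution_Ici:
  fixes f :: "real \<Rightarrow> ennreal" and g g' :: "real \<Rightarrow> real"
  assumes [measurable]: "f \<in> borel_measurable borel" "g \<in> borel_measurable borel" "g' \<in> borel_measurable borel"
    and deriv: "\<And>x. x \<ge> 0 \<Longrightarrow> (g has_real_derivative g' x) (at x)"
    and cont: "continuous_on {0..} g'" and nonneg: "\<And>x. x \<ge> 0 \<Longrightarrow> g' x \<ge> 0"
  shows "(\<integral>\<^sup>+x\<in>{0..}. f (g x) * ennreal (g' x) \<partial>lborel) =
    (\<integral>\<^sup>+x\<in>(\<Union>n. {g 0..g (real (Suc n))}). f x \<partial>lborel)"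
proof -
  have mono: "g x \<le> g y" if "0 \<le> x" "x \<le> y" for x y
    using deriv nonneg that by (intro DERIV_nonneg_imp_nondecreasing[OF that(2)]) (meson order_trans)
  have U: "{0..} = (\<Union>n. {0..real (Suc n)})"
  proof (intro equalityI subsetI)
    fix x :: real assume "x \<in> {0..}"
    moreover obtain n where "x \<le> real n" using real_arch_simple by blast
    ultimately have "x \<in> {0..real (Suc n)}" by simp
    then show "x \<in> (\<Union>n. {0..real (Suc n)})" by blast
  qed auto
  have "(\<integral>\<^sup>+x\<in>{0..}. f (g x) * ennreal (g' x) \<partial>lborel) =
    (SUP n. \<integral>\<^sup>+x\<in>{0..real (Suc n)}. f (g x) * ennreal (g' x) \<partial>lborel)"
    unfolding U by (rule set_nn_integral_incseq) (auto simp: incseq_def)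
  also have "\<dots> = (SUP n. \<integral>\<^sup>+x\<in>{g 0..g (real (Suc n))}. f x \<partial>lborel)"
  proof (intro SUP_cong refl)
    fix n
    show "(\<integral>\<^sup>+x\<in>{0..real (Suc n)}. f (g x) * ennreal (g' x) \<partial>lborel) = (\<integral>\<^sup>+x\<in>{g 0..g (real (Suc n))}. f x \<partial>lborel)"
    proof (rule nn_integral_substitution_aux[symmetric])
      show "continuous_on {0..real (Suc n)} g'" by (rule continuous_on_subset[OF cont]) auto
    qed (use deriv nonneg in simp_all)
  qed
  also have "\<dots> = (\<integral>\<^sup>+x\<in>(\<Union>n. {g 0..g (real (Suc n))}). f x \<partial>lborel)"
    by (rule set_nn_integral_incseq[symmetric]) (auto simp: incseq_def intro: order_trans mono)
  finally show ?thesis .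
qed

section \<open>Growth bounds for the averages in terms of the counts\<close>

lemma power_le_fact_mult_exp:
  fixes t :: real
  assumes "t \<ge> 0"
  shows "t ^ k \<le> fact k * exp t"
proof -
  have "(\<Sum>i\<in>{k}. t ^ i /\<^sub>R fact i) \<le> (\<Sum>i. t ^ i /\<^sub>R fact i)"
    using assms by (intro sum_le_suminf summable_exp_generic) auto
  then show ?thesis by (simp add: exp_def field_simps)
qed

lemma fact_le_half_gamma: "fact k * sqrt pi \<le> 2 ^ k * half_gamma k"
proof (induction k)
  case (Suc k)
  have "fact (Suc k) * sqrt pi = (1 + real k) * (fact k * sqrt pi)" by simp
  also have "\<dots> \<le> (1 + real k) * (2 ^ k * half_gamma k)" using Suc by (intro mult_left_mono) auto
  also have "\<dots> \<le> (1 + 2 * real k) * (2 ^ k * half_gamma k)"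
    by (intro mult_right_mono) (auto simp: less_imp_le)
  also have "\<dots> = 2 ^ Suc k * half_gamma (Suc k)" by (simp add: half_gamma_Suc algebra_simps)
  finally show ?case .
qed simp

text \<open>Here t^k exp (- t) is at most k!, and k! is at most 2^k half_gamma k / sqrt pi. The
  crude factor 2^k is good enough, since its mean under a Poisson law is finite.\<close>

lemma sqrt_gamma_density_le:
  assumes v: "v > 0"
  shows "sqrt_gamma_density v k x \<le> 2 ^ k / (sqrt v * sqrt pi)"
proof -
  have "sqrt_gamma_density v k x = (x\<^sup>2 / v) ^ k * exp (- (x\<^sup>2 / v)) / (sqrt v * half_gamma k)"
    by (simp add: sqrt_gamma_density_def power_divide power_mult)
  also have "\<dots> \<le> fact k / (sqrt v * half_gamma k)"
    using v power_le_fact_mult_exp[of "x\<^sup>2 / v" k] half_gamma_pos[of k]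
    by (intro divide_right_mono) (auto simp: exp_minus field_simps less_imp_le)
  also have "\<dots> \<le> 2 ^ k / (sqrt v * sqrt pi)"
    using v fact_le_half_gamma[of k] by (simp add: field_simps)
  finally show ?thesis .
qed

lemma gaussian_average_le_1: "v > 0 \<Longrightarrow> u \<ge> 0 \<Longrightarrow> gaussian_average \<eta> v k u \<le> 1"
  unfolding gaussian_average_def nn_integral_sqrt_gamma_density[symmetric, of v k]
  by (intro nn_integral_mono ennreal_leI) (auto intro!: mult_left_le sqrt_gamma_density_nonneg)

text \<open>This decay makes the mixture converge at infinity: once the density is bounded
  uniformly, the Gaussian factor integrates to sqrt (pi / u).\<close>

lemma gaussian_average_le:
  assumes v: "v > 0" and u: "u > 0"
  shows "gaussian_average \<eta> v k u \<le> ennreal (2 ^ k / sqrt v * u powr (- (1 / 2)))"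
proof -
  have "gaussian_average \<eta> v k u \<le> (\<integral>\<^sup>+x. ennreal (2 ^ k / (sqrt v * sqrt pi)) * ennreal (x ^ (2 * 0) * exp (- ((x - \<eta>)\<^sup>2 / (1 / u)))) \<partial>lborel)"
    unfolding gaussian_average_def
  proof (intro nn_integral_mono)
    fix x
    have "sqrt_gamma_density v k x * exp (- (u * (x - \<eta>)\<^sup>2)) \<le> 2 ^ k / (sqrt v * sqrt pi) * exp (- (u * (x - \<eta>)\<^sup>2))"
      by (intro mult_right_mono sqrt_gamma_density_le v) auto
    then show "ennreal (sqrt_gamma_density v k x * exp (- (u * (x - \<eta>)\<^sup>2))) \<le>
        ennreal (2 ^ k / (sqrt v * sqrt pi)) * ennreal (x ^ (2 * 0) * exp (- ((x - \<eta>)\<^sup>2 / (1 / u))))"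
      using v by (subst ennreal_mult'[symmetric]) (auto simp: mult.commute intro!: ennreal_leI)
  qed
  also have "\<dots> = ennreal (2 ^ k / (sqrt v * sqrt pi)) * ennreal (sqrt (1 / u) * sqrt pi)"
    using u by (subst nn_integral_cmult, measurable, subst nn_integral_shifted_gaussian_moment) auto
  also have "\<dots> = ennreal (2 ^ k / sqrt v * u powr (- (1 / 2)))"
    using v u by (simp add: ennreal_mult'[symmetric] powr_minus powr_half_sqrt real_sqrt_divide field_simps)
  finally show ?thesis .
qed

text \<open>For \<open>u \<le> 2\<close> the Gaussian factor is at least exp (- 4 x^2 - 4 \<eta>^2),
  and multiplying the density by exp (- 4 x^2) only lowers its parameter.\<close>

lemma gaussian_average_ge:
  assumes v: "v > 0" and u: "0 \<le> u" "u \<le> 2"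
  defines "q \<equiv> 1 / (1 + 4 * v)"
  shows "gaussian_average \<eta> v k u \<ge> ennreal (exp (- 4 * \<eta>\<^sup>2) * sqrt q * q ^ k)"
proof -
  have q: "q > 0" using v by (simp add: q_def)
  \<comment> \<open>Chosen so that 1 / w = 1 / v + 4; the density for \<open>v\<close> times exp (-
    4 x^2) is then a multiple of the probability density for \<open>w\<close>.\<close>
  define w where "w = q * v"
  have w: "w > 0" using q v by (simp add: w_def)
  have wv: "x\<^sup>2 / w = x\<^sup>2 / v + 4 * x\<^sup>2" for x
    using v by (simp add: w_def q_def field_simps)
  have "ennreal (exp (- 4 * \<eta>\<^sup>2) * sqrt q * q ^ k) =
     (\<integral>\<^sup>+x. ennreal (exp (- 4 * \<eta>\<^sup>2) * sqrt q * q ^ k) * ennreal (sqrt_gamma_density w k x) \<partial>lborel)"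
    by (subst nn_integral_cmult) (auto simp: nn_integral_sqrt_gamma_density[OF w])
  also have "\<dots> \<le> gaussian_average \<eta> v k u"
    unfolding gaussian_average_def
  proof (intro nn_integral_mono)
    fix x
    have "u * (x - \<eta>)\<^sup>2 \<le> 2 * (x - \<eta>)\<^sup>2" using u by (intro mult_right_mono) auto
    also have "\<dots> \<le> 2 * ((x - \<eta>)\<^sup>2 + (x + \<eta>)\<^sup>2)" by simp
    also have "\<dots> = 4 * x\<^sup>2 + 4 * \<eta>\<^sup>2" by (simp add: power2_eq_square algebra_simps)
    finally have le: "exp (- (4 * x\<^sup>2)) * exp (- 4 * \<eta>\<^sup>2) \<le> exp (- (u * (x - \<eta>)\<^sup>2))"
      by (simp flip: exp_add)
    have "exp (- (x\<^sup>2 / w)) = exp (- (x\<^sup>2 / v)) * exp (- (4 * x\<^sup>2))"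
      unfolding wv by (simp flip: exp_add)
    then have "sqrt q * q ^ k * sqrt_gamma_density w k x = sqrt_gamma_density v k x * exp (- (4 * x\<^sup>2))"
      using q v by (simp add: sqrt_gamma_density_def w_def real_sqrt_mult power_mult_distrib)
    then have "exp (- 4 * \<eta>\<^sup>2) * sqrt q * q ^ k * sqrt_gamma_density w k x =
        sqrt_gamma_density v k x * (exp (- (4 * x\<^sup>2)) * exp (- 4 * \<eta>\<^sup>2))"
      by (simp add: mult_ac)
    also have "\<dots> \<le> sqrt_gamma_density v k x * exp (- (u * (x - \<eta>)\<^sup>2))"
      by (intro mult_left_mono le sqrt_gamma_density_nonneg v)
    finally show "ennreal (exp (- 4 * \<eta>\<^sup>2) * sqrt q * q ^ k) * ennreal (sqrt_gamma_density w k x) \<le>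
        ennreal (sqrt_gamma_density v k x * exp (- (u * (x - \<eta>)\<^sup>2)))"
      using sqrt_gamma_density_nonneg[OF w] by (simp add: ennreal_mult''[symmetric] ennreal_leI)
  qed
  finally show ?thesis .
qed

text \<open>Up to the factor \<open>Gamma \<alpha>\<close>, the mean of \<open>\<bar>\<theta> - \<eta>\<bar> powr (- 2 \<alpha>)\<close>, since
  \<open>Gamma \<alpha> * S powr (- \<alpha>)\<close> is the integral of \<open>u powr (\<alpha> - 1) * exp (- u S)\<close> over \<open>u > 0\<close>.\<close>

definition power_average :: "real \<Rightarrow> real ^ 'd \<Rightarrow> real ^ 'd \<Rightarrow> nat ^ 'd \<Rightarrow> ennreal" where
  "power_average \<alpha> \<eta> v z = (\<integral>\<^sup>+u\<in>{0<..}. ennreal (u powr (\<alpha> - 1)) * (\<Prod>i\<in>UNIV. gaussian_average (\<eta> $ i) (v $ i) (z $ i) u) \<partial>lborel)"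

text \<open>The mixture integral is split at 1. Below, the averages are at most 1 and the weight is
  integrable as \<alpha> > 0. Above, the coordinates contribute one factor u powr (- 1 / 2) each,
  which brings the exponent below -1.\<close>

lemma power_average_le:
  fixes \<eta> v :: "real ^ 'd"
  assumes v: "\<And>i. v $ i > 0" and \<alpha>: "0 < \<alpha>" "\<alpha> < real CARD('d) / 2"
  shows "\<exists>C>0. \<forall>z. power_average \<alpha> \<eta> v z \<le> ennreal (C * (\<Prod>i\<in>UNIV. 2 ^ (z $ i)))"
proof -
  define e where "e = \<alpha> - 1 - real CARD('d) / 2"
  define D where "D = (\<Prod>i\<in>UNIV. 1 / sqrt (v $ i))"
  have D: "D > 0" using v by (simp add: D_def prod_pos)
  have e: "e < - 1" using \<alpha> by (simp add: e_def)
  show ?thesis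
  proof (intro exI conjI allI)
    show "1 / \<alpha> + D / - (e + 1) > 0" using \<alpha> D e by (intro add_pos_pos divide_pos_pos) auto
    fix z :: "nat ^ 'd"
    define P :: real where "P = (\<Prod>i\<in>UNIV. 2 ^ (z $ i))"
    have P: "P \<ge> 1" by (simp add: P_def prod_ge_1)
    let ?g = "\<lambda>u. \<Prod>i\<in>UNIV. gaussian_average (\<eta> $ i) (v $ i) (z $ i) u"
    have g1: "?g u \<le> 1" if "u > 0" for u
      using v that by (intro prod_le_1) (auto intro!: gaussian_average_le_1)
    have g2: "?g u \<le> ennreal (D * P * u powr (- (real CARD('d) / 2)))" if "u > 0" for u
    proof -
      have "?g u \<le> (\<Prod>i\<in>UNIV. ennreal (2 ^ (z $ i) / sqrt (v $ i) * u powr (- (1 / 2))))"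
        using v that by (intro prod_mono_ennreal gaussian_average_le) auto
      also have "\<dots> = ennreal (\<Prod>i\<in>UNIV. 2 ^ (z $ i) / sqrt (v $ i) * u powr (- (1 / 2)))"
        using v by (intro prod_ennreal) (auto intro!: mult_nonneg_nonneg divide_nonneg_nonneg simp: less_imp_le)
      also have "(\<Prod>i\<in>UNIV. 2 ^ (z $ i) / sqrt (v $ i) * u powr (- (1 / 2))) = D * P * (u powr (- (1 / 2))) ^ CARD('d)"
        by (simp add: D_def P_def prod.distrib prod_dividef)
      also have "(u powr (- (1 / 2))) ^ CARD('d) = u powr (- (real CARD('d) / 2))"
        using that by (simp add: powr_realpow[symmetric] powr_powr)
      finally show ?thesis .
    qed
    have "power_average \<alpha> \<eta> v z \<le> (\<integral>\<^sup>+u. ennreal (u powr (\<alpha> - 1)) * indicator {0..1} u + ennreal (D * P) * (ennreal (u powr e) * indicator {1..} u) \<partial>lborel)"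
      unfolding power_average_def
    proof (intro nn_integral_mono)
      fix u :: real
      consider "u \<le> 0" | "0 < u" "u \<le> 1" | "u > 1" by linarith
      then show "ennreal (u powr (\<alpha> - 1)) * ?g u * indicator {0<..} u \<le>
        ennreal (u powr (\<alpha> - 1)) * indicator {0..1} u + ennreal (D * P) * (ennreal (u powr e) * indicator {1..} u)"
      proof cases
        case 2
        then have "ennreal (u powr (\<alpha> - 1)) * ?g u \<le> ennreal (u powr (\<alpha> - 1)) * 1"
          by (intro mult_left_mono g1) auto
        with 2 show ?thesis by (auto intro: add_increasing2)
      next
        case 3
        then have "ennreal (u powr (\<alpha> - 1)) * ?g u \<le> ennreal (u powr (\<alpha> - 1)) * ennreal (D * P * u powr (- (real CARD('d) / 2)))"
          by (intro mult_left_mono g2) auto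
        also have "u powr e = u powr (\<alpha> - 1) * u powr (- (real CARD('d) / 2))"
          unfolding powr_add[symmetric] by (simp add: e_def)
        then have "ennreal (u powr (\<alpha> - 1)) * ennreal (D * P * u powr (- (real CARD('d) / 2))) = ennreal (D * P) * ennreal (u powr e)"
          using D P by (simp add: ennreal_mult'[symmetric] mult_ac)
        finally show ?thesis using 3 by simp
      qed auto
    qed
    also have "\<dots> = (\<integral>\<^sup>+u\<in>{0..1}. ennreal (u powr (\<alpha> - 1)) \<partial>lborel) + ennreal (D * P) * (\<integral>\<^sup>+u\<in>{1..}. ennreal (u powr e) \<partial>lborel)"
      by (simp add: nn_integral_add nn_integral_cmult)
    also have "(\<integral>\<^sup>+u\<in>{0..1}. ennreal (u powr (\<alpha> - 1)) \<partial>lborel) = ennreal (1 / \<alpha>)"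
      using has_integral_powr_from_0[of "\<alpha> - 1" 1] \<alpha> by (intro nn_integral_has_integral_lebesgue') auto
    also have "(\<integral>\<^sup>+u\<in>{1..}. ennreal (u powr e) \<partial>lborel) = ennreal (1 / - (e + 1))"
    proof (intro nn_integral_has_integral_lebesgue')
      have "- (1 powr (e + 1)) / (e + 1) = 1 / - (e + 1)" by (simp only: powr_one_eq_one minus_divide_left[symmetric] minus_divide_right[symmetric])
      then show "((\<lambda>u. u powr e) has_integral 1 / - (e + 1)) {1..}"
        using has_integral_powr_to_inf[OF e, of 1] by simp
    qed simp
    also have "ennreal (1 / \<alpha>) + ennreal (D * P) * ennreal (1 / - (e + 1)) = ennreal (1 / \<alpha> + D * P * (1 / - (e + 1)))"
      using \<alpha> D P e by (simp add: ennreal_mult'[symmetric] ennreal_plus[symmetric] divide_nonneg_pos del: ennreal_plus)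
    also have "\<dots> \<le> ennreal ((1 / \<alpha> + D / - (e + 1)) * P)"
      using \<alpha> D P e by (intro ennreal_leI) (simp add: distrib_right mult_left_le_one_le le_divide_eq)
    finally show "power_average \<alpha> \<eta> v z \<le> ennreal ((1 / \<alpha> + D / - (e + 1)) * (\<Prod>i\<in>UNIV. 2 ^ (z $ i)))"
      by (simp add: P_def)
  qed
qed

text \<open>Bounds only the part u > 1, because this is the part that makes the thinning inequality
  strict. The geometric form in \<open>z\<close> later keeps the logarithm of the average at most
  linear in the counts from below. The interval from 1 to 2 suffices.\<close>

lemma power_average_ge:
  fixes \<eta> v :: "real ^ 'd"
  assumes v: "\<And>i. v $ i > 0" and \<alpha>: "0 < \<alpha>"
  shows "(\<integral>\<^sup>+u\<in>{1<..}. ennreal (u powr (\<alpha> - 1)) * (\<Prod>i\<in>UNIV. gaussian_average (\<eta> $ i) (v $ i) (z $ i) u) \<partial>lborel) \<ge>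
    ennreal (1 / 2 * (\<Prod>i\<in>UNIV. exp (- 4 * (\<eta> $ i)\<^sup>2) * sqrt (1 / (1 + 4 * v $ i)) * (1 / (1 + 4 * v $ i)) ^ (z $ i)))"
proof -
  let ?P = "\<Prod>i\<in>UNIV. exp (- 4 * (\<eta> $ i)\<^sup>2) * sqrt (1 / (1 + 4 * v $ i)) * (1 / (1 + 4 * v $ i)) ^ (z $ i)"
  have v': "1 + 4 * v $ i > 0" for i using v[of i] by simp
  have "ennreal (1 / 2 * ?P) = (\<integral>\<^sup>+u\<in>{1<..2::real}. ennreal (1 / 2 * ?P) \<partial>lborel)"
    by (simp add: nn_integral_cmult_indicator)
  also have "\<dots> \<le> (\<integral>\<^sup>+u\<in>{1<..}. ennreal (u powr (\<alpha> - 1)) * (\<Prod>i\<in>UNIV. gaussian_average (\<eta> $ i) (v $ i) (z $ i) u) \<partial>lborel)"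
  proof (intro nn_integral_mono)
    fix u :: real
    show "ennreal (1 / 2 * ?P) * indicator {1<..2::real} u \<le> ennreal (u powr (\<alpha> - 1)) * (\<Prod>i\<in>UNIV. gaussian_average (\<eta> $ i) (v $ i) (z $ i) u) * indicator {1<..} u"
    proof (cases "u \<in> {1<..2}")
      case True
      then have u: "1 < u" "u \<le> 2" by auto
      have "1 / 2 \<le> u powr (- 1)" using u by (simp add: powr_minus field_simps)
      also have "\<dots> \<le> u powr (\<alpha> - 1)" using u \<alpha> by (intro powr_mono) auto
      finally have 1: "ennreal (1 / 2) \<le> ennreal (u powr (\<alpha> - 1))" by (rule ennreal_leI)
      have "ennreal ?P = (\<Prod>i\<in>UNIV. ennreal (exp (- 4 * (\<eta> $ i)\<^sup>2) * sqrt (1 / (1 + 4 * v $ i)) * (1 / (1 + 4 * v $ i)) ^ (z $ i)))"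
        using v' by (intro prod_ennreal[symmetric]) (auto intro!: mult_nonneg_nonneg simp: less_imp_le)
      also have "\<dots> \<le> (\<Prod>i\<in>UNIV. gaussian_average (\<eta> $ i) (v $ i) (z $ i) u)"
        using u v by (intro prod_mono_ennreal gaussian_average_ge) auto
      finally have "ennreal (1 / 2) * ennreal ?P \<le> ennreal (u powr (\<alpha> - 1)) * (\<Prod>i\<in>UNIV. gaussian_average (\<eta> $ i) (v $ i) (z $ i) u)"
        using 1 by (intro mult_mono) auto
      moreover have "ennreal (1 / 2 * ?P) = ennreal (1 / 2) * ennreal ?P" by (rule ennreal_mult') simp
      ultimately show ?thesis using True by simp
    qed simp
  qed
  finally show ?thesis .
qed

section \<open>Thinning of count vectors\<close>

lemma sum_box_prod:
  fixes f :: "'d::finite \<Rightarrow> nat \<Rightarrow> 'a::comm_semiring_1" and n :: "nat ^ 'd"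
  shows "(\<Sum>x\<in>{x. \<forall>i. x $ i \<le> n $ i}. \<Prod>i\<in>UNIV. f i (x $ i)) = (\<Prod>i\<in>UNIV. \<Sum>j\<le>n $ i. f i j)"
proof -
  have "(\<Prod>i\<in>UNIV. \<Sum>j\<le>n $ i. f i j) = (\<Sum>g\<in>PiE UNIV (\<lambda>i. {..n $ i}). \<Prod>i\<in>UNIV. f i (g i))"
    by (rule prod_sum_PiE) auto
  also have "\<dots> = (\<Sum>x\<in>{x. \<forall>i. x $ i \<le> n $ i}. \<Prod>i\<in>UNIV. f i (x $ i))"
    by (rule sum.reindex_bij_witness[where i = "\<lambda>x i. x $ i" and j = vec_lambda]) (auto simp: PiE_def Pi_def)
  finally show ?thesis ..
qed

lemma finite_box: "finite {x :: nat ^ 'd. \<forall>i. x $ i \<le> n $ i}"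
proof -
  have "{x :: nat ^ 'd. \<forall>i. x $ i \<le> n $ i} \<subseteq> vec_lambda ` (PiE UNIV (\<lambda>i. {..n $ i}))"
  proof
    fix x :: "nat ^ 'd" assume "x \<in> {x. \<forall>i. x $ i \<le> n $ i}"
    then have "(\<lambda>i. x $ i) \<in> PiE UNIV (\<lambda>i. {..n $ i})" by auto
    then show "x \<in> vec_lambda ` (PiE UNIV (\<lambda>i. {..n $ i}))" by (metis image_eqI vec_nth_inverse)
  qed
  then show ?thesis by (rule finite_subset) (auto intro!: finite_imageI finite_PiE)
qed

definition binom_vec :: "real ^ 'd \<Rightarrow> nat ^ 'd \<Rightarrow> nat ^ 'd \<Rightarrow> real" where
  "binom_vec p n x = (\<Prod>i\<in>UNIV. real (n $ i choose x $ i) * (p $ i) ^ (x $ i) * (1 - p $ i) ^ (n $ i - x $ i))"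

text \<open>The substitution \<open>w = u / (1 + u)\<close> turns the left-hand side into an integral over \<open>0 < w < 1\<close>
  whose integrand has the additional factor \<open>(1 - w) powr (d / 2 - \<alpha> - 1) \<le> 1\<close>.\<close>

lemma power_average_thinning_less:
  fixes \<eta> v v' p :: "real ^ 'd"
  assumes v': "\<And>i. v' $ i > 0" and v: "\<And>i. v $ i = v' $ i + 1" and p: "\<And>i. p $ i = v' $ i / (v' $ i + 1)"
    and \<alpha>: "0 < \<alpha>" "\<alpha> \<le> (real CARD('d) - 2) / 2"
  shows "(\<Sum>x\<in>{x. \<forall>i. x $ i \<le> n $ i}. ennreal (binom_vec p n x) * power_average \<alpha> \<eta> v x) < power_average \<alpha> \<eta> v' n"
proof -
  let ?box = "{x. \<forall>i. x $ i \<le> n $ i}"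
  let ?b = "\<lambda>i j. real (n $ i choose j) * (p $ i) ^ j * (1 - p $ i) ^ (n $ i - j)"
  have p01: "0 \<le> p $ i" "p $ i \<le> 1" for i using v'[of i] by (auto simp: p)
  have b0: "?b i j \<ge> 0" for i j using p01[of i] by (intro mult_nonneg_nonneg) auto
  \<comment> \<open>The exponent of 1 - w after the substitution. It is nonnegative exactly when
    \<open>\<alpha> \<le> (real CARD('d) - 2) / 2\<close>, the range in which the power is
    superharmonic.\<close>
  define \<beta> where "\<beta> = real CARD('d) / 2 - \<alpha> - 1"
  have \<beta>: "\<beta> \<ge> 0" using \<alpha> by (simp add: \<beta>_def field_simps)
  define G where "G w = (\<Prod>i\<in>UNIV. gaussian_average (\<eta> $ i) (v' $ i) (n $ i) w)" for w
  have [measurable]: "G \<in> borel_measurable borel" unfolding G_def[abs_def] by measurable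
  define f where "f w = ennreal (w powr (\<alpha> - 1) * (1 - w) powr \<beta>) * G w" for w
  have [measurable]: "f \<in> borel_measurable borel" unfolding f_def[abs_def] by measurable
  have "(\<Sum>x\<in>?box. ennreal (binom_vec p n x) * power_average \<alpha> \<eta> v x) =
    (\<integral>\<^sup>+u\<in>{0<..}. ennreal (u powr (\<alpha> - 1)) * (\<Sum>x\<in>?box. ennreal (binom_vec p n x) * (\<Prod>i\<in>UNIV. gaussian_average (\<eta> $ i) (v $ i) (x $ i) u)) \<partial>lborel)"
  proof -
    have "(\<Sum>x\<in>?box. ennreal (binom_vec p n x) * power_average \<alpha> \<eta> v x) =
      (\<Sum>x\<in>?box. \<integral>\<^sup>+u. ennreal (binom_vec p n x) * (ennreal (u powr (\<alpha> - 1)) * (\<Prod>i\<in>UNIV. gaussian_average (\<eta> $ i) (v $ i) (x $ i) u) * indicator {0<..} u) \<partial>lborel)"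
      unfolding power_average_def by (intro sum.cong refl nn_integral_cmult[symmetric]) measurable
    also have "\<dots> = (\<integral>\<^sup>+u. (\<Sum>x\<in>?box. ennreal (binom_vec p n x) * (ennreal (u powr (\<alpha> - 1)) * (\<Prod>i\<in>UNIV. gaussian_average (\<eta> $ i) (v $ i) (x $ i) u) * indicator {0<..} u)) \<partial>lborel)"
      by (intro nn_integral_sum[symmetric]) measurable
    also have "\<dots> = (\<integral>\<^sup>+u\<in>{0<..}. ennreal (u powr (\<alpha> - 1)) * (\<Sum>x\<in>?box. ennreal (binom_vec p n x) * (\<Prod>i\<in>UNIV. gaussian_average (\<eta> $ i) (v $ i) (x $ i) u)) \<partial>lborel)"
      by (intro nn_integral_cong) (simp add: sum_distrib_left sum_distrib_right mult_ac)
    finally show ?thesis .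
  qed
  also have "\<dots> = (\<integral>\<^sup>+u\<in>{0<..}. f (u / (1 + u)) * ennreal (1 / (1 + u)\<^sup>2) \<partial>lborel)"
  proof (intro nn_integral_cong)
    fix u :: real
    show "ennreal (u powr (\<alpha> - 1)) * (\<Sum>x\<in>?box. ennreal (binom_vec p n x) * (\<Prod>i\<in>UNIV. gaussian_average (\<eta> $ i) (v $ i) (x $ i) u)) * indicator {0<..} u =
      f (u / (1 + u)) * ennreal (1 / (1 + u)\<^sup>2) * indicator {0<..} u"
    proof (cases "u > 0")
      case u: True
      have "(\<Sum>x\<in>?box. ennreal (binom_vec p n x) * (\<Prod>i\<in>UNIV. gaussian_average (\<eta> $ i) (v $ i) (x $ i) u)) =
        (\<Sum>x\<in>?box. \<Prod>i\<in>UNIV. ennreal (?b i (x $ i)) * gaussian_average (\<eta> $ i) (v $ i) (x $ i) u)"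
      proof (intro sum.cong refl)
        fix x
        have "ennreal (binom_vec p n x) = (\<Prod>i\<in>UNIV. ennreal (?b i (x $ i)))"
          unfolding binom_vec_def using b0 by (rule prod_ennreal[symmetric])
        then show "ennreal (binom_vec p n x) * (\<Prod>i\<in>UNIV. gaussian_average (\<eta> $ i) (v $ i) (x $ i) u) =
          (\<Prod>i\<in>UNIV. ennreal (?b i (x $ i)) * gaussian_average (\<eta> $ i) (v $ i) (x $ i) u)"
          by (simp only: prod.distrib)
      qed
      also have "\<dots> = (\<Prod>i\<in>UNIV. \<Sum>j\<le>n $ i. ennreal (?b i j) * gaussian_average (\<eta> $ i) (v $ i) j u)"
        by (rule sum_box_prod)
      also have "\<dots> = (\<Prod>i\<in>UNIV. ennreal (1 / sqrt (1 + u)) * gaussian_average (\<eta> $ i) (v' $ i) (n $ i) (u / (1 + u)))"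
        unfolding v p by (simp only: gaussian_average_thinning[OF v' u])
      also have "\<dots> = ennreal ((1 / sqrt (1 + u)) ^ CARD('d)) * G (u / (1 + u))"
        using u by (simp add: prod.distrib G_def ennreal_power)
      also have "(1 / sqrt (1 + u)) ^ CARD('d) = (1 + u) powr (- (real CARD('d) / 2))"
      proof -
        have "1 / sqrt (1 + u) = (1 + u) powr (- (1 / 2))"
          using u by (simp add: powr_minus powr_half_sqrt field_simps)
        then show ?thesis using u by (simp add: powr_realpow[symmetric] powr_powr)
      qed
      finally have "ennreal (u powr (\<alpha> - 1)) * (\<Sum>x\<in>?box. ennreal (binom_vec p n x) * (\<Prod>i\<in>UNIV. gaussian_average (\<eta> $ i) (v $ i) (x $ i) u)) =
         ennreal (u powr (\<alpha> - 1) * (1 + u) powr (- (real CARD('d) / 2))) * G (u / (1 + u))"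
        by (simp add: ennreal_mult' mult.assoc)
      also have "u powr (\<alpha> - 1) * (1 + u) powr (- (real CARD('d) / 2)) =
        (u / (1 + u)) powr (\<alpha> - 1) * (1 - u / (1 + u)) powr \<beta> * (1 / (1 + u)\<^sup>2)"
      proof -
        have 1: "1 - u / (1 + u) = 1 / (1 + u)" using u by (simp add: field_simps)
        have 2: "1 / (1 + u)\<^sup>2 = (1 + u) powr (- 2)" using u by (simp add: powr_minus inverse_eq_divide)
        \<comment> \<open>The exponents of 1 + u contributed by w powr (\<alpha> - 1), by (1 - w)
          powr \<beta> and by the Jacobian.\<close>
        have 3: "- (real CARD('d) / 2) = (1 - \<alpha>) + (- \<beta>) + (- 2)" by (simp add: \<beta>_def)
        show ?thesis unfolding 1 2 3 powr_add using u
          by (simp add: powr_divide powr_minus powr_diff field_simps)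
      qed
      finally show ?thesis by (simp add: f_def ennreal_mult'[symmetric] mult_ac)
    qed simp
  qed
  also have "\<dots> \<le> (\<integral>\<^sup>+u\<in>{0..}. f (u / (1 + u)) * ennreal (1 / (1 + u)\<^sup>2) \<partial>lborel)"
    by (intro nn_integral_mono) (auto simp: indicator_def)
  also have "\<dots> = (\<integral>\<^sup>+x\<in>(\<Union>n. {0 / (1 + 0)..real (Suc n) / (1 + real (Suc n))}). f x \<partial>lborel)"
  proof (rule nn_integral_substitution_Ici)
    show "((\<lambda>u. u / (1 + u)) has_real_derivative 1 / (1 + x)\<^sup>2) (at x)" if "x \<ge> 0" for x :: real
      using that by (auto intro!: derivative_eq_intros simp: field_simps power2_eq_square)
    show "continuous_on {0..} (\<lambda>x::real. 1 / (1 + x)\<^sup>2)"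
      by (intro continuous_intros) (auto simp: add_nonneg_eq_0_iff)
  qed auto
  also have "\<dots> \<le> (\<integral>\<^sup>+w\<in>{0<..1}. ennreal (w powr (\<alpha> - 1)) * G w \<partial>lborel)"
  proof (rule nn_integral_mono)
    fix w :: real
    show "f w * indicator (\<Union>n. {0 / (1 + 0)..real (Suc n) / (1 + real (Suc n))}) w \<le> ennreal (w powr (\<alpha> - 1)) * G w * indicator {0<..1} w"
    proof (cases "w \<in> {0<..1}")
      case True
      have "(1 - w) powr \<beta> \<le> 1" using True \<beta> by (intro powr_le1) auto
      then have "w powr (\<alpha> - 1) * (1 - w) powr \<beta> \<le> w powr (\<alpha> - 1)" by (intro mult_left_le) auto
      then have "f w \<le> ennreal (w powr (\<alpha> - 1)) * G w" unfolding f_def by (intro mult_right_mono ennreal_leI) auto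
      then show ?thesis using True by (auto simp: indicator_def)
    next
      \<comment> \<open>Outside \<open>{0<..1}\<close> the substitution reaches only the point 0,
        where \<open>f\<close> vanishes because \<open>0 powr (\<alpha> - 1) = 0\<close>.\<close>
      case False
      have "w = 0" if w: "w \<in> {0 / (1 + 0)..real (Suc n) / (1 + real (Suc n))}" for n
      proof -
        have "real (Suc n) / (1 + real (Suc n)) \<le> 1" by simp
        with w have "0 \<le> w" "w \<le> 1" by (simp, meson atLeastAtMost_iff order_trans)
        with False show ?thesis by auto
      qed
      then have "w \<notin> (\<Union>n. {0 / (1 + 0)..real (Suc n) / (1 + real (Suc n))}) \<or> w = 0"
        by blast
      then show ?thesis by (auto simp: f_def)
    qed
  qed
  finally have le: "(\<Sum>x\<in>?box. ennreal (binom_vec p n x) * power_average \<alpha> \<eta> v x) \<le> (\<integral>\<^sup>+w\<in>{0<..1}. ennreal (w powr (\<alpha> - 1)) * G w \<partial>lborel)" (is "_ \<le> ?A") .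
  \<comment> \<open>The part of the mixture with w > 1, which \<open>u / (1 + u)\<close> never
    reaches. Its positivity, together with the finiteness of the other part, gives
    strictness.\<close>
  define B where "B = (\<integral>\<^sup>+w\<in>{1<..}. ennreal (w powr (\<alpha> - 1)) * G w \<partial>lborel)"
  have "1 + 4 * v' $ i > 0" for i using v'[of i] by simp
  then have "0 < ennreal (1 / 2 * (\<Prod>i\<in>UNIV. exp (- 4 * (\<eta> $ i)\<^sup>2) * sqrt (1 / (1 + 4 * v' $ i)) * (1 / (1 + 4 * v' $ i)) ^ (n $ i)))"
    by (auto intro!: mult_pos_pos prod_pos)
  also have "\<dots> \<le> B" unfolding B_def G_def by (rule power_average_ge[OF v' \<alpha>(1)])
  finally have B: "B > 0" .
  have split: "power_average \<alpha> \<eta> v' n = ?A + B"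
    unfolding power_average_def B_def G_def
    by (subst nn_integral_add[symmetric]) (auto intro!: nn_integral_cong simp: indicator_def)
  obtain C where "power_average \<alpha> \<eta> v' n \<le> ennreal (C * (\<Prod>i\<in>UNIV. 2 ^ (n $ i)))"
    using power_average_le[of v' \<alpha> \<eta>] v' \<alpha> by (auto simp: field_simps)
  then have "?A + B < \<top>" unfolding split using ennreal_less_top le_less_trans by blast
  then have "?A < ?A + B" using B ennreal_add_left_cancel_less[of ?A 0 B]
    by (cases "?A = \<top>") auto
  then show ?thesis unfolding split by (rule le_less_trans[OF le])
qed

section \<open>Integrals against the gamma weights\<close>

text \<open>Turns the two signs of a root into the two half lines; the point 0 is null.\<close>

lemma nn_integral_reflect_split:
  fixes h :: "real \<Rightarrow> ennreal"
  assumes [measurable]: "h \<in> borel_measurable borel"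
  shows "(\<integral>\<^sup>+x\<in>{0<..}. h x + h (- x) \<partial>lborel) = (\<integral>\<^sup>+x. h x \<partial>lborel)"
proof -
  have "(\<integral>\<^sup>+x\<in>{0<..}. h x + h (- x) \<partial>lborel) =
    (\<integral>\<^sup>+x\<in>{0<..}. h x \<partial>lborel) + (\<integral>\<^sup>+x\<in>{0<..}. h (- x) \<partial>lborel)"
    by (subst nn_integral_add[symmetric]) (auto intro!: nn_integral_cong simp: distrib_right)
  also have "(\<integral>\<^sup>+x\<in>{0<..}. h (- x) \<partial>lborel) = (\<integral>\<^sup>+x\<in>{..<0}. h x \<partial>lborel)"
    by (subst (2) nn_integral_real_affine[where c = "- 1" and t = 0])
       (auto intro!: nn_integral_cong simp: indicator_def)
  also have "(\<integral>\<^sup>+x\<in>{0<..}. h x \<partial>lborel) + (\<integral>\<^sup>+x\<in>{..<0}. h x \<partial>lborel) =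
    (\<integral>\<^sup>+x. h x * indicator {0<..} x + h x * indicator {..<0} x \<partial>lborel)"
    by (subst nn_integral_add) auto
  also have "\<dots> = (\<integral>\<^sup>+x. h x \<partial>lborel)"
    using AE_lborel_singleton[of 0] by (intro nn_integral_cong_AE) (auto elim!: eventually_mono simp: indicator_def)
  finally show ?thesis .
qed

definition gaussian_sign_sum :: "real \<Rightarrow> real \<Rightarrow> real \<Rightarrow> real \<Rightarrow> ennreal" where
  "gaussian_sign_sum \<gamma> \<eta> u l = (\<Sum>a\<in>{1, - 1}. ennreal (exp (- (u * (a * sqrt (l / \<gamma>) - \<eta>)\<^sup>2))))"

lemma borel_measurable_vec_nth_compose [measurable (raw)]:
  fixes f :: "'a \<Rightarrow> real ^ 'd"
  assumes "f \<in> borel_measurable M"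
  shows "(\<lambda>x. f x $ i) \<in> borel_measurable M"
  using assms borel_measurable_nth by (rule measurable_compose)

lemma borel_measurable_gaussian_sign_sum [measurable (raw)]:
  assumes [measurable]: "u \<in> borel_measurable M" "l \<in> borel_measurable M"
  shows "(\<lambda>x. gaussian_sign_sum \<gamma> \<eta> (u x) (l x)) \<in> borel_measurable M"
  unfolding gaussian_sign_sum_def by measurable

definition gamma_weight :: "real \<Rightarrow> nat \<Rightarrow> real \<Rightarrow> real" where
  "gamma_weight c k l = l ^ k * exp (- (c * l)) * l powr (- (1 / 2))"

lemma borel_measurable_gamma_weight [measurable]: "gamma_weight c k \<in> borel_measurable borel"
  unfolding gamma_weight_def[abs_def] by measurable

definition gamma_mass :: "real \<Rightarrow> nat \<Rightarrow> real" where
  "gamma_mass c k = half_gamma k / (c ^ k * sqrt c)"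

lemma gamma_mass_pos [simp]: "c > 0 \<Longrightarrow> gamma_mass c k > 0"
  by (simp add: gamma_mass_def)

text \<open>Under l = \<gamma> x^2 the Jeffreys factor and the Jacobian cancel to the constant
  \<open>2 * sqrt \<gamma>\<close>. What remains is the even density x^(2k) exp (- x^2 / v) with v =
  1 / (c \<gamma>), and the two signs cover the whole line.\<close>

lemma nn_integral_gamma_weight_gaussian_sign_sum:
  fixes c \<gamma> \<eta> u :: real
  assumes c: "c > 0" and \<gamma>: "\<gamma> > 0"
  shows "(\<integral>\<^sup>+l\<in>{0<..}. ennreal (gamma_weight c k l) * gaussian_sign_sum \<gamma> \<eta> u l \<partial>lborel) =
    ennreal (2 * gamma_mass c k) * gaussian_average \<eta> (1 / (c * \<gamma>)) k u"
proof -
  define v where "v = 1 / (c * \<gamma>)"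
  have v: "v > 0" using c \<gamma> by (simp add: v_def)
  define f where "f l = ennreal (gamma_weight c k l) * gaussian_sign_sum \<gamma> \<eta> u l * indicator {0<..} l" for l
  have [measurable]: "f \<in> borel_measurable borel"
    unfolding f_def[abs_def] gaussian_sign_sum_def[abs_def] by measurable
  define h where "h x = ennreal (sqrt_gamma_density v k x * exp (- (u * (x - \<eta>)\<^sup>2)))" for x
  have [measurable]: "h \<in> borel_measurable borel" unfolding h_def[abs_def] by measurable
  have U: "(\<Union>n. {\<gamma> * 0\<^sup>2..\<gamma> * (real (Suc n))\<^sup>2}) = {0..}"
  proof (intro equalityI subsetI)
    fix x :: real assume x: "x \<in> {0..}"
    obtain n where "x / \<gamma> \<le> real n" using real_arch_simple by blast
    then have "x \<le> \<gamma> * real n" using \<gamma> by (simp add: field_simps)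
    also have "real n \<le> (real (Suc n))\<^sup>2" by (simp add: power2_eq_square algebra_simps)
    finally have "x \<le> \<gamma> * (real (Suc n))\<^sup>2" using \<gamma> by simp
    with x show "x \<in> (\<Union>n. {\<gamma> * 0\<^sup>2..\<gamma> * (real (Suc n))\<^sup>2})" by auto
  qed auto
  have "(\<integral>\<^sup>+l\<in>{0<..}. ennreal (gamma_weight c k l) * gaussian_sign_sum \<gamma> \<eta> u l \<partial>lborel) = (\<integral>\<^sup>+l\<in>{0..}. f l \<partial>lborel)"
    by (intro nn_integral_cong) (auto simp: f_def indicator_def)
  also have "\<dots> = (\<integral>\<^sup>+l\<in>(\<Union>n. {\<gamma> * 0\<^sup>2..\<gamma> * (real (Suc n))\<^sup>2}). f l \<partial>lborel)"
    by (simp only: U)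
  also have "\<dots> = (\<integral>\<^sup>+x\<in>{0..}. f (\<gamma> * x\<^sup>2) * ennreal (2 * \<gamma> * x) \<partial>lborel)"
    by (rule nn_integral_substitution_Ici[symmetric, where g = "\<lambda>x. \<gamma> * x\<^sup>2"])
       (use \<gamma> in \<open>auto intro!: derivative_eq_intros continuous_intros\<close>)
  also have "\<dots> = (\<integral>\<^sup>+x. ennreal (2 * gamma_mass c k) * ((h x + h (- x)) * indicator {0<..} x) \<partial>lborel)"
  proof (intro nn_integral_cong)
    fix x :: real
    show "f (\<gamma> * x\<^sup>2) * ennreal (2 * \<gamma> * x) * indicator {0..} x = ennreal (2 * gamma_mass c k) * ((h x + h (- x)) * indicator {0<..} x)"
    proof (cases "x > 0")
      case x: True
      have gs: "gaussian_sign_sum \<gamma> \<eta> u (\<gamma> * x\<^sup>2) = ennreal (exp (- (u * (x - \<eta>)\<^sup>2))) + ennreal (exp (- (u * (- x - \<eta>)\<^sup>2)))"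
        using \<gamma> x by (simp add: gaussian_sign_sum_def)
      have gw: "gamma_weight c k (\<gamma> * x\<^sup>2) * (2 * \<gamma> * x) = 2 * gamma_mass c k * sqrt_gamma_density v k x"
      proof -
        have p1: "(\<gamma> * x\<^sup>2) powr (- (1 / 2)) = 1 / (sqrt \<gamma> * x)"
          using \<gamma> x by (simp add: powr_minus powr_half_sqrt real_sqrt_mult field_simps)
        have p2: "\<gamma> * x = sqrt \<gamma> * (sqrt \<gamma> * x)" using \<gamma> by (simp add: mult.assoc[symmetric])
        have p3: "1 / t * (2 * (g * t)) = 2 * g" if "t \<noteq> 0" for g t :: real using that by simp
        have pw: "(\<gamma> * x\<^sup>2) powr (- (1 / 2)) * (2 * \<gamma> * x) = 2 * sqrt \<gamma>"
          unfolding mult.assoc p2 p1 by (rule p3) (use \<gamma> x in simp)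
        have ex: "x\<^sup>2 / v = c * (\<gamma> * x\<^sup>2)" using c \<gamma> by (simp add: v_def)
        have "gamma_weight c k (\<gamma> * x\<^sup>2) * (2 * \<gamma> * x) = (\<gamma> * x\<^sup>2) ^ k * exp (- (c * (\<gamma> * x\<^sup>2))) * (2 * sqrt \<gamma>)"
          unfolding gamma_weight_def pw[symmetric] by simp
        also have "\<dots> = 2 * gamma_mass c k * sqrt_gamma_density v k x"
        proof -
          have 1: "v ^ k = 1 / (c ^ k * \<gamma> ^ k)" "sqrt v = 1 / (sqrt c * sqrt \<gamma>)"
            by (simp_all add: v_def power_divide power_mult_distrib real_sqrt_divide real_sqrt_mult)
          have 2: "G * X * E * (2 * g') = 2 * (H / (C * c')) * (X * E / (1 / (C * G) * (1 / (c' * g')) * H))"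
            if "G \<noteq> 0" "C \<noteq> 0" "H \<noteq> 0" "c' \<noteq> 0" for G X E g' H C c' :: real
            using that by (simp add: field_simps)
          show ?thesis
            unfolding sqrt_gamma_density_def ex gamma_mass_def power_mult[of x 2 k] power_mult_distrib[of \<gamma> "x\<^sup>2" k] 1
            by (rule 2) (use c \<gamma> less_imp_neq[OF half_gamma_pos[of k]] in auto)
        qed
        finally show ?thesis .
      qed
      have dens: "sqrt_gamma_density v k (- x) = sqrt_gamma_density v k x" "0 \<le> sqrt_gamma_density v k x" using v by (simp_all add: sqrt_gamma_density_def sqrt_gamma_density_nonneg[unfolded sqrt_gamma_density_def])
      have hg: "0 \<le> 2 * gamma_mass c k" using c by (simp add: less_imp_le)
      have "f (\<gamma> * x\<^sup>2) * ennreal (2 * \<gamma> * x) = ennreal (gamma_weight c k (\<gamma> * x\<^sup>2)) * ennreal (2 * \<gamma> * x) * gaussian_sign_sum \<gamma> \<eta> u (\<gamma> * x\<^sup>2)"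
        using \<gamma> x by (simp add: f_def mult_ac)
      also have "ennreal (gamma_weight c k (\<gamma> * x\<^sup>2)) * ennreal (2 * \<gamma> * x) = ennreal (2 * gamma_mass c k * sqrt_gamma_density v k x)"
        unfolding gw[symmetric] using \<gamma> x by (intro ennreal_mult''[symmetric]) simp
      also have "\<dots> = ennreal (2 * gamma_mass c k) * ennreal (sqrt_gamma_density v k x)"
        using hg by (rule ennreal_mult')
      also have "\<dots> * gaussian_sign_sum \<gamma> \<eta> u (\<gamma> * x\<^sup>2) = ennreal (2 * gamma_mass c k) * (h x + h (- x))"
        unfolding gs h_def dens(1) ennreal_mult'[OF dens(2)] by (simp only: distrib_left mult.assoc)
      finally have "f (\<gamma> * x\<^sup>2) * ennreal (2 * \<gamma> * x) = ennreal (2 * gamma_mass c k) * (h x + h (- x))" .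
      with x show ?thesis by simp
    next
      case False
      then show ?thesis by (auto simp: f_def indicator_def)
    qed
  qed
  also have "\<dots> = ennreal (2 * gamma_mass c k) * gaussian_average \<eta> v k u"
    by (subst nn_integral_cmult, measurable) (simp add: nn_integral_reflect_split gaussian_average_def h_def[symmetric])
  finally show ?thesis by (simp add: v_def)
qed

text \<open>The case u = 0 of the signed integral: both sign terms are 1 and the average is the
  total mass of a probability density.\<close>

lemma nn_integral_gamma_weight:
  assumes c: "c > 0"
  shows "(\<integral>\<^sup>+l\<in>{0<..}. ennreal (gamma_weight c k l) \<partial>lborel) = ennreal (gamma_mass c k)"
proof -
  have "gaussian_average 0 (1 / c) k 0 = 1" using c by (simp add: gaussian_average_def nn_integral_sqrt_gamma_density)
  moreover have "gaussian_sign_sum 1 0 0 l = 2" for l by (simp add: gaussian_sign_sum_def)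
  ultimately have "(\<integral>\<^sup>+l. 2 * (ennreal (gamma_weight c k l) * indicator {0<..} l) \<partial>lborel) = ennreal (2 * gamma_mass c k)"
    using nn_integral_gamma_weight_gaussian_sign_sum[OF c, of 1 k 0 0] by (simp add: mult_ac)
  then have "2 * (\<integral>\<^sup>+l\<in>{0<..}. ennreal (gamma_weight c k l) \<partial>lborel) = 2 * ennreal (gamma_mass c k)"
    using ennreal_mult'[of 2 "gamma_mass c k"] by (subst (asm) nn_integral_cmult) auto
  then show ?thesis by (simp add: ennreal_mult_cancel_left)
qed

section \<open>Factorization over the coordinates\<close>

lemma nn_integral_vec_prod:
  fixes f :: "'d::finite \<Rightarrow> real \<Rightarrow> ennreal"
  assumes [measurable]: "\<And>i. f i \<in> borel_measurable borel"
  shows "(\<integral>\<^sup>+x. (\<Prod>i\<in>UNIV. f i (x $ i)) \<partial>(lborel :: (real^'d) measure)) = (\<Prod>i\<in>UNIV. \<integral>\<^sup>+l. f i l \<partial>lborel)"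
proof -
  have ax: "axis_index (axis i (1::real)) = i" for i :: 'd
    using axis_index[of "axis i (1::real)"] by (auto simp: axis_in_Basis_iff axis_eq_axis)
  have B: "(\<Prod>b\<in>(Basis :: (real^'d) set). g b) = (\<Prod>i\<in>UNIV. g (axis i 1))" for g :: "real^'d \<Rightarrow> ennreal"
    by (rule prod.reindex_bij_witness[where i = "\<lambda>i. axis i 1" and j = axis_index])
       (auto simp: axis_in_Basis_iff ax axis_index[symmetric])
  have "(\<integral>\<^sup>+x. (\<Prod>b\<in>Basis. f (axis_index b) (x \<bullet> b)) \<partial>(lborel :: (real^'d) measure)) =
    (\<Prod>b\<in>(Basis :: (real^'d) set). \<integral>\<^sup>+l. f (axis_index b) l \<partial>lborel)"
    by (rule nn_integral_lborel_prod) auto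
  then show ?thesis unfolding B by (simp add: ax cart_eq_inner_axis)
qed

lemma sum_sign_vectors_prod:
  fixes f :: "'d::finite \<Rightarrow> real \<Rightarrow> 'a::comm_semiring_1"
  shows "(\<Sum>a\<in>(sign_vectors :: (real^'d) set). \<Prod>i\<in>UNIV. f i (a $ i)) = (\<Prod>i\<in>UNIV. \<Sum>b\<in>{1, - 1}. f i b)"
proof -
  have "(\<Prod>i\<in>UNIV. \<Sum>b\<in>{1, - 1}. f i b) = (\<Sum>g\<in>PiE UNIV (\<lambda>i. {1, - 1}). \<Prod>i\<in>UNIV. f i (g i))"
    by (rule prod_sum_PiE) auto
  also have "\<dots> = (\<Sum>x\<in>(sign_vectors :: (real^'d) set). \<Prod>i\<in>UNIV. f i (x $ i))"
    by (rule sum.reindex_bij_witness[where i = "\<lambda>x i. x $ i" and j = vec_lambda])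
       (auto simp: PiE_def Pi_def sign_vectors_def)
  finally show ?thesis ..
qed

text \<open>Euler's integral scaled by t = S u. At S = 0 the two sides differ, as the left one is 0
  by convention and the integral diverges.\<close>

lemma ennreal_powr_neg_eq_nn_integral:
  fixes S \<alpha> :: real
  assumes S: "S > 0" and \<alpha>: "\<alpha> > 0"
  shows "ennreal (S powr (- \<alpha>)) =
    ennreal (1 / Gamma \<alpha>) * (\<integral>\<^sup>+u\<in>{0<..}. ennreal (u powr (\<alpha> - 1) * exp (- (u * S))) \<partial>lborel)"
proof -
  have G: "Gamma \<alpha> > 0" using \<alpha> by (rule Gamma_real_pos)
  have "ennreal (Gamma \<alpha>) = (\<integral>\<^sup>+t\<in>{0..}. ennreal (t powr (\<alpha> - 1) / exp t) \<partial>lborel)"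
    by (rule nn_integral_has_integral_lebesgue'[symmetric]) (auto intro: Gamma_integral_real \<alpha>)
  also have "\<dots> = ennreal S * (\<integral>\<^sup>+u. ennreal ((S * u) powr (\<alpha> - 1) / exp (S * u)) * indicator {0..} (S * u) \<partial>lborel)"
    using S by (subst nn_integral_real_affine[where c = S and t = 0]) auto
  also have "(\<integral>\<^sup>+u. ennreal ((S * u) powr (\<alpha> - 1) / exp (S * u)) * indicator {0..} (S * u) \<partial>lborel) =
    (\<integral>\<^sup>+u. ennreal (S powr (\<alpha> - 1)) * (ennreal (u powr (\<alpha> - 1) * exp (- (u * S))) * indicator {0<..} u) \<partial>lborel)"
  proof (intro nn_integral_cong)
    fix u :: real
    consider "u < 0" | "u = 0" | "u > 0" by linarith
    then show "ennreal ((S * u) powr (\<alpha> - 1) / exp (S * u)) * indicator {0..} (S * u) =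
      ennreal (S powr (\<alpha> - 1)) * (ennreal (u powr (\<alpha> - 1) * exp (- (u * S))) * indicator {0<..} u)"
    proof cases
      case 1
      then have "S * u < 0" using S by (simp add: mult_pos_neg)
      with 1 show ?thesis by simp
    next
      case 3
      then show ?thesis using S by (simp add: powr_mult exp_minus ennreal_mult'[symmetric] field_simps)
    qed simp
  qed
  also have "\<dots> = ennreal (S powr (\<alpha> - 1)) * (\<integral>\<^sup>+u\<in>{0<..}. ennreal (u powr (\<alpha> - 1) * exp (- (u * S))) \<partial>lborel)"
    by (rule nn_integral_cmult) measurable
  finally have "ennreal (Gamma \<alpha>) = ennreal (S powr \<alpha>) * (\<integral>\<^sup>+u\<in>{0<..}. ennreal (u powr (\<alpha> - 1) * exp (- (u * S))) \<partial>lborel)"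
    using S by (simp add: mult.assoc[symmetric] ennreal_mult'[symmetric] powr_mult_base)
  then have "ennreal (S powr (- \<alpha>) / Gamma \<alpha>) * ennreal (Gamma \<alpha>) = ennreal (S powr (- \<alpha>) / Gamma \<alpha>) * ennreal (S powr \<alpha>) * (\<integral>\<^sup>+u\<in>{0<..}. ennreal (u powr (\<alpha> - 1) * exp (- (u * S))) \<partial>lborel)"
    by (simp add: mult.assoc)
  then show ?thesis
    using G S by (simp add: ennreal_mult''[symmetric] powr_minus field_simps)
qed

lemma jeffreys_pos: "lam \<in> orthant \<Longrightarrow> jeffreys lam > 0"
  unfolding jeffreys_def orthant_def by (intro prod_pos) (simp, metis less_irrefl)

lemma sets_orthant [measurable]: "(orthant :: (real^'d) set) \<in> sets borel"
proof -
  have "(orthant :: (real^'d) set) = {x \<in> space borel. \<forall>i. x $ i > 0}" by (auto simp: orthant_def)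
  also have "\<dots> \<in> sets borel" by measurable
  finally show ?thesis .
qed

definition poisson_weight :: "real ^ 'd \<Rightarrow> nat ^ 'd \<Rightarrow> real ^ 'd \<Rightarrow> real" where
  "poisson_weight c k lam = (\<Prod>i\<in>UNIV. lam $ i ^ (k $ i) * exp (- (c $ i * lam $ i)))"

lemma poisson_weight_jeffreys: "poisson_weight c k lam * jeffreys lam = (\<Prod>i\<in>UNIV. gamma_weight (c $ i) (k $ i) (lam $ i))"
  by (simp add: poisson_weight_def jeffreys_def gamma_weight_def prod.distrib)

lemma indicator_orthant: "indicator orthant (lam :: real^'d) = (\<Prod>i\<in>UNIV. indicator {0<..} (lam $ i) :: ennreal)"
  by (auto simp: indicator_def orthant_def)

lemma gamma_weight_nonneg: "l > 0 \<Longrightarrow> gamma_weight c k l \<ge> 0"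
  by (simp add: gamma_weight_def)

lemma nn_integral_jeffreys:
  fixes c :: "real ^ 'd"
  assumes c: "\<And>i. c $ i > 0"
  shows "(\<integral>\<^sup>+lam\<in>orthant. ennreal (poisson_weight c k lam * jeffreys lam) \<partial>lborel) =
    ennreal (\<Prod>i\<in>UNIV. gamma_mass (c $ i) (k $ i))"
proof -
  have "(\<integral>\<^sup>+lam\<in>orthant. ennreal (poisson_weight c k lam * jeffreys lam) \<partial>lborel) =
    (\<integral>\<^sup>+lam. (\<Prod>i\<in>UNIV. ennreal (gamma_weight (c $ i) (k $ i) (lam $ i)) * indicator {0<..} (lam $ i)) \<partial>(lborel :: (real^'d) measure))"
  proof (intro nn_integral_cong)
    fix lam :: "real^'d"
    show "ennreal (poisson_weight c k lam * jeffreys lam) * indicator orthant lam =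
      (\<Prod>i\<in>UNIV. ennreal (gamma_weight (c $ i) (k $ i) (lam $ i)) * indicator {0<..} (lam $ i))"
    proof (cases "lam \<in> orthant")
      case True
      then show ?thesis
        by (auto simp: poisson_weight_jeffreys prod.distrib indicator_orthant[symmetric] orthant_def
            intro!: prod_ennreal[symmetric] gamma_weight_nonneg)
    next
      case False
      then show ?thesis by (simp add: prod.distrib indicator_orthant[symmetric])
    qed
  qed
  also have "\<dots> = (\<Prod>i\<in>UNIV. ennreal (gamma_mass (c $ i) (k $ i)))"
    by (subst nn_integral_vec_prod) (auto simp: nn_integral_gamma_weight c)
  also have "\<dots> = ennreal (\<Prod>i\<in>UNIV. gamma_mass (c $ i) (k $ i))"
    using c by (intro prod_ennreal) (auto intro: less_imp_le)
  finally show ?thesis .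
qed

text \<open>After each summand is written as a Gaussian mixture and the integrals are exchanged, the
  integrand for fixed \<open>u\<close> is a product over coordinates, the sum over sign vectors
  being a product of two-term sums.\<close>

lemma nn_integral_shrinkage:
  fixes c \<gamma> \<eta> :: "real ^ 'd"
  assumes c: "\<And>i. c $ i > 0" and \<gamma>: "\<And>i. \<gamma> $ i > 0" and \<alpha>: "\<alpha> > 0"
  shows "(\<integral>\<^sup>+lam\<in>orthant. ennreal (poisson_weight c k lam * (f_sym \<eta> \<alpha> (\<chi> i. sqrt (lam $ i / \<gamma> $ i)) * jeffreys lam)) \<partial>lborel) =
    ennreal (2 ^ CARD('d) / Gamma \<alpha> * (\<Prod>i\<in>UNIV. gamma_mass (c $ i) (k $ i))) * power_average \<alpha> \<eta> (\<chi> i. 1 / (c $ i * \<gamma> $ i)) k"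
proof -
  define Sq where "Sq a lam = (\<Sum>i\<in>UNIV. (a $ i * sqrt (lam $ i / \<gamma> $ i) - \<eta> $ i)\<^sup>2)" for a lam :: "real^'d"
  define h where "h i l = ennreal (gamma_weight (c $ i) (k $ i) l) * indicator {0<..} l" for i l
  have [measurable]: "h i \<in> borel_measurable borel" for i unfolding h_def[abs_def] by measurable
  \<comment> \<open>Squaring forgets the signs, so all singular summands have their singularity at
    one and the same \<open>lam\<close>. Excluding this point yields an equality almost
    everywhere.\<close>
  have pt: "ennreal (poisson_weight c k lam * (f_sym \<eta> \<alpha> (\<chi> i. sqrt (lam $ i / \<gamma> $ i)) * jeffreys lam)) * indicator orthant lam =
    ennreal (1 / Gamma \<alpha>) * (\<integral>\<^sup>+u. ennreal (u powr (\<alpha> - 1)) * indicator {0<..} u * (\<Prod>i\<in>UNIV. h i (lam $ i) * gaussian_sign_sum (\<gamma> $ i) (\<eta> $ i) u (lam $ i)) \<partial>lborel)"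
    if ne: "lam \<noteq> (\<chi> i. \<gamma> $ i * (\<eta> $ i)\<^sup>2)" for lam
  proof (cases "lam \<in> orthant")
    case lam: True
    then have l: "lam $ i > 0" for i by (simp add: orthant_def)
    have S: "Sq a lam > 0" if a: "a \<in> sign_vectors" for a
    proof -
      have "Sq a lam \<noteq> 0"
      proof
        assume "Sq a lam = 0"
        then have "(a $ i * sqrt (lam $ i / \<gamma> $ i) - \<eta> $ i)\<^sup>2 = 0" for i
          unfolding Sq_def by (subst (asm) sum_nonneg_eq_0_iff) auto
        then have "(\<eta> $ i)\<^sup>2 = (a $ i)\<^sup>2 * (lam $ i / \<gamma> $ i)" for i
          using l[of i] \<gamma>[of i] by (metis eq_iff_diff_eq_0 power_mult_distrib real_sqrt_pow2 zero_le_divide_iff less_imp_le zero_eq_power2)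
        moreover have "(a $ i)\<^sup>2 = 1" for i using a by (auto simp: sign_vectors_def power2_eq_1_iff)
        ultimately have "lam = (\<chi> i. \<gamma> $ i * (\<eta> $ i)\<^sup>2)"
          using \<gamma> by (auto simp: vec_eq_iff less_imp_neq[symmetric])
        then show False using ne by simp
      qed
      moreover have "Sq a lam \<ge> 0" unfolding Sq_def by (intro sum_nonneg) auto
      ultimately show ?thesis by simp
    qed
    have J: "0 \<le> poisson_weight c k lam * jeffreys lam"
      unfolding poisson_weight_jeffreys using l by (intro prod_nonneg) (auto intro!: gamma_weight_nonneg)
    have "ennreal (poisson_weight c k lam * (f_sym \<eta> \<alpha> (\<chi> i. sqrt (lam $ i / \<gamma> $ i)) * jeffreys lam)) =
      ennreal (poisson_weight c k lam * jeffreys lam) * (\<Sum>a\<in>sign_vectors. ennreal (Sq a lam powr (- \<alpha>)))"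
      using J by (simp add: ennreal_mult'[symmetric] f_sym_def Sq_def mult_ac)
    also have "(\<Sum>a\<in>sign_vectors. ennreal (Sq a lam powr (- \<alpha>))) =
      (\<Sum>a\<in>sign_vectors. ennreal (1 / Gamma \<alpha>) * (\<integral>\<^sup>+u\<in>{0<..}. ennreal (u powr (\<alpha> - 1) * exp (- (u * Sq a lam))) \<partial>lborel))"
      by (intro sum.cong refl ennreal_powr_neg_eq_nn_integral S \<alpha>)
    also have "\<dots> = ennreal (1 / Gamma \<alpha>) * (\<integral>\<^sup>+u. (\<Sum>a\<in>sign_vectors. ennreal (u powr (\<alpha> - 1) * exp (- (u * Sq a lam))) * indicator {0<..} u) \<partial>lborel)"
      unfolding sum_distrib_left[symmetric] by (subst nn_integral_sum) auto
    also have "(\<integral>\<^sup>+u. (\<Sum>a\<in>sign_vectors. ennreal (u powr (\<alpha> - 1) * exp (- (u * Sq a lam))) * indicator {0<..} u) \<partial>lborel) =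
      (\<integral>\<^sup>+u. ennreal (u powr (\<alpha> - 1)) * indicator {0<..} u * (\<Prod>i\<in>UNIV. gaussian_sign_sum (\<gamma> $ i) (\<eta> $ i) u (lam $ i)) \<partial>lborel)"
    proof (intro nn_integral_cong)
      fix u :: real
      have "exp (- (u * Sq a lam)) = (\<Prod>i\<in>UNIV. exp (- (u * (a $ i * sqrt (lam $ i / \<gamma> $ i) - \<eta> $ i)\<^sup>2)))" for a
        by (simp add: Sq_def sum_distrib_left exp_sum sum_negf[symmetric])
      then have "(\<Sum>a\<in>sign_vectors. ennreal (exp (- (u * Sq a lam)))) = (\<Prod>i\<in>UNIV. gaussian_sign_sum (\<gamma> $ i) (\<eta> $ i) u (lam $ i))"
        unfolding gaussian_sign_sum_def sum_sign_vectors_prod[symmetric] by (simp add: prod_ennreal)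
      then show "(\<Sum>a\<in>sign_vectors. ennreal (u powr (\<alpha> - 1) * exp (- (u * Sq a lam))) * indicator {0<..} u) =
        ennreal (u powr (\<alpha> - 1)) * indicator {0<..} u * (\<Prod>i\<in>UNIV. gaussian_sign_sum (\<gamma> $ i) (\<eta> $ i) u (lam $ i))"
        by (simp add: ennreal_mult' sum_distrib_left[symmetric] sum_distrib_right[symmetric] mult_ac)
    qed
    also have "ennreal (poisson_weight c k lam * jeffreys lam) * (ennreal (1 / Gamma \<alpha>) * (\<integral>\<^sup>+u. ennreal (u powr (\<alpha> - 1)) * indicator {0<..} u * (\<Prod>i\<in>UNIV. gaussian_sign_sum (\<gamma> $ i) (\<eta> $ i) u (lam $ i)) \<partial>lborel))
      = ennreal (1 / Gamma \<alpha>) * (\<integral>\<^sup>+u. ennreal (poisson_weight c k lam * jeffreys lam) * (ennreal (u powr (\<alpha> - 1)) * indicator {0<..} u * (\<Prod>i\<in>UNIV. gaussian_sign_sum (\<gamma> $ i) (\<eta> $ i) u (lam $ i))) \<partial>lborel)"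
      by (subst nn_integral_cmult) (auto simp: mult_ac)
    also have "ennreal (poisson_weight c k lam * jeffreys lam) = (\<Prod>i\<in>UNIV. h i (lam $ i))"
      unfolding poisson_weight_jeffreys h_def using l
      by (subst prod_ennreal[symmetric]) (auto intro!: gamma_weight_nonneg)
    finally show ?thesis using lam by (simp add: prod.distrib mult_ac)
  next
    case False
    then obtain i where "\<not> lam $ i > 0" by (auto simp: orthant_def)
    then have "h i (lam $ i) = 0" by (simp add: h_def)
    then have P0: "(\<Prod>i\<in>UNIV. h i (lam $ i) * gaussian_sign_sum (\<gamma> $ i) (\<eta> $ i) u (lam $ i)) = 0" for u
      by (intro prod_zero) (auto intro!: bexI[of _ i])
    show ?thesis unfolding P0 using False by simp
  qed
  have "(\<integral>\<^sup>+lam\<in>orthant. ennreal (poisson_weight c k lam * (f_sym \<eta> \<alpha> (\<chi> i. sqrt (lam $ i / \<gamma> $ i)) * jeffreys lam)) \<partial>lborel) =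
    (\<integral>\<^sup>+lam. ennreal (1 / Gamma \<alpha>) * (\<integral>\<^sup>+u. ennreal (u powr (\<alpha> - 1)) * indicator {0<..} u * (\<Prod>i\<in>UNIV. h i (lam $ i) * gaussian_sign_sum (\<gamma> $ i) (\<eta> $ i) u (lam $ i)) \<partial>lborel) \<partial>lborel)"
    using AE_lborel_singleton[of "(\<chi> i. \<gamma> $ i * (\<eta> $ i)\<^sup>2)"]
    by (intro nn_integral_cong_AE) (auto elim!: eventually_mono simp: pt)
  also have "\<dots> = ennreal (1 / Gamma \<alpha>) * (\<integral>\<^sup>+lam. (\<integral>\<^sup>+u. ennreal (u powr (\<alpha> - 1)) * indicator {0<..} u * (\<Prod>i\<in>UNIV. h i (lam $ i) * gaussian_sign_sum (\<gamma> $ i) (\<eta> $ i) u (lam $ i)) \<partial>lborel) \<partial>lborel)"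
    by (rule nn_integral_cmult) measurable
  also have "(\<integral>\<^sup>+lam. (\<integral>\<^sup>+u. ennreal (u powr (\<alpha> - 1)) * indicator {0<..} u * (\<Prod>i\<in>UNIV. h i (lam $ i) * gaussian_sign_sum (\<gamma> $ i) (\<eta> $ i) u (lam $ i)) \<partial>lborel) \<partial>lborel) =
    (\<integral>\<^sup>+u. (\<integral>\<^sup>+lam. ennreal (u powr (\<alpha> - 1)) * indicator {0<..} u * (\<Prod>i\<in>UNIV. h i (lam $ i) * gaussian_sign_sum (\<gamma> $ i) (\<eta> $ i) u (lam $ i)) \<partial>(lborel :: (real^'d) measure)) \<partial>lborel)"
    by (rule lborel_pair.Fubini') measurable
  also have "\<dots> = (\<integral>\<^sup>+u. ennreal (\<Prod>i\<in>UNIV. 2 * gamma_mass (c $ i) (k $ i)) * (ennreal (u powr (\<alpha> - 1)) * (\<Prod>i\<in>UNIV. gaussian_average (\<eta> $ i) (1 / (c $ i * \<gamma> $ i)) (k $ i) u) * indicator {0<..} u) \<partial>lborel)"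
  proof (intro nn_integral_cong)
    fix u :: real
    have "(\<integral>\<^sup>+lam. ennreal (u powr (\<alpha> - 1)) * indicator {0<..} u * (\<Prod>i\<in>UNIV. h i (lam $ i) * gaussian_sign_sum (\<gamma> $ i) (\<eta> $ i) u (lam $ i)) \<partial>(lborel :: (real^'d) measure)) =
      ennreal (u powr (\<alpha> - 1)) * indicator {0<..} u * (\<integral>\<^sup>+lam. (\<Prod>i\<in>UNIV. h i (lam $ i) * gaussian_sign_sum (\<gamma> $ i) (\<eta> $ i) u (lam $ i)) \<partial>(lborel :: (real^'d) measure))"
      by (rule nn_integral_cmult) measurable
    also have "(\<integral>\<^sup>+lam. (\<Prod>i\<in>UNIV. h i (lam $ i) * gaussian_sign_sum (\<gamma> $ i) (\<eta> $ i) u (lam $ i)) \<partial>(lborel :: (real^'d) measure)) =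
      (\<Prod>i\<in>UNIV. \<integral>\<^sup>+l. h i l * gaussian_sign_sum (\<gamma> $ i) (\<eta> $ i) u l \<partial>lborel)"
      by (rule nn_integral_vec_prod) measurable
    also have "\<dots> = (\<Prod>i\<in>UNIV. ennreal (2 * gamma_mass (c $ i) (k $ i)) * gaussian_average (\<eta> $ i) (1 / (c $ i * \<gamma> $ i)) (k $ i) u)"
      unfolding nn_integral_gamma_weight_gaussian_sign_sum[OF c \<gamma>, symmetric] h_def
      by (intro prod.cong refl nn_integral_cong) (simp add: mult_ac)
    also have "\<dots> = ennreal (\<Prod>i\<in>UNIV. 2 * gamma_mass (c $ i) (k $ i)) * (\<Prod>i\<in>UNIV. gaussian_average (\<eta> $ i) (1 / (c $ i * \<gamma> $ i)) (k $ i) u)"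
      using c by (subst prod_ennreal[symmetric]) (auto simp: prod.distrib intro!: mult_nonneg_nonneg less_imp_le)
    finally show "(\<integral>\<^sup>+lam. ennreal (u powr (\<alpha> - 1)) * indicator {0<..} u * (\<Prod>i\<in>UNIV. h i (lam $ i) * gaussian_sign_sum (\<gamma> $ i) (\<eta> $ i) u (lam $ i)) \<partial>(lborel :: (real^'d) measure)) =
      ennreal (\<Prod>i\<in>UNIV. 2 * gamma_mass (c $ i) (k $ i)) * (ennreal (u powr (\<alpha> - 1)) * (\<Prod>i\<in>UNIV. gaussian_average (\<eta> $ i) (1 / (c $ i * \<gamma> $ i)) (k $ i) u) * indicator {0<..} u)"
      by (simp add: mult_ac)
  qed
  also have "\<dots> = ennreal (\<Prod>i\<in>UNIV. 2 * gamma_mass (c $ i) (k $ i)) * power_average \<alpha> \<eta> (\<chi> i. 1 / (c $ i * \<gamma> $ i)) k"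
    unfolding power_average_def by (subst nn_integral_cmult) auto
  also have "ennreal (1 / Gamma \<alpha>) * (ennreal (\<Prod>i\<in>UNIV. 2 * gamma_mass (c $ i) (k $ i)) * power_average \<alpha> \<eta> (\<chi> i. 1 / (c $ i * \<gamma> $ i)) k) =
    ennreal (2 ^ CARD('d) / Gamma \<alpha> * (\<Prod>i\<in>UNIV. gamma_mass (c $ i) (k $ i))) * power_average \<alpha> \<eta> (\<chi> i. 1 / (c $ i * \<gamma> $ i)) k"
    using Gamma_real_pos[OF \<alpha>] by (simp add: mult.assoc[symmetric] ennreal_mult'[symmetric] prod.distrib)
  finally show ?thesis .
qed

section \<open>Predictive distributions\<close>

lemma set_lebesgue_integral_nonneg_eq:
  fixes g :: "real ^ 'd \<Rightarrow> real"
  assumes [measurable]: "g \<in> borel_measurable borel" "A \<in> sets borel" and nn: "\<And>x. x \<in> A \<Longrightarrow> g x \<ge> 0"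
  shows "(LINT x:A|lborel. g x) = enn2real (\<integral>\<^sup>+x\<in>A. ennreal (g x) \<partial>lborel)"
proof -
  have "(LINT x:A|lborel. g x) = enn2real (\<integral>\<^sup>+x. ennreal (indicator A x *\<^sub>R g x) \<partial>lborel)"
    unfolding set_lebesgue_integral_def
    by (rule integral_eq_nn_integral) (auto simp: indicator_def nn)
  also have "(\<integral>\<^sup>+x. ennreal (indicator A x *\<^sub>R g x) \<partial>lborel) = (\<integral>\<^sup>+x\<in>A. ennreal (g x) \<partial>lborel)"
    by (intro nn_integral_cong) (auto simp: indicator_def)
  finally show ?thesis .
qed

text \<open>The part of the Poisson density free of \<lambda>. For \<open>r\<close> and
  \<open>x\<close> it cancels within the predictive ratio, for \<open>s\<close> and \<open>y\<close>
  in the comparison with the true density.\<close>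

definition poisson_coeff :: "real ^ 'd \<Rightarrow> nat ^ 'd \<Rightarrow> real" where
  "poisson_coeff r x = (\<Prod>i\<in>UNIV. r $ i ^ (x $ i) / fact (x $ i))"

lemma poisson_coeff_pos: "(\<And>i. r $ i > 0) \<Longrightarrow> poisson_coeff r x > 0"
  by (simp add: poisson_coeff_def prod_pos)

lemma poisson_prob_eq: "poisson_prob r lam x = poisson_coeff r x * poisson_weight r x lam"
  by (simp add: poisson_prob_def poisson_coeff_def poisson_weight_def prod.distrib prod_dividef power_mult_distrib)

lemma poisson_weight_mult: "poisson_weight r x lam * poisson_weight s y lam = poisson_weight (r + s) (x + y) lam"
proof -
  have "lam $ i ^ (x $ i) * exp (- (r $ i * lam $ i)) * (lam $ i ^ (y $ i) * exp (- (s $ i * lam $ i))) =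
    lam $ i ^ ((x + y) $ i) * exp (- ((r + s) $ i * lam $ i))" for i
  proof -
    have "exp (- ((r + s) $ i * lam $ i)) = exp (- (r $ i * lam $ i)) * exp (- (s $ i * lam $ i))"
      by (simp add: exp_add[symmetric] distrib_right)
    then show ?thesis by (simp add: power_add)
  qed
  then show ?thesis
    unfolding poisson_weight_def prod.distrib[symmetric] by simp
qed

lemma predictive_eq:
  assumes "\<And>i. r $ i > 0"
  shows "predictive r s \<pi> x y = poisson_coeff s y *
    (LINT lam:orthant|lborel. poisson_weight (r + s) (x + y) lam * \<pi> lam) / (LINT lam:orthant|lborel. poisson_weight r x lam * \<pi> lam)"
proof -
  have 1: "poisson_prob r lam x * poisson_prob s lam y * \<pi> lam =
    poisson_coeff r x * poisson_coeff s y * (poisson_weight (r + s) (x + y) lam * \<pi> lam)" for lam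
    unfolding poisson_prob_eq poisson_weight_mult[symmetric] by (simp only: mult_ac)
  have 2: "poisson_prob r lam x * \<pi> lam = poisson_coeff r x * (poisson_weight r x lam * \<pi> lam)" for lam
    unfolding poisson_prob_eq by (simp only: mult_ac)
  show ?thesis
    unfolding predictive_def 1 2 set_integral_mult_right
    using less_imp_neq[OF poisson_coeff_pos[OF assms, of x]] by simp
qed

lemma predictive_cong:
  assumes "\<And>lam. lam \<in> orthant \<Longrightarrow> \<pi> lam = K * \<pi>' lam" and K: "K \<noteq> 0"
  shows "predictive r s \<pi> = predictive r s \<pi>'"
proof (intro ext)
  fix x y
  have "(LINT lam:orthant|lborel. g lam * \<pi> lam) = K * (LINT lam:orthant|lborel. g lam * \<pi>' lam)" for g
  proof -
    have "(LINT lam:orthant|lborel. g lam * \<pi> lam) = (LINT lam:orthant|lborel. K * (g lam * \<pi>' lam))"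
      by (rule set_lebesgue_integral_cong) (auto simp: assms(1))
    then show ?thesis by simp
  qed
  then show "predictive r s \<pi> x y = predictive r s \<pi>' x y"
    using K by (simp add: predictive_def)
qed

lemma borel_measurable_poisson_weight [measurable]: "poisson_weight c k \<in> borel_measurable borel"
  unfolding poisson_weight_def[abs_def] by measurable

lemma borel_measurable_jeffreys [measurable]: "jeffreys \<in> borel_measurable borel"
  unfolding jeffreys_def[abs_def] by measurable

lemma borel_measurable_f_sym_sqrt [measurable]:
  "(\<lambda>lam. f_sym \<eta> \<alpha> (\<chi> i. sqrt (lam $ i / \<gamma> $ i))) \<in> borel_measurable borel"
  unfolding f_sym_def by simp measurable

lemma f_sym_nonneg: "f_sym \<eta> \<alpha> \<theta> \<ge> 0"
  unfolding f_sym_def by (intro sum_nonneg) auto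

lemma poisson_weight_nonneg: "lam \<in> orthant \<Longrightarrow> poisson_weight c k lam \<ge> 0"
  unfolding poisson_weight_def orthant_def by (intro prod_nonneg) (auto intro!: mult_nonneg_nonneg less_imp_le)

definition gamma_mass_vec :: "real ^ 'd \<Rightarrow> nat ^ 'd \<Rightarrow> real" where
  "gamma_mass_vec c k = (\<Prod>i\<in>UNIV. gamma_mass (c $ i) (k $ i))"

lemma gamma_mass_vec_pos: "(\<And>i. c $ i > 0) \<Longrightarrow> gamma_mass_vec c k > 0"
  by (simp add: gamma_mass_vec_def prod_pos)

lemma integral_jeffreys:
  assumes c: "\<And>i. c $ i > 0"
  shows "(LINT lam:orthant|lborel. poisson_weight c k lam * jeffreys lam) = gamma_mass_vec c k"
proof -
  have "(LINT lam:orthant|lborel. poisson_weight c k lam * jeffreys lam) =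
    enn2real (\<integral>\<^sup>+lam\<in>orthant. ennreal (poisson_weight c k lam * jeffreys lam) \<partial>lborel)"
    by (rule set_lebesgue_integral_nonneg_eq)
       (auto intro!: mult_nonneg_nonneg poisson_weight_nonneg less_imp_le[OF jeffreys_pos])
  then show ?thesis
    using less_imp_le[OF gamma_mass_vec_pos[OF c]] by (simp add: nn_integral_jeffreys[OF c] gamma_mass_vec_def[symmetric])
qed

lemma predictive_jeffreys:
  assumes "\<And>i. r $ i > 0" "\<And>i. s $ i > 0"
  shows "predictive r s jeffreys x y = poisson_coeff s y * gamma_mass_vec (r + s) (x + y) / gamma_mass_vec r x"
  using assms by (subst predictive_eq) (auto simp: integral_jeffreys add_pos_pos)

lemma integral_shrinkage:
  fixes c \<gamma> \<eta> :: "real ^ 'd"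
  assumes c: "\<And>i. c $ i > 0" and \<gamma>: "\<And>i. \<gamma> $ i > 0" and \<alpha>: "\<alpha> > 0"
  shows "(LINT lam:orthant|lborel. poisson_weight c k lam * (f_sym \<eta> \<alpha> (\<chi> i. sqrt (lam $ i / \<gamma> $ i)) * jeffreys lam)) =
    2 ^ CARD('d) / Gamma \<alpha> * gamma_mass_vec c k * enn2real (power_average \<alpha> \<eta> (\<chi> i. 1 / (c $ i * \<gamma> $ i)) k)"
proof -
  have "(LINT lam:orthant|lborel. poisson_weight c k lam * (f_sym \<eta> \<alpha> (\<chi> i. sqrt (lam $ i / \<gamma> $ i)) * jeffreys lam)) =
    enn2real (\<integral>\<^sup>+lam\<in>orthant. ennreal (poisson_weight c k lam * (f_sym \<eta> \<alpha> (\<chi> i. sqrt (lam $ i / \<gamma> $ i)) * jeffreys lam)) \<partial>lborel)"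
    by (rule set_lebesgue_integral_nonneg_eq)
       (auto intro!: mult_nonneg_nonneg poisson_weight_nonneg f_sym_nonneg less_imp_le[OF jeffreys_pos])
  also have "\<dots> = enn2real (ennreal (2 ^ CARD('d) / Gamma \<alpha> * gamma_mass_vec c k) * power_average \<alpha> \<eta> (\<chi> i. 1 / (c $ i * \<gamma> $ i)) k)"
    unfolding nn_integral_shrinkage[OF c \<gamma> \<alpha>] gamma_mass_vec_def ..
  also have "\<dots> = 2 ^ CARD('d) / Gamma \<alpha> * gamma_mass_vec c k * enn2real (power_average \<alpha> \<eta> (\<chi> i. 1 / (c $ i * \<gamma> $ i)) k)"
    using less_imp_le[OF gamma_mass_vec_pos[OF c]] less_imp_le[OF Gamma_real_pos[OF \<alpha>]]
    unfolding enn2real_mult by (subst enn2real_ennreal) auto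
  finally show ?thesis .
qed

lemma gam_pos: "(\<And>i. r $ i > 0) \<Longrightarrow> (\<And>i. s $ i > 0) \<Longrightarrow> gam r s $ i > 0"
  by (simp add: gam_def field_simps add_pos_pos)

definition power_mean :: "real \<Rightarrow> real ^ 'd \<Rightarrow> real ^ 'd \<Rightarrow> nat ^ 'd \<Rightarrow> real" where
  "power_mean \<alpha> \<eta> v z = enn2real (power_average \<alpha> \<eta> v z)"

text \<open>The factor \<open>2 ^ CARD('d) / Gamma \<alpha>\<close> depends neither on the rates nor
  on the counts and cancels; the gamma masses of numerator and denominator reproduce the Jeffreys
  predictive distribution.\<close>

lemma predictive_shrinkage:
  fixes r s \<eta> :: "real ^ 'd"
  assumes r: "\<And>i. r $ i > 0" and s: "\<And>i. s $ i > 0" and \<alpha>: "\<alpha> > 0"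
  shows "predictive r s (shrinkage_prior (theta_diff r s) (f_sym \<eta> \<alpha>)) x y =
    predictive r s jeffreys x y *
      (power_mean \<alpha> \<eta> (\<chi> i. 1 / ((r $ i + s $ i) * gam r s $ i)) (x + y) / power_mean \<alpha> \<eta> (\<chi> i. 1 / (r $ i * gam r s $ i)) x)"
proof -
  have rs: "(r + s) $ i > 0" for i using r[of i] s[of i] by simp
  note I = integral_shrinkage[OF _ gam_pos[OF r s] \<alpha>]
  show ?thesis
    unfolding predictive_jeffreys[OF r s] unfolding predictive_eq[OF r] shrinkage_prior_def theta_diff_def
    using Gamma_real_pos[OF \<alpha>]
    by (simp add: I[OF r] I[OF rs] power_mean_def)
qed

text \<open>With equal durations the two coordinate systems differ by the global factor
  \<open>sqrt g\<close>, and \<open>f_sym\<close> is homogeneous of degree - 2 \<alpha> jointly in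
  \<theta> and \<eta>. Rescaling \<eta> reduces this case to the general one.\<close>

lemma predictive_same_duration:
  fixes \<eta> :: "real ^ 'd" and r s :: real
  assumes r: "r > 0" and s: "s > 0"
  defines "g \<equiv> 1 / r - 1 / (r + s)"
  shows "predictive (\<chi> i. r) (\<chi> i. s) (shrinkage_prior theta_same (f_sym \<eta> \<alpha>)) =
    predictive (\<chi> i. r) (\<chi> i. s) (shrinkage_prior (theta_diff (\<chi> i. r) (\<chi> i. s)) (f_sym (\<chi> i. \<eta> $ i / sqrt g) \<alpha>))"
proof (rule predictive_cong)
  have g: "g > 0" using r s by (simp add: g_def field_simps add_pos_pos)
  then show "g powr (- \<alpha>) \<noteq> 0" by simp
  fix lam :: "real ^ 'd" assume lam: "lam \<in> orthant"
  have "f_sym \<eta> \<alpha> (theta_same lam) =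
     g powr (- \<alpha>) * f_sym (\<chi> i. \<eta> $ i / sqrt g) \<alpha> (theta_diff (\<chi> i. r) (\<chi> i. s) lam)"
    unfolding f_sym_def sum_distrib_left
  proof (intro sum.cong refl)
    fix a :: "real ^ 'd"
    have "(a $ i * theta_same lam $ i - \<eta> $ i)\<^sup>2 =
      g * (a $ i * theta_diff (\<chi> i. r) (\<chi> i. s) lam $ i - (\<chi> i. \<eta> $ i / sqrt g) $ i)\<^sup>2" for i
    proof -
      have "a $ i * theta_same lam $ i - \<eta> $ i =
        sqrt g * (a $ i * theta_diff (\<chi> i. r) (\<chi> i. s) lam $ i - (\<chi> i. \<eta> $ i / sqrt g) $ i)"
        using g by (simp add: theta_same_def theta_diff_def gam_def g_def[symmetric] real_sqrt_divide right_diff_distrib)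
      then show ?thesis using g by (simp add: power_mult_distrib)
    qed
    then have "(\<Sum>i\<in>UNIV. (a $ i * theta_same lam $ i - \<eta> $ i)\<^sup>2) =
      g * (\<Sum>i\<in>UNIV. (a $ i * theta_diff (\<chi> i. r) (\<chi> i. s) lam $ i - (\<chi> i. \<eta> $ i / sqrt g) $ i)\<^sup>2)"
      by (simp add: sum_distrib_left)
    then show "(\<Sum>i\<in>UNIV. (a $ i * theta_same lam $ i - \<eta> $ i)\<^sup>2) powr (- \<alpha>) = g powr (- \<alpha>) *
      (\<Sum>i\<in>UNIV. (a $ i * theta_diff (\<chi> i. r) (\<chi> i. s) lam $ i - (\<chi> i. \<eta> $ i / sqrt g) $ i)\<^sup>2) powr (- \<alpha>)"
      using g by (simp add: powr_mult sum_nonneg)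
  qed
  then show "shrinkage_prior theta_same (f_sym \<eta> \<alpha>) lam = g powr (- \<alpha>) *
    shrinkage_prior (theta_diff (\<chi> i. r) (\<chi> i. s)) (f_sym (\<chi> i. \<eta> $ i / sqrt g) \<alpha>) lam"
    by (simp add: shrinkage_prior_def)
qed

section \<open>Kullback-Leibler risk as a Poisson expectation\<close>

definition poisson_vec_pmf :: "real ^ 'd \<Rightarrow> (nat ^ 'd) pmf" where
  "poisson_vec_pmf m = map_pmf vec_lambda (Pi_pmf UNIV 0 (\<lambda>i. poisson_pmf (m $ i)))"

lemma pmf_poisson_vec_pmf: "pmf (poisson_vec_pmf m) x = (\<Prod>i\<in>UNIV. pmf (poisson_pmf (m $ i)) (x $ i))"
proof -
  have "pmf (poisson_vec_pmf m) (vec_lambda (\<lambda>i. x $ i)) = pmf (Pi_pmf UNIV 0 (\<lambda>i. poisson_pmf (m $ i))) (\<lambda>i. x $ i)"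
    unfolding poisson_vec_pmf_def by (rule pmf_map_inj') (auto simp: inj_on_def vec_lambda_inject)
  then show ?thesis by (simp add: pmf_Pi)
qed

lemma map_pmf_poisson_vec_pmf_nth: "map_pmf (\<lambda>x. x $ i) (poisson_vec_pmf m) = poisson_pmf (m $ i)"
  by (simp add: poisson_vec_pmf_def pmf.map_comp o_def Pi_pmf_component)

lemma pmf_poisson_pos: "m > 0 \<Longrightarrow> pmf (poisson_pmf m) k > 0"
  by simp

lemma pmf_poisson_vec_pmf_pos: "(\<And>i. m $ i > 0) \<Longrightarrow> pmf (poisson_vec_pmf m) x > 0"
  unfolding pmf_poisson_vec_pmf by (intro prod_pos) (simp add: pmf_poisson_pos)

text \<open>A common dominating function for the logarithms in the risk: multiplicative under
  addition of counts, larger than each count, and of finite mean under Poisson laws.\<close>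

definition pow2_weight :: "nat ^ 'd \<Rightarrow> real" where
  "pow2_weight x = (\<Prod>i\<in>UNIV. 2 ^ (x $ i))"

lemma pow2_weight_ge_1: "pow2_weight x \<ge> 1"
  by (simp add: pow2_weight_def prod_ge_1)

lemma pow2_weight_nonneg [simp]: "pow2_weight x \<ge> 0"
  using pow2_weight_ge_1[of x] by simp

lemma pow2_weight_add: "pow2_weight (x + y) = pow2_weight x * pow2_weight y"
  by (simp add: pow2_weight_def power_add prod.distrib)

lemma power_le_pow2_weight: "2 ^ (x $ i) \<le> pow2_weight x"
proof -
  have "pow2_weight x = 2 ^ (x $ i) * (\<Prod>j\<in>UNIV - {i}. 2 ^ (x $ j))"
    unfolding pow2_weight_def by (rule prod.remove) auto
  moreover have "(\<Prod>j\<in>UNIV - {i}. 2 ^ (x $ j)) \<ge> (1::real)" by (intro prod_ge_1) auto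
  ultimately show ?thesis by simp
qed

text \<open>Tilting by 2^k doubles the mean of a Poisson law and leaves the factor exp (2 m -
  m).\<close>

lemma nn_integral_poisson_power2:
  assumes m: "m > 0"
  shows "(\<integral>\<^sup>+k. ennreal (2 ^ k) \<partial>measure_pmf (poisson_pmf m)) = ennreal (exp m)"
proof -
  have "(\<integral>\<^sup>+k. ennreal (2 ^ k) \<partial>measure_pmf (poisson_pmf m)) =
    (\<integral>\<^sup>+k. ennreal (exp m) * ennreal (pmf (poisson_pmf (2 * m)) k) \<partial>count_space UNIV)"
    unfolding nn_integral_measure_pmf
  proof (intro nn_integral_cong)
    fix k
    have "exp m * exp (- (2 * m)) = exp (- m)" by (simp flip: exp_add)
    then show "ennreal (pmf (poisson_pmf m) k) * ennreal (2 ^ k) = ennreal (exp m) * ennreal (pmf (poisson_pmf (2 * m)) k)"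
      using m by (simp add: ennreal_mult'[symmetric] power_mult_distrib)
  qed
  also have "\<dots> = ennreal (exp m)"
    by (simp add: nn_integral_cmult nn_integral_pmf measure_pmf.emeasure_space_1[simplified])
  finally show ?thesis .
qed

lemma nn_integral_pow2_weight:
  assumes "\<And>i. m $ i > 0"
  shows "(\<integral>\<^sup>+x. ennreal (pow2_weight x) \<partial>measure_pmf (poisson_vec_pmf m)) < \<infinity>"
proof -
  have "(\<integral>\<^sup>+x. ennreal (pow2_weight x) \<partial>measure_pmf (poisson_vec_pmf m)) =
    (\<integral>\<^sup>+f. (\<Prod>i\<in>UNIV. ennreal (2 ^ f i)) \<partial>measure_pmf (Pi_pmf UNIV 0 (\<lambda>i. poisson_pmf (m $ i))))"
    by (simp add: poisson_vec_pmf_def pow2_weight_def prod_ennreal)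
  also have "\<dots> = (\<Prod>i\<in>UNIV. ennreal (exp (m $ i)))"
    by (subst nn_integral_prod_Pi_pmf) (simp_all add: nn_integral_poisson_power2 assms)
  also have "\<dots> < \<infinity>" by (simp add: prod_ennreal)
  finally show ?thesis .
qed

lemma integrable_pair_poisson_vec_pmf:
  assumes a: "\<And>i. a $ i > 0" and b: "\<And>i. b $ i > 0"
    and f: "\<And>x y. \<bar>f (x, y)\<bar> \<le> C * (pow2_weight x * pow2_weight y)"
  shows "integrable (measure_pmf (pair_pmf (poisson_vec_pmf a) (poisson_vec_pmf b))) f"
proof (rule integrableI_bounded)
  have C: "0 \<le> C" using f[of 0 0] by (simp add: pow2_weight_def)
  have "(\<integral>\<^sup>+z. ennreal (norm (f z)) \<partial>measure_pmf (pair_pmf (poisson_vec_pmf a) (poisson_vec_pmf b))) \<le>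
    (\<integral>\<^sup>+x. \<integral>\<^sup>+y. ennreal C * ennreal (pow2_weight x) * ennreal (pow2_weight y) \<partial>measure_pmf (poisson_vec_pmf b) \<partial>measure_pmf (poisson_vec_pmf a))"
    unfolding nn_integral_pair_pmf'
  proof (intro nn_integral_mono)
    fix x y
    have "ennreal (norm (f (x, y))) \<le> ennreal (C * (pow2_weight x * pow2_weight y))" using f by (intro ennreal_leI) simp
    also have "\<dots> = ennreal C * ennreal (pow2_weight x) * ennreal (pow2_weight y)"
      using C by (simp add: ennreal_mult mult.assoc)
    finally show "ennreal (norm (f (x, y))) \<le> ennreal C * ennreal (pow2_weight x) * ennreal (pow2_weight y)" .
  qed
  also have "\<dots> = ennreal C * ((\<integral>\<^sup>+x. ennreal (pow2_weight x) \<partial>measure_pmf (poisson_vec_pmf a)) * (\<integral>\<^sup>+y. ennreal (pow2_weight y) \<partial>measure_pmf (poisson_vec_pmf b)))"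
    by (simp add: nn_integral_cmult nn_integral_multc mult.assoc)
  also have "\<dots> < \<infinity>"
    using nn_integral_pow2_weight[of a] nn_integral_pow2_weight[of b] a b by (simp add: ennreal_mult_less_top)
  finally show "(\<integral>\<^sup>+z. ennreal (norm (f z)) \<partial>measure_pmf (pair_pmf (poisson_vec_pmf a) (poisson_vec_pmf b))) < \<infinity>" .
qed simp

lemma has_sum_pmf_expectation:
  fixes f :: "'a \<Rightarrow> real"
  assumes "integrable (measure_pmf p) f"
  shows "((\<lambda>x. pmf p x * f x) has_sum measure_pmf.expectation p f) UNIV"
proof -
  have "integrable (density (count_space UNIV) (pmf p)) f"
    using assms by (simp add: measure_pmf_eq_density)
  then have "integrable (count_space UNIV) (\<lambda>x. pmf p x *\<^sub>R f x)"
    by (subst (asm) integrable_density) auto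
  then have A: "Infinite_Set_Sum.abs_summable_on (\<lambda>x. pmf p x * f x) UNIV"
    by (simp add: Infinite_Set_Sum.abs_summable_on_def)
  have "(\<lambda>x. pmf p x * f x) summable_on UNIV"
    by (rule Infinite_Sum.abs_summable_summable)
       (use A abs_summable_equivalent[of "\<lambda>x. pmf p x * f x" UNIV] in blast)
  then have "((\<lambda>x. pmf p x * f x) has_sum (\<Sum>\<^sub>\<infinity>x. pmf p x * f x)) UNIV" by (rule has_sum_infsum)
  then show ?thesis unfolding pmf_expectation_eq_infsetsum infsetsum_infsum[OF A] .
qed

lemma has_sum_ereal:
  fixes f :: "'a \<Rightarrow> real"
  assumes "(f has_sum S) A"
  shows "((\<lambda>x. ereal (f x)) has_sum ereal S) A"
proof -
  have "sum (\<lambda>x. ereal (f x)) = (\<lambda>F. ereal (sum f F))" by (simp add: fun_eq_iff)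
  then show ?thesis using assms unfolding has_sum_def by simp
qed

lemma expectation_pair_pmf:
  fixes f :: "'a \<times> 'b \<Rightarrow> real"
  assumes f: "integrable (measure_pmf (pair_pmf p q)) f"
    and slice: "\<And>x. integrable (measure_pmf q) (\<lambda>y. f (x, y))"
  shows "((\<lambda>x. pmf p x * measure_pmf.expectation q (\<lambda>y. f (x, y))) has_sum
    measure_pmf.expectation (pair_pmf p q) f) UNIV"
proof -
  have "((\<lambda>z. pmf (pair_pmf p q) z * f z) has_sum measure_pmf.expectation (pair_pmf p q) f) (Sigma UNIV (\<lambda>_. UNIV))"
    using has_sum_pmf_expectation[OF f] by simp
  moreover have "((\<lambda>y. pmf (pair_pmf p q) (x, y) * f (x, y)) has_sum pmf p x * measure_pmf.expectation q (\<lambda>y. f (x, y))) UNIV" for x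
    using has_sum_cmult_right[OF has_sum_pmf_expectation[OF slice[of x]], of "pmf p x"]
    by (simp add: pmf_pair mult.assoc)
  ultimately show ?thesis by (rule has_sum_SigmaD)
qed

lemma poisson_prob_eq_poisson_vec_pmf:
  assumes "\<And>i. r $ i > 0" "lam \<in> orthant"
  shows "poisson_prob r lam x = pmf (poisson_vec_pmf (\<chi> i. r $ i * lam $ i)) x"
  using assms by (simp add: poisson_prob_eq_prod_poisson_pmf pmf_poisson_vec_pmf orthant_def)

text \<open>Positivity of \<open>q\<close> excludes the infinite branch of \<open>kl_loss\<close>,
  and the bound makes the logarithm integrable for the pair and for each fixed \<open>x\<close>. The
  iterated extended sums are therefore one finite expectation.\<close>

lemma kl_risk_eq_expectation:
  fixes r s lam :: "real ^ 'd"
  assumes r: "\<And>i. r $ i > 0" and s: "\<And>i. s $ i > 0" and lam: "lam \<in> orthant"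
    and q: "\<And>x y. q x y > 0"
    and bound: "\<And>x y. \<bar>ln (poisson_prob s lam y / q x y)\<bar> \<le> C * (pow2_weight x * pow2_weight y)"
  shows "kl_risk r s q lam = ereal (measure_pmf.expectation
    (pair_pmf (poisson_vec_pmf (\<chi> i. r $ i * lam $ i)) (poisson_vec_pmf (\<chi> i. s $ i * lam $ i)))
    (\<lambda>(x, y). ln (poisson_prob s lam y / q x y)))"
proof -
  define a where "a = (\<chi> i. r $ i * lam $ i)"
  define b where "b = (\<chi> i. s $ i * lam $ i)"
  have a: "a $ i > 0" and b: "b $ i > 0" for i using r[of i] s[of i] lam by (auto simp: a_def b_def orthant_def)
  let ?f = "\<lambda>(x, y). ln (poisson_prob s lam y / q x y)"
  have int: "integrable (measure_pmf (pair_pmf (poisson_vec_pmf a) (poisson_vec_pmf b))) ?f"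
    using a b bound by (intro integrable_pair_poisson_vec_pmf[where C = C]) auto
  have slice: "integrable (measure_pmf (poisson_vec_pmf b)) (\<lambda>y. ?f (x, y))" for x
  proof (rule integrableI_bounded)
    have "(\<integral>\<^sup>+y. ennreal (norm (?f (x, y))) \<partial>measure_pmf (poisson_vec_pmf b)) \<le> (\<integral>\<^sup>+y. ennreal (C * pow2_weight x) * ennreal (pow2_weight y) \<partial>measure_pmf (poisson_vec_pmf b))"
      using bound[of _ x] by (intro nn_integral_mono) (simp add: ennreal_mult''[symmetric] mult.assoc ennreal_leI)
    also have "\<dots> < \<infinity>"
      using nn_integral_pow2_weight[of b] b by (simp add: nn_integral_cmult ennreal_mult_less_top)
    finally show "(\<integral>\<^sup>+y. ennreal (norm (?f (x, y))) \<partial>measure_pmf (poisson_vec_pmf b)) < \<infinity>" .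
  qed simp
  have loss: "kl_loss s q lam x = ereal (measure_pmf.expectation (poisson_vec_pmf b) (\<lambda>y. ?f (x, y)))" for x
    unfolding kl_loss_def using has_sum_ereal[OF has_sum_pmf_expectation[OF slice[of x]]] q
    by (intro infsumI) (simp add: poisson_prob_eq_poisson_vec_pmf[OF s lam] b_def)
  show ?thesis
    unfolding kl_risk_def loss a_def[symmetric] b_def[symmetric]
    using has_sum_ereal[OF expectation_pair_pmf[OF int slice]]
    by (intro infsumI) (simp add: poisson_prob_eq_poisson_vec_pmf[OF r lam] a_def)
qed

section \<open>Splitting a Poisson vector according to its total\<close>

lemma pmf_poisson_binomial:
  assumes a: "a > 0" and b: "b > 0" and k: "k \<le> n"
  shows "pmf (poisson_pmf a) k * pmf (poisson_pmf b) (n - k) =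
    pmf (poisson_pmf (a + b)) n * (real (n choose k) * (a / (a + b)) ^ k * (1 - a / (a + b)) ^ (n - k))"
proof -
  have 1: "1 - a / (a + b) = b / (a + b)" using a b by (simp add: field_simps)
  have 2: "(a + b) ^ n = (a + b) ^ k * (a + b) ^ (n - k)" using k by (simp flip: power_add)
  have 3: "a + b \<noteq> 0" using a b by simp
  have 4: "exp (- (a + b)) = 1 / (exp a * exp b)" by (simp only: exp_minus exp_add inverse_eq_divide)
  show ?thesis
    using a b k 3 unfolding 1
    by (simp add: 2 4 del: minus_add_distrib add: power_divide binomial_fact exp_minus exp_add field_simps)
qed

text \<open>Substitutes \<open>n - x\<close> for \<open>y\<close> and exchanges the sums. Truncated
  subtraction is exact, because \<open>x\<close> runs over the box below \<open>n\<close>.\<close>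

lemma nn_integral_pair_poisson_vec_pmf:
  fixes a b p :: "real ^ 'd"
  assumes a: "\<And>i. a $ i > 0" and b: "\<And>i. b $ i > 0" and p: "\<And>i. p $ i = a $ i / (a $ i + b $ i)"
  shows "(\<integral>\<^sup>+z. g z \<partial>measure_pmf (pair_pmf (poisson_vec_pmf a) (poisson_vec_pmf b))) =
    (\<integral>\<^sup>+n. (\<Sum>x\<in>{x. \<forall>i. x $ i \<le> n $ i}. ennreal (binom_vec p n x) * g (x, n - x)) \<partial>measure_pmf (poisson_vec_pmf (a + b)))"
proof -
  let ?box = "\<lambda>n :: nat ^ 'd. {x. \<forall>i. x $ i \<le> n $ i}"
  have bij: "bij_betw (\<lambda>y. x + y) UNIV {n. x \<in> ?box n}" for x :: "nat ^ 'd"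
    by (rule bij_betwI[where g = "\<lambda>n. n - x"]) (auto simp: vec_eq_iff)
  have "(\<integral>\<^sup>+z. g z \<partial>measure_pmf (pair_pmf (poisson_vec_pmf a) (poisson_vec_pmf b))) =
    (\<integral>\<^sup>+x. \<integral>\<^sup>+y. ennreal (pmf (poisson_vec_pmf a) x) * (ennreal (pmf (poisson_vec_pmf b) y) * g (x, y)) \<partial>count_space UNIV \<partial>count_space UNIV)"
    unfolding nn_integral_pair_pmf' by (simp add: nn_integral_measure_pmf nn_integral_cmult)
  also have "\<dots> = (\<integral>\<^sup>+x. \<integral>\<^sup>+n. ennreal (pmf (poisson_vec_pmf a) x) * (ennreal (pmf (poisson_vec_pmf b) (n - x)) * g (x, n - x)) * indicator (?box n) x \<partial>count_space UNIV \<partial>count_space UNIV)"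
  proof (rule nn_integral_cong)
    fix x :: "nat ^ 'd"
    let ?h = "\<lambda>n. ennreal (pmf (poisson_vec_pmf a) x) * (ennreal (pmf (poisson_vec_pmf b) (n - x)) * g (x, n - x))"
    have "(\<integral>\<^sup>+y. ennreal (pmf (poisson_vec_pmf a) x) * (ennreal (pmf (poisson_vec_pmf b) y) * g (x, y)) \<partial>count_space UNIV) = (\<integral>\<^sup>+y. ?h (x + y) \<partial>count_space UNIV)"
      by simp
    also have "\<dots> = (\<integral>\<^sup>+n. ?h n \<partial>count_space {n. x \<in> ?box n})"
      by (rule nn_integral_bij_count_space[OF bij])
    also have "\<dots> = (\<integral>\<^sup>+n. ?h n * indicator {n. x \<in> ?box n} n \<partial>count_space UNIV)"
      by (rule nn_integral_count_space_indicator) simp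
    also have "\<dots> = (\<integral>\<^sup>+n. ?h n * indicator (?box n) x \<partial>count_space UNIV)"
      by (intro nn_integral_cong) (simp add: indicator_def)
    finally show "(\<integral>\<^sup>+y. ennreal (pmf (poisson_vec_pmf a) x) * (ennreal (pmf (poisson_vec_pmf b) y) * g (x, y)) \<partial>count_space UNIV) = \<dots>" .
  qed
  also have "\<dots> = (\<integral>\<^sup>+n. \<integral>\<^sup>+x. ennreal (pmf (poisson_vec_pmf a) x) * (ennreal (pmf (poisson_vec_pmf b) (n - x)) * g (x, n - x)) * indicator (?box n) x \<partial>count_space UNIV \<partial>count_space UNIV)"
    using nn_integral_fst_count_space[of "\<lambda>(x, n). ennreal (pmf (poisson_vec_pmf a) x) * (ennreal (pmf (poisson_vec_pmf b) (n - x)) * g (x, n - x)) * indicator (?box n) x"]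
      nn_integral_snd_count_space[of "\<lambda>(x, n). ennreal (pmf (poisson_vec_pmf a) x) * (ennreal (pmf (poisson_vec_pmf b) (n - x)) * g (x, n - x)) * indicator (?box n) x"]
    by simp
  also have "\<dots> = (\<integral>\<^sup>+n. ennreal (pmf (poisson_vec_pmf (a + b)) n) * (\<Sum>x\<in>?box n. ennreal (binom_vec p n x) * g (x, n - x)) \<partial>count_space UNIV)"
  proof (rule nn_integral_cong)
    fix n :: "nat ^ 'd"
    have "(\<integral>\<^sup>+x. ennreal (pmf (poisson_vec_pmf a) x) * (ennreal (pmf (poisson_vec_pmf b) (n - x)) * g (x, n - x)) * indicator (?box n) x \<partial>count_space UNIV) =
      (\<Sum>x\<in>?box n. ennreal (pmf (poisson_vec_pmf a) x) * (ennreal (pmf (poisson_vec_pmf b) (n - x)) * g (x, n - x)) * indicator (?box n) x)"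
      by (rule nn_integral_count_space'[OF finite_box]) auto
    also have "\<dots> = (\<Sum>x\<in>?box n. ennreal (pmf (poisson_vec_pmf (a + b)) n) * (ennreal (binom_vec p n x) * g (x, n - x)))"
    proof (intro sum.cong refl)
      fix x assume x: "x \<in> ?box n"
      have "pmf (poisson_vec_pmf a) x * pmf (poisson_vec_pmf b) (n - x) = pmf (poisson_vec_pmf (a + b)) n * binom_vec p n x"
        unfolding pmf_poisson_vec_pmf binom_vec_def prod.distrib[symmetric]
        using x by (intro prod.cong refl) (simp add: p pmf_poisson_binomial[OF a b, simplified] del: pmf_poisson)
      then have "ennreal (pmf (poisson_vec_pmf a) x) * ennreal (pmf (poisson_vec_pmf b) (n - x)) = ennreal (pmf (poisson_vec_pmf (a + b)) n) * ennreal (binom_vec p n x)"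
        by (simp flip: ennreal_mult')
      then show "ennreal (pmf (poisson_vec_pmf a) x) * (ennreal (pmf (poisson_vec_pmf b) (n - x)) * g (x, n - x)) * indicator (?box n) x =
        ennreal (pmf (poisson_vec_pmf (a + b)) n) * (ennreal (binom_vec p n x) * g (x, n - x))"
        using x by (simp add: mult.assoc[symmetric])
    qed
    finally show "(\<integral>\<^sup>+x. ennreal (pmf (poisson_vec_pmf a) x) * (ennreal (pmf (poisson_vec_pmf b) (n - x)) * g (x, n - x)) * indicator (?box n) x \<partial>count_space UNIV) =
      ennreal (pmf (poisson_vec_pmf (a + b)) n) * (\<Sum>x\<in>?box n. ennreal (binom_vec p n x) * g (x, n - x))"
      by (simp add: sum_distrib_left)
  qed
  finally show ?thesis by (simp add: nn_integral_measure_pmf)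
qed

lemma sum_binom_vec:
  assumes "\<And>i. 0 \<le> p $ i" "\<And>i. p $ i \<le> 1"
  shows "(\<Sum>x\<in>{x. \<forall>i. x $ i \<le> n $ i}. binom_vec p n x) = 1"
proof -
  have "(\<Sum>j\<le>n $ i. real (n $ i choose j) * (p $ i) ^ j * (1 - p $ i) ^ (n $ i - j)) = 1" for i
    using binomial_ring[of "p $ i" "1 - p $ i" "n $ i"] by simp
  moreover have "(\<Sum>x\<in>{x. \<forall>i. x $ i \<le> n $ i}. binom_vec p n x) =
    (\<Prod>i\<in>UNIV. \<Sum>j\<le>n $ i. real (n $ i choose j) * (p $ i) ^ j * (1 - p $ i) ^ (n $ i - j))"
    unfolding binom_vec_def by (rule sum_box_prod)
  ultimately show ?thesis by simp
qed

lemma binom_vec_nonneg: "(\<And>i. 0 \<le> p $ i) \<Longrightarrow> (\<And>i. p $ i \<le> 1) \<Longrightarrow> 0 \<le> binom_vec p n x"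
  unfolding binom_vec_def by (intro prod_nonneg) auto

text \<open>Applies the splitting formula to the indicator of x + y = k, which is constant on each
  box, and uses that the binomial weights sum to 1.\<close>

lemma map_pmf_add_poisson_vec_pmf:
  fixes a b :: "real ^ 'd"
  assumes a: "\<And>i. a $ i > 0" and b: "\<And>i. b $ i > 0"
  shows "map_pmf (\<lambda>(x, y). x + y) (pair_pmf (poisson_vec_pmf a) (poisson_vec_pmf b)) = poisson_vec_pmf (a + b)"
proof (rule pmf_eqI)
  fix k
  define p where "p = (\<chi> i. a $ i / (a $ i + b $ i))"
  have p01: "0 \<le> p $ i" "p $ i \<le> 1" for i using a[of i] b[of i] by (auto simp: p_def)
  have "ennreal (pmf (map_pmf (\<lambda>(x, y). x + y) (pair_pmf (poisson_vec_pmf a) (poisson_vec_pmf b))) k) =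
    (\<integral>\<^sup>+z. indicator {k} (fst z + snd z) \<partial>measure_pmf (pair_pmf (poisson_vec_pmf a) (poisson_vec_pmf b)))"
    unfolding ennreal_pmf_map by (intro nn_integral_cong) (auto simp: indicator_def)
  also have "\<dots> = (\<integral>\<^sup>+n. (\<Sum>x\<in>{x. \<forall>i. x $ i \<le> n $ i}. ennreal (binom_vec p n x) * indicator {k} (x + (n - x))) \<partial>measure_pmf (poisson_vec_pmf (a + b)))"
    by (subst nn_integral_pair_poisson_vec_pmf[OF a b, where p = p]) (auto simp: p_def)
  also have "\<dots> = (\<integral>\<^sup>+n. indicator {k} n \<partial>measure_pmf (poisson_vec_pmf (a + b)))"
  proof (intro nn_integral_cong)
    fix n :: "nat ^ 'd"
    have "(\<Sum>x\<in>{x. \<forall>i. x $ i \<le> n $ i}. ennreal (binom_vec p n x) * indicator {k} (x + (n - x))) =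
      (\<Sum>x\<in>{x. \<forall>i. x $ i \<le> n $ i}. ennreal (binom_vec p n x) * indicator {k} n)"
    proof (intro sum.cong refl)
      fix x assume "x \<in> {x. \<forall>i. x $ i \<le> n $ i}"
      then have "x + (n - x) = n" by (auto simp: vec_eq_iff)
      then show "ennreal (binom_vec p n x) * indicator {k} (x + (n - x)) = ennreal (binom_vec p n x) * indicator {k} n" by simp
    qed
    also have "\<dots> = ennreal (\<Sum>x\<in>{x. \<forall>i. x $ i \<le> n $ i}. binom_vec p n x) * indicator {k} n"
      unfolding sum_distrib_right[symmetric] using p01 by (subst sum_ennreal) (auto intro: binom_vec_nonneg)
    finally show "(\<Sum>x\<in>{x. \<forall>i. x $ i \<le> n $ i}. ennreal (binom_vec p n x) * indicator {k} (x + (n - x))) = indicator {k} n"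
      using sum_binom_vec[of p n] p01 by simp
  qed
  also have "\<dots> = ennreal (pmf (poisson_vec_pmf (a + b)) k)"
    by (simp add: emeasure_pmf_single)
  finally show "pmf (map_pmf (\<lambda>(x, y). x + y) (pair_pmf (poisson_vec_pmf a) (poisson_vec_pmf b))) k = pmf (poisson_vec_pmf (a + b)) k"
    by simp
qed

section \<open>Domination\<close>

lemma nat_le_pow2_weight: "real (x $ i) \<le> pow2_weight x"
  using power_le_pow2_weight[of x i] of_nat_less_two_power[of "x $ i", where 'a = real] by linarith

text \<open>The recurrence adds ln (k + 1 / 2), which is itself at most 2^k in absolute value, so
  the bound doubles at each step.\<close>

lemma abs_ln_half_gamma_le: "\<bar>ln (half_gamma k)\<bar> \<le> 2 ^ k"
proof (induction k)
  case 0
  have "1 \<le> sqrt pi" using pi_gt3 by simp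
  moreover have "ln (sqrt pi) \<le> sqrt pi - 1" by (rule ln_le_minus_one) simp
  moreover have "sqrt pi \<le> sqrt 4" using pi_less_4 by (intro real_sqrt_le_mono) simp
  ultimately show ?case by simp
next
  case (Suc k)
  have "ln (half_gamma (Suc k)) = ln (real k + 1 / 2) + ln (half_gamma k)"
    unfolding half_gamma_Suc by (rule ln_mult_pos) auto
  moreover have "\<bar>ln (real k + 1 / 2)\<bar> \<le> 2 ^ k"
  proof (cases k)
    case 0
    have "ln (2::real) \<le> 1" using ln_2_less_1 by simp
    with 0 show ?thesis by (simp add: ln_div)
  next
    case (Suc j)
    have "0 \<le> ln (real k + 1 / 2)" using Suc by (intro ln_ge_zero) simp
    moreover have "ln (real k + 1 / 2) \<le> (real k + 1 / 2) - 1" by (rule ln_le_minus_one) simp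
    moreover have "real k < 2 ^ k" by (rule of_nat_less_two_power)
    ultimately show ?thesis by linarith
  qed
  ultimately show ?case using Suc by simp
qed

lemma abs_ln_gamma_mass_le:
  assumes c: "c > 0"
  shows "\<bar>ln (gamma_mass c k)\<bar> \<le> (1 + 2 * \<bar>ln c\<bar>) * 2 ^ k"
proof -
  have "ln (gamma_mass c k) = ln (half_gamma k) - (real k * ln c + ln c / 2)"
    using c less_imp_neq[OF half_gamma_pos, of k]
    by (simp add: gamma_mass_def ln_div ln_mult ln_realpow ln_sqrt)
  then have "\<bar>ln (gamma_mass c k)\<bar> \<le> \<bar>ln (half_gamma k)\<bar> + (real k * \<bar>ln c\<bar> + \<bar>ln c\<bar> / 2)"
    using abs_mult[of "real k" "ln c"] by simp
  also have "\<dots> \<le> 2 ^ k + (2 ^ k * \<bar>ln c\<bar> + 2 ^ k * \<bar>ln c\<bar>)"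
  proof (intro add_mono abs_ln_half_gamma_le mult_right_mono)
    show "real k \<le> 2 ^ k" using of_nat_less_two_power[of k, where 'a = real] by simp
    have "\<bar>ln c\<bar> / 2 \<le> 1 * \<bar>ln c\<bar>" by simp
    also have "\<dots> \<le> 2 ^ k * \<bar>ln c\<bar>" by (intro mult_right_mono) auto
    finally show "\<bar>ln c\<bar> / 2 \<le> 2 ^ k * \<bar>ln c\<bar>" .
  qed auto
  also have "\<dots> = (1 + 2 * \<bar>ln c\<bar>) * 2 ^ k" by (simp add: algebra_simps)
  finally show ?thesis .
qed

text \<open>The contribution of one coordinate to ln (p / q) for the Jeffreys prior, after
  \<open>poisson_coeff s y\<close> has cancelled; no factorial of \<open>y\<close> is left.\<close>

definition log_ratio_coord :: "real \<Rightarrow> real \<Rightarrow> real \<Rightarrow> nat \<Rightarrow> nat \<Rightarrow> real" where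
  "log_ratio_coord r s l x y = ln (gamma_mass r x) - ln (gamma_mass (r + s) (x + y)) + real y * ln l - s * l"

lemma abs_log_ratio_coord_le:
  assumes "r > 0" "s > 0" "l > 0"
  shows "\<bar>log_ratio_coord r s l x y\<bar> \<le>
    ((1 + 2 * \<bar>ln r\<bar>) + (1 + 2 * \<bar>ln (r + s)\<bar>) + \<bar>ln l\<bar> + s * l) * (2 ^ x * 2 ^ y)"
proof -
  have p: "(1::real) \<le> 2 ^ x" "(1::real) \<le> 2 ^ y" by simp_all
  have p2: "(2::real) ^ x \<le> 2 ^ x * 2 ^ y" "(2::real) ^ y \<le> 2 ^ x * 2 ^ y" using p by simp_all
  have p3: "(1::real) \<le> 2 ^ x * 2 ^ y" using p(1) p2(1) by linarith
  have y: "real y \<le> 2 ^ x * 2 ^ y" using of_nat_less_two_power[of y, where 'a = real] p2 by linarith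
  have sl: "s * l \<ge> 0" using assms by simp
  have "\<bar>log_ratio_coord r s l x y\<bar> \<le> \<bar>ln (gamma_mass r x)\<bar> + \<bar>ln (gamma_mass (r + s) (x + y))\<bar> + real y * \<bar>ln l\<bar> + s * l * 1"
    unfolding log_ratio_coord_def using sl abs_mult[of "real y" "ln l"] by simp
  also have "\<dots> \<le> (1 + 2 * \<bar>ln r\<bar>) * (2 ^ x * 2 ^ y) + (1 + 2 * \<bar>ln (r + s)\<bar>) * (2 ^ x * 2 ^ y)
      + (2 ^ x * 2 ^ y) * \<bar>ln l\<bar> + s * l * (2 ^ x * 2 ^ y)"
  proof (intro add_mono mult_right_mono[OF y] mult_left_mono[OF p3] sl)
    show "\<bar>ln (gamma_mass r x)\<bar> \<le> (1 + 2 * \<bar>ln r\<bar>) * (2 ^ x * 2 ^ y)"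
      using abs_ln_gamma_mass_le[of r x] assms mult_left_mono[OF p2(1), of "1 + 2 * \<bar>ln r\<bar>"] by linarith
    show "\<bar>ln (gamma_mass (r + s) (x + y))\<bar> \<le> (1 + 2 * \<bar>ln (r + s)\<bar>) * (2 ^ x * 2 ^ y)"
      using abs_ln_gamma_mass_le[of "r + s" "x + y"] assms by (simp add: power_add)
  qed auto
  also have "\<dots> = ((1 + 2 * \<bar>ln r\<bar>) + (1 + 2 * \<bar>ln (r + s)\<bar>) + \<bar>ln l\<bar> + s * l) * (2 ^ x * 2 ^ y)"
    by (simp add: algebra_simps)
  finally show ?thesis .
qed

lemma predictive_jeffreys_pos:
  assumes "\<And>i. r $ i > 0" "\<And>i. s $ i > 0"
  shows "predictive r s jeffreys x y > 0"
  using assms by (simp add: predictive_jeffreys gamma_mass_vec_pos poisson_coeff_pos add_pos_pos)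

lemma ln_ratio_jeffreys:
  assumes r: "\<And>i. r $ i > 0" and s: "\<And>i. s $ i > 0" and lam: "lam \<in> orthant"
  shows "ln (poisson_prob s lam y / predictive r s jeffreys x y) =
    (\<Sum>i\<in>UNIV. log_ratio_coord (r $ i) (s $ i) (lam $ i) (x $ i) (y $ i))"
proof -
  have l: "lam $ i > 0" for i using lam by (simp add: orthant_def)
  have rs: "r $ i + s $ i > 0" for i using r[of i] s[of i] by simp
  have "poisson_prob s lam y / predictive r s jeffreys x y =
    (\<Prod>i\<in>UNIV. lam $ i ^ (y $ i) * exp (- (s $ i * lam $ i)) * gamma_mass (r $ i) (x $ i) / gamma_mass (r $ i + s $ i) (x $ i + y $ i))"
    using poisson_coeff_pos[OF s, of y]
    by (simp add: predictive_jeffreys[OF r s] poisson_prob_eq poisson_weight_def gamma_mass_vec_def prod.distrib prod_dividef)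
  then have "ln (poisson_prob s lam y / predictive r s jeffreys x y) =
    ln (\<Prod>i\<in>UNIV. lam $ i ^ (y $ i) * exp (- (s $ i * lam $ i)) * gamma_mass (r $ i) (x $ i) / gamma_mass (r $ i + s $ i) (x $ i + y $ i))"
    by simp
  also have "\<dots> = (\<Sum>i\<in>UNIV. ln (lam $ i ^ (y $ i) * exp (- (s $ i * lam $ i)) * gamma_mass (r $ i) (x $ i) / gamma_mass (r $ i + s $ i) (x $ i + y $ i)))"
  proof (intro ln_prod)
    fix i
    have "lam $ i ^ (y $ i) * exp (- (s $ i * lam $ i)) * gamma_mass (r $ i) (x $ i) / gamma_mass (r $ i + s $ i) (x $ i + y $ i) > 0"
      using l[of i] r[of i] rs[of i] by (intro divide_pos_pos mult_pos_pos) auto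
    then show "lam $ i ^ (y $ i) * exp (- (s $ i * lam $ i)) * gamma_mass (r $ i) (x $ i) / gamma_mass (r $ i + s $ i) (x $ i + y $ i) \<noteq> 0"
      by (rule less_imp_neq[symmetric])
  qed auto
  also have "\<dots> = (\<Sum>i\<in>UNIV. log_ratio_coord (r $ i) (s $ i) (lam $ i) (x $ i) (y $ i))"
  proof (intro sum.cong refl)
    fix i
    have "0 < lam $ i ^ (y $ i)" "0 < gamma_mass (r $ i) (x $ i)" "0 < gamma_mass (r $ i + s $ i) (x $ i + y $ i)"
      using l[of i] r[of i] rs[of i] by auto
    then show "ln (lam $ i ^ (y $ i) * exp (- (s $ i * lam $ i)) * gamma_mass (r $ i) (x $ i) / gamma_mass (r $ i + s $ i) (x $ i + y $ i)) =
      log_ratio_coord (r $ i) (s $ i) (lam $ i) (x $ i) (y $ i)"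
      using l[of i] by (simp add: log_ratio_coord_def ln_div ln_mult ln_realpow)
  qed
  finally show ?thesis .
qed

lemma ln_ratio_jeffreys_bound:
  fixes r s lam :: "real ^ 'd"
  assumes r: "\<And>i. r $ i > 0" and s: "\<And>i. s $ i > 0" and lam: "lam \<in> orthant"
  shows "\<exists>C. \<forall>x y. \<bar>ln (poisson_prob s lam y / predictive r s jeffreys x y)\<bar> \<le> C * (pow2_weight x * pow2_weight y)"
proof -
  have l: "lam $ i > 0" for i using lam by (simp add: orthant_def)
  define c where "c i = (1 + 2 * \<bar>ln (r $ i)\<bar>) + (1 + 2 * \<bar>ln (r $ i + s $ i)\<bar>) + \<bar>ln (lam $ i)\<bar> + s $ i * lam $ i" for i
  have c: "c i \<ge> 0" for i using s[of i] l[of i] by (simp add: c_def)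
  have "\<bar>ln (poisson_prob s lam y / predictive r s jeffreys x y)\<bar> \<le> (\<Sum>i\<in>UNIV. c i) * (pow2_weight x * pow2_weight y)" for x y
  proof -
    have "\<bar>ln (poisson_prob s lam y / predictive r s jeffreys x y)\<bar> \<le>
      (\<Sum>i\<in>UNIV. \<bar>log_ratio_coord (r $ i) (s $ i) (lam $ i) (x $ i) (y $ i)\<bar>)"
      unfolding ln_ratio_jeffreys[OF r s lam] by (rule sum_abs)
    also have "\<dots> \<le> (\<Sum>i\<in>UNIV. c i * (pow2_weight x * pow2_weight y))"
    proof (intro sum_mono)
      fix i
      have "\<bar>log_ratio_coord (r $ i) (s $ i) (lam $ i) (x $ i) (y $ i)\<bar> \<le> c i * (2 ^ (x $ i) * 2 ^ (y $ i))"
        unfolding c_def by (rule abs_log_ratio_coord_le[OF r s l])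
      also have "\<dots> \<le> c i * (pow2_weight x * pow2_weight y)"
        by (intro mult_left_mono mult_mono power_le_pow2_weight c) auto
      finally show "\<bar>log_ratio_coord (r $ i) (s $ i) (lam $ i) (x $ i) (y $ i)\<bar> \<le> c i * (pow2_weight x * pow2_weight y)" .
    qed
    finally show ?thesis by (simp add: sum_distrib_right)
  qed
  then show ?thesis by blast
qed

text \<open>Makes the correction to the Jeffreys risk integrable. From above, ln t \<le> t - 1 is
  enough; from below, a bound geometric in \<open>z\<close> has a logarithm linear in the
  counts.\<close>

lemma power_mean_properties:
  fixes \<eta> v :: "real ^ 'd"
  assumes v: "\<And>i. v $ i > 0" and \<alpha>: "0 < \<alpha>" "\<alpha> < real CARD('d) / 2"
  shows "power_average \<alpha> \<eta> v z = ennreal (power_mean \<alpha> \<eta> v z)" and "power_mean \<alpha> \<eta> v z > 0"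
    and "\<exists>C. \<forall>z. \<bar>ln (power_mean \<alpha> \<eta> v z)\<bar> \<le> C * pow2_weight z"
proof -
  obtain C where C: "C > 0" "power_average \<alpha> \<eta> v z \<le> ennreal (C * pow2_weight z)" for z
    using power_average_le[OF v \<alpha>] unfolding pow2_weight_def by blast
  have eq: "power_average \<alpha> \<eta> v z = ennreal (power_mean \<alpha> \<eta> v z)" for z
    using le_less_trans[OF C(2)[of z] ennreal_less_top] by (simp add: power_mean_def)
  then show "power_average \<alpha> \<eta> v z = ennreal (power_mean \<alpha> \<eta> v z)" .
  define q where "q i = 1 / (1 + 4 * v $ i)" for i
  have q: "q i > 0" for i using v[of i] by (simp add: q_def add_pos_pos)
  define e where "e i = exp (- 4 * (\<eta> $ i)\<^sup>2) * sqrt (q i)" for i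
  have e: "e i > 0" for i using q by (simp add: e_def)
  define L where "L z = 1 / 2 * (\<Prod>i\<in>UNIV. e i * q i ^ (z $ i))" for z :: "nat ^ 'd"
  have prod_pos: "(\<Prod>i\<in>UNIV. e i * q i ^ (z $ i)) > 0" for z :: "nat ^ 'd"
    using e q by (intro prod_pos) auto
  have L: "L z > 0" for z using prod_pos by (simp add: L_def)
  have pn: "power_mean \<alpha> \<eta> v z \<ge> 0" for z by (simp add: power_mean_def)
  have "ennreal (L z) \<le> (\<integral>\<^sup>+u\<in>{1<..}. ennreal (u powr (\<alpha> - 1)) * (\<Prod>i\<in>UNIV. gaussian_average (\<eta> $ i) (v $ i) (z $ i) u) \<partial>lborel)" for z
    unfolding L_def e_def q_def by (rule power_average_ge[OF v \<alpha>(1)])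
  also have "\<dots> z \<le> power_average \<alpha> \<eta> v z" for z
    unfolding power_average_def by (intro nn_integral_mono) (auto simp: indicator_def)
  finally have "L z \<le> power_mean \<alpha> \<eta> v z" for z
    using pn by (simp add: eq)
  then have ge: "L z \<le> power_mean \<alpha> \<eta> v z" for z .
  show pos: "power_mean \<alpha> \<eta> v z > 0" for z using L[of z] ge[of z] by simp
  have le: "power_mean \<alpha> \<eta> v z \<le> C * pow2_weight z" for z
    using C(2)[of z] C(1) by (simp add: eq)
  define K where "K = ln 2 + (\<Sum>i\<in>UNIV. \<bar>ln (e i)\<bar> + \<bar>ln (q i)\<bar>)"
  have K: "K \<ge> 0" by (auto simp: K_def intro!: add_nonneg_nonneg sum_nonneg)
  have "\<bar>ln (power_mean \<alpha> \<eta> v z)\<bar> \<le> (C + K) * pow2_weight z" for z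
  proof -
    have "ln (power_mean \<alpha> \<eta> v z) \<le> C * pow2_weight z" using ln_le_minus_one[OF pos[of z]] le[of z] by simp
    moreover have "- ln (power_mean \<alpha> \<eta> v z) \<le> K * pow2_weight z"
    proof -
      have "- ln (power_mean \<alpha> \<eta> v z) \<le> - ln (L z)" using ge[of z] L[of z] by simp
      also have "ln (L z) = - ln 2 + ln (\<Prod>i\<in>UNIV. e i * q i ^ (z $ i))"
      proof -
        have "ln (1 / 2 * X) = - ln 2 + ln X" if "X > 0" for X :: real
          using that ln_mult_pos[of "1 / 2" X] by (simp add: ln_div)
        then show ?thesis unfolding L_def using prod_pos by blast
      qed
      also have "ln (\<Prod>i\<in>UNIV. e i * q i ^ (z $ i)) = (\<Sum>i\<in>UNIV. ln (e i * q i ^ (z $ i)))"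
        by (intro ln_prod) (auto simp: less_imp_neq[OF e, symmetric] less_imp_neq[OF q, symmetric])
      also have "\<dots> = (\<Sum>i\<in>UNIV. ln (e i) + real (z $ i) * ln (q i))"
        using e q by (intro sum.cong refl) (simp add: ln_mult_pos ln_realpow)
      also have "- (- ln 2 + (\<Sum>i\<in>UNIV. ln (e i) + real (z $ i) * ln (q i))) = ln 2 * 1 + (\<Sum>i\<in>UNIV. - ln (e i) * 1 + real (z $ i) * - ln (q i))"
        by (simp add: sum_negf[symmetric])
      also have "\<dots> \<le> ln 2 * pow2_weight z + (\<Sum>i\<in>UNIV. \<bar>ln (e i)\<bar> * pow2_weight z + pow2_weight z * \<bar>ln (q i)\<bar>)"
      proof (intro add_mono sum_mono)
        fix i
        show "ln 2 * 1 \<le> ln 2 * pow2_weight z" using pow2_weight_ge_1[of z] by (intro mult_left_mono) auto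
        have "- ln (e i) * 1 \<le> \<bar>ln (e i)\<bar> * 1" by simp
        also have "\<dots> \<le> \<bar>ln (e i)\<bar> * pow2_weight z" using pow2_weight_ge_1[of z] by (intro mult_left_mono) auto
        finally show "- ln (e i) * 1 \<le> \<bar>ln (e i)\<bar> * pow2_weight z" .
        have "real (z $ i) * - ln (q i) \<le> real (z $ i) * \<bar>ln (q i)\<bar>" by (intro mult_left_mono) auto
        also have "\<dots> \<le> pow2_weight z * \<bar>ln (q i)\<bar>" by (intro mult_right_mono nat_le_pow2_weight) auto
        finally show "real (z $ i) * - ln (q i) \<le> pow2_weight z * \<bar>ln (q i)\<bar>" .
      qed
      also have "\<dots> = K * pow2_weight z"
        by (simp add: K_def distrib_right sum_distrib_right[symmetric] sum.distrib sum_distrib_left[symmetric])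
      finally show ?thesis .
    qed
    moreover have "C * pow2_weight z \<ge> 0" "K * pow2_weight z \<ge> 0" using C K by simp_all
    ultimately show ?thesis by (simp add: distrib_right)
  qed
  then show "\<exists>C. \<forall>z. \<bar>ln (power_mean \<alpha> \<eta> v z)\<bar> \<le> C * pow2_weight z" by blast
qed

text \<open>The logarithm is bounded before conditioning: the resulting ratio is linear in
  \<open>F\<close>, and its denominator depends only on the total. A bound on the thinned mean of
  \<open>F\<close> then suffices.\<close>

lemma expectation_ln_ratio_pos:
  fixes a b p :: "real ^ 'd" and F G :: "nat ^ 'd \<Rightarrow> real"
  assumes a: "\<And>i. a $ i > 0" and b: "\<And>i. b $ i > 0" and p: "\<And>i. p $ i = a $ i / (a $ i + b $ i)"
    and F: "\<And>x. F x > 0" and G: "\<And>n. G n > 0"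
    and less: "\<And>n. (\<Sum>x\<in>{x. \<forall>i. x $ i \<le> n $ i}. ennreal (binom_vec p n x) * ennreal (F x)) < ennreal (G n)"
    and int: "integrable (measure_pmf (pair_pmf (poisson_vec_pmf a) (poisson_vec_pmf b))) (\<lambda>(x, y). ln (G (x + y)) - ln (F x))"
  shows "measure_pmf.expectation (pair_pmf (poisson_vec_pmf a) (poisson_vec_pmf b)) (\<lambda>(x, y). ln (G (x + y)) - ln (F x)) > 0"
proof -
  let ?P = "pair_pmf (poisson_vec_pmf a) (poisson_vec_pmf b)"
  let ?box = "\<lambda>n :: nat ^ 'd. {x. \<forall>i. x $ i \<le> n $ i}"
  have p01: "0 \<le> p $ i" "p $ i \<le> 1" for i using a[of i] b[of i] by (auto simp: p)
  have B0: "0 \<le> binom_vec p n x" for n x using p01 by (rule binom_vec_nonneg)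
  \<comment> \<open>The conditional mean of F x / G (x + y) given x + y = n. By \<open>less\<close>
    it is below 1 for every \<open>n\<close>.\<close>
  define c where "c n = (\<Sum>x\<in>?box n. binom_vec p n x * F x) / G n" for n
  have sumF: "0 \<le> (\<Sum>x\<in>?box n. binom_vec p n x * F x)" for n
    using B0 F by (intro sum_nonneg mult_nonneg_nonneg) (auto intro: less_imp_le)
  have c: "0 \<le> c n" "c n < 1" for n
  proof -
    have "ennreal (\<Sum>x\<in>?box n. binom_vec p n x * F x) < ennreal (G n)"
      using less[of n] B0 F by (subst sum_ennreal[symmetric]) (auto simp: ennreal_mult less_imp_le)
    then have "(\<Sum>x\<in>?box n. binom_vec p n x * F x) < G n"
      using sumF by (simp add: ennreal_less_iff)
    then show "c n < 1" using G[of n] by (simp add: c_def)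
    show "0 \<le> c n" using sumF[of n] G[of n] by (simp add: c_def less_imp_le)
  qed
  have intc: "integrable (measure_pmf (poisson_vec_pmf (a + b))) c"
    using c by (intro measure_pmf.integrable_const_bound[where B = 1]) (auto intro: less_imp_le)
  have "(\<integral>\<^sup>+z. ennreal (F (fst z) / G (fst z + snd z)) \<partial>measure_pmf ?P) =
    (\<integral>\<^sup>+n. (\<Sum>x\<in>?box n. ennreal (binom_vec p n x) * ennreal (F x / G (x + (n - x)))) \<partial>measure_pmf (poisson_vec_pmf (a + b)))"
    by (subst nn_integral_pair_poisson_vec_pmf[OF a b p]) simp
  also have "\<dots> = (\<integral>\<^sup>+n. ennreal (c n) \<partial>measure_pmf (poisson_vec_pmf (a + b)))"
  proof (rule nn_integral_cong)
    fix n :: "nat ^ 'd"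
    have "(\<Sum>x\<in>?box n. ennreal (binom_vec p n x) * ennreal (F x / G (x + (n - x)))) =
      (\<Sum>x\<in>?box n. ennreal (binom_vec p n x * F x / G n))"
    proof (intro sum.cong refl)
      fix x assume "x \<in> ?box n"
      then have "x + (n - x) = n" by (auto simp: vec_eq_iff)
      then show "ennreal (binom_vec p n x) * ennreal (F x / G (x + (n - x))) = ennreal (binom_vec p n x * F x / G n)"
        using B0 by (simp add: ennreal_mult'[symmetric])
    qed
    also have "\<dots> = ennreal (c n)"
      unfolding c_def sum_divide_distrib
      by (intro sum_ennreal divide_nonneg_nonneg mult_nonneg_nonneg B0 less_imp_le[OF F] less_imp_le[OF G])
    finally show "(\<Sum>x\<in>?box n. ennreal (binom_vec p n x) * ennreal (F x / G (x + (n - x)))) = ennreal (c n)" .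
  qed
  also have "\<dots> = ennreal (measure_pmf.expectation (poisson_vec_pmf (a + b)) c)"
    using c by (intro nn_integral_eq_integral intc) auto
  finally have nn: "(\<integral>\<^sup>+z. ennreal (F (fst z) / G (fst z + snd z)) \<partial>measure_pmf ?P) =
    ennreal (measure_pmf.expectation (poisson_vec_pmf (a + b)) c)" .
  have FG: "0 \<le> F x / G y" for x y using F[of x] G[of y] by (simp add: less_imp_le)
  have intr: "integrable (measure_pmf ?P) (\<lambda>z. F (fst z) / G (fst z + snd z))"
  proof (rule integrableI_bounded)
    show "(\<integral>\<^sup>+z. ennreal (norm (F (fst z) / G (fst z + snd z))) \<partial>measure_pmf ?P) < \<infinity>"
      by (simp only: nn real_norm_def abs_of_nonneg[OF FG]) simp
  qed simp
  have "measure_pmf.expectation ?P (\<lambda>z. F (fst z) / G (fst z + snd z)) = measure_pmf.expectation (poisson_vec_pmf (a + b)) c"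
    using nn c FG by (simp add: integral_eq_nn_integral integral_nonneg_AE)
  also have "\<dots> < 1"
    using c by (intro measure_pmf.expectation_less intc) auto
  finally have 1: "measure_pmf.expectation ?P (\<lambda>z. F (fst z) / G (fst z + snd z)) < 1" .
  have "0 < 1 - measure_pmf.expectation ?P (\<lambda>z. F (fst z) / G (fst z + snd z))" using 1 by simp
  also have "\<dots> = measure_pmf.expectation ?P (\<lambda>z. 1 - F (fst z) / G (fst z + snd z))"
    using intr by simp
  also have "\<dots> \<le> measure_pmf.expectation ?P (\<lambda>(x, y). ln (G (x + y)) - ln (F x))"
  proof (intro integral_mono int)
    show "integrable (measure_pmf ?P) (\<lambda>z. 1 - F (fst z) / G (fst z + snd z))" using intr by simp
    fix z :: "(nat ^ 'd) \<times> (nat ^ 'd)"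
    obtain x y where z: "z = (x, y)" by (cases z)
    have "ln (F x / G (x + y)) \<le> F x / G (x + y) - 1" by (intro ln_le_minus_one divide_pos_pos F G)
    then show "1 - F (fst z) / G (fst z + snd z) \<le> (case z of (x, y) \<Rightarrow> ln (G (x + y)) - ln (F x))"
      using F[of x] G[of "x + y"] by (simp add: z ln_div)
  qed
  finally show ?thesis .
qed

lemma kl_risk_jeffreys:
  fixes r s lam :: "real ^ 'd"
  assumes r: "\<And>i. r $ i > 0" and s: "\<And>i. s $ i > 0" and lam: "lam \<in> orthant"
  shows "kl_risk r s (predictive r s jeffreys) lam = ereal (measure_pmf.expectation
    (pair_pmf (poisson_vec_pmf (\<chi> i. r $ i * lam $ i)) (poisson_vec_pmf (\<chi> i. s $ i * lam $ i)))
    (\<lambda>(x, y). ln (poisson_prob s lam y / predictive r s jeffreys x y)))"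
proof -
  obtain C where C: "\<bar>ln (poisson_prob s lam y / predictive r s jeffreys x y)\<bar> \<le> C * (pow2_weight x * pow2_weight y)" for x y
    using ln_ratio_jeffreys_bound[OF r s lam] by blast
  show ?thesis
    by (rule kl_risk_eq_expectation[OF r s lam _ C]) (rule predictive_jeffreys_pos[OF r s])
qed

lemma kl_risk_shrinkage_less:
  fixes r s lam \<eta> :: "real ^ 'd"
  assumes r: "\<And>i. r $ i > 0" and s: "\<And>i. s $ i > 0" and lam: "lam \<in> orthant"
    and \<alpha>: "0 < \<alpha>" "\<alpha> \<le> (real CARD('d) - 2) / 2"
  shows "kl_risk r s (predictive r s (shrinkage_prior (theta_diff r s) (f_sym \<eta> \<alpha>))) lam <
    kl_risk r s (predictive r s jeffreys) lam"
proof -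
  define a where "a = (\<chi> i. r $ i * lam $ i)"
  define b where "b = (\<chi> i. s $ i * lam $ i)"
  have a: "a $ i > 0" and b: "b $ i > 0" for i using r[of i] s[of i] lam by (auto simp: a_def b_def orthant_def)
  define v where "v = (\<chi> i. 1 / (r $ i * gam r s $ i))"
  define v' where "v' = (\<chi> i. 1 / ((r $ i + s $ i) * gam r s $ i))"
  define p where "p = (\<chi> i. a $ i / (a $ i + b $ i))"
  \<comment> \<open>Both quotients come from \<open>gam\<close> being s / (r (r + s)); their
    inverses differ by exactly 1.\<close>
  have g: "r $ i * gam r s $ i = s $ i / (r $ i + s $ i)" "(r $ i + s $ i) * gam r s $ i = s $ i / r $ i" for i
    using r[of i] s[of i] add_pos_pos[OF r[of i] s[of i]] by (simp_all add: gam_def right_diff_distrib diff_divide_eq_iff add_divide_distrib)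
  have v: "v $ i = (r $ i + s $ i) / s $ i" and v': "v' $ i = r $ i / s $ i" for i
    by (simp_all add: v_def v'_def g)
  have vpos: "v $ i > 0" "v' $ i > 0" for i using r[of i] s[of i] by (simp_all add: v v')
  have vv: "v $ i = v' $ i + 1" for i using s[of i] by (simp add: v v' field_simps)
  have l: "lam $ i > 0" for i using lam by (simp add: orthant_def)
  \<comment> \<open>Here \<lambda> cancels, and the Poisson splitting probability r / (r + s) is the
    one for which the convolution identity holds.\<close>
  have pv: "p $ i = v' $ i / (v' $ i + 1)" for i
  proof -
    have "p $ i = r $ i / (r $ i + s $ i)"
      using l[of i] by (simp add: p_def a_def b_def distrib_right[symmetric])
    then show ?thesis using r[of i] s[of i] by (simp add: v' field_simps)
  qed
  have \<alpha>2: "\<alpha> < real CARD('d) / 2" using \<alpha> by (simp add: field_simps)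
  define F where "F = power_mean \<alpha> \<eta> v"
  define G where "G = power_mean \<alpha> \<eta> v'"
  note Fp = power_mean_properties[OF vpos(1) \<alpha>(1) \<alpha>2, where \<eta> = \<eta>, folded F_def]
  note Gp = power_mean_properties[OF vpos(2) \<alpha>(1) \<alpha>2, where \<eta> = \<eta>, folded G_def]
  let ?J = "\<lambda>x y. ln (poisson_prob s lam y / predictive r s jeffreys x y)"
  let ?H = "\<lambda>x y. ln (G (x + y)) - ln (F x)"
  let ?q = "predictive r s (shrinkage_prior (theta_diff r s) (f_sym \<eta> \<alpha>))"
  let ?P = "pair_pmf (poisson_vec_pmf a) (poisson_vec_pmf b)"
  have q: "?q x y = predictive r s jeffreys x y * (G (x + y) / F x)" for x y
    by (simp add: predictive_shrinkage[OF r s \<alpha>(1)] F_def G_def v_def v'_def)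
  have qpos: "?q x y > 0" for x y
    unfolding q using predictive_jeffreys_pos[OF r s] Fp(2) Gp(2) by simp
  have pp: "poisson_prob s lam y > 0" for y
    unfolding poisson_prob_eq_poisson_vec_pmf[OF s lam] by (rule pmf_poisson_vec_pmf_pos) (use b in \<open>simp add: b_def\<close>)
  have ln_q: "ln (poisson_prob s lam y / ?q x y) = ?J x y - ?H x y" for x y
    unfolding q using pp[of y] predictive_jeffreys_pos[OF r s, of x y] Fp(2)[of x] Gp(2)[of "x + y"]
    by (simp add: ln_div ln_mult_pos)
  obtain C where C: "\<bar>?J x y\<bar> \<le> C * (pow2_weight x * pow2_weight y)" for x y
    using ln_ratio_jeffreys_bound[OF r s lam] by blast
  obtain C1 where C1: "\<bar>ln (F z)\<bar> \<le> C1 * pow2_weight z" for z using Fp(3) by blast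
  obtain C2 where C2: "\<bar>ln (G z)\<bar> \<le> C2 * pow2_weight z" for z using Gp(3) by blast
  have C1n: "0 \<le> C1" using C1[of 0] by (simp add: pow2_weight_def)
  have H: "\<bar>?H x y\<bar> \<le> (C1 + C2) * (pow2_weight x * pow2_weight y)" for x y
  proof -
    have "C1 * pow2_weight x * 1 \<le> C1 * pow2_weight x * pow2_weight y"
      using C1n pow2_weight_ge_1[of y] by (intro mult_left_mono) auto
    then show ?thesis using C1[of x] C2[of "x + y"] by (simp add: pow2_weight_add algebra_simps abs_le_iff)
  qed
  have intJ: "integrable (measure_pmf ?P) (\<lambda>(x, y). ?J x y)"
    using C by (intro integrable_pair_poisson_vec_pmf[OF a b, where C = C]) simp
  have intH: "integrable (measure_pmf ?P) (\<lambda>(x, y). ?H x y)"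
    using H by (intro integrable_pair_poisson_vec_pmf[OF a b, where C = "C1 + C2"]) simp
  have "kl_risk r s ?q lam = ereal (measure_pmf.expectation ?P (\<lambda>(x, y). ln (poisson_prob s lam y / ?q x y)))"
    unfolding a_def b_def
  proof (rule kl_risk_eq_expectation[OF r s lam qpos])
    show "\<bar>ln (poisson_prob s lam y / ?q x y)\<bar> \<le> (C + (C1 + C2)) * (pow2_weight x * pow2_weight y)" for x y
      unfolding ln_q distrib_right[of C] using C[of y x] H[of x y] by linarith
  qed
  also have "(\<lambda>(x, y). ln (poisson_prob s lam y / ?q x y)) = (\<lambda>z. (case z of (x, y) \<Rightarrow> ?J x y) - (case z of (x, y) \<Rightarrow> ?H x y))"
    by (auto simp: fun_eq_iff ln_q)
  also have "measure_pmf.expectation ?P \<dots> = measure_pmf.expectation ?P (\<lambda>(x, y). ?J x y) - measure_pmf.expectation ?P (\<lambda>(x, y). ?H x y)"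
    by (rule Bochner_Integration.integral_diff[OF intJ intH])
  finally have risk: "kl_risk r s ?q lam = ereal (measure_pmf.expectation ?P (\<lambda>(x, y). ?J x y) - measure_pmf.expectation ?P (\<lambda>(x, y). ?H x y))" .
  have "measure_pmf.expectation ?P (\<lambda>(x, y). ?H x y) > 0"
  proof (rule expectation_ln_ratio_pos[OF a b _ Fp(2) Gp(2) _ intH])
    show "p $ i = a $ i / (a $ i + b $ i)" for i by (simp add: p_def)
    show "(\<Sum>x\<in>{x. \<forall>i. x $ i \<le> n $ i}. ennreal (binom_vec p n x) * ennreal (F x)) < ennreal (G n)" for n
      unfolding Fp(1)[symmetric] Gp(1)[symmetric]
      by (rule power_average_thinning_less[OF vpos(2) vv pv \<alpha>])
  qed
  then show ?thesis
    unfolding risk kl_risk_jeffreys[OF r s lam] a_def[symmetric] b_def[symmetric] by simp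
qed

section \<open>A bound for Poisson expectations of logarithms\<close>

text \<open>Exponential generating functions: \<open>exp (- \<mu>) * egf g \<mu>\<close> is the mean of \<open>g Z\<close> for \<open>Z\<close> Poisson with mean \<open>\<mu>\<close>.\<close>

definition egf :: "(nat \<Rightarrow> real) \<Rightarrow> real \<Rightarrow> real" where
  "egf g \<mu> = (\<Sum>k. g k / fact k * \<mu> ^ k)"

definition egf_conv :: "(nat \<Rightarrow> real) \<Rightarrow> bool" where
  "egf_conv g \<longleftrightarrow> (\<forall>\<mu>. summable (\<lambda>k. g k / fact k * \<mu> ^ k))"

lemma egf_convD: "egf_conv g \<Longrightarrow> summable (\<lambda>k. g k / fact k * \<mu> ^ k)"
  by (simp add: egf_conv_def)

lemma egf_conv_bound:
  assumes "\<And>k. \<bar>g k\<bar> \<le> C * 2 ^ k"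
  shows "egf_conv g"
  unfolding egf_conv_def
proof (intro allI, rule summable_comparison_test[OF _ summable_mult[OF summable_exp]])
  fix \<mu> :: real
  have "norm (g k / fact k * \<mu> ^ k) \<le> C * (inverse (fact k) * (2 * \<bar>\<mu>\<bar>) ^ k)" for k
  proof -
    have "norm (g k / fact k * \<mu> ^ k) = \<bar>g k\<bar> * (inverse (fact k) * \<bar>\<mu>\<bar> ^ k)"
      by (simp add: abs_mult power_abs divide_inverse)
    also have "\<dots> \<le> C * 2 ^ k * (inverse (fact k) * \<bar>\<mu>\<bar> ^ k)"
      using assms by (intro mult_right_mono) auto
    finally show ?thesis by (simp add: power_mult_distrib mult_ac)
  qed
  then show "\<exists>N. \<forall>n\<ge>N. norm (g n / fact n * \<mu> ^ n) \<le> C * (inverse (fact n) * (2 * \<bar>\<mu>\<bar>) ^ n)" by blast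
qed

lemma egf_conv_const: "egf_conv (\<lambda>k. c)"
proof (rule egf_conv_bound)
  fix k
  have "\<bar>c\<bar> * 1 \<le> \<bar>c\<bar> * 2 ^ k" by (intro mult_left_mono) auto
  then show "\<bar>c\<bar> \<le> \<bar>c\<bar> * 2 ^ k" by simp
qed

lemma egf_add:
  assumes "egf_conv f" "egf_conv g"
  shows "egf_conv (\<lambda>k. f k + g k)" "egf (\<lambda>k. f k + g k) \<mu> = egf f \<mu> + egf g \<mu>"
  using summable_add[OF egf_convD[OF assms(1)] egf_convD[OF assms(2)]]
    suminf_add[OF egf_convD[OF assms(1)] egf_convD[OF assms(2)], of \<mu> \<mu>]
  by (simp_all add: egf_conv_def egf_def add_divide_distrib distrib_right)

lemma egf_diff:
  assumes "egf_conv f" "egf_conv g"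
  shows "egf_conv (\<lambda>k. f k - g k)" "egf (\<lambda>k. f k - g k) \<mu> = egf f \<mu> - egf g \<mu>"
  using summable_diff[OF egf_convD[OF assms(1)] egf_convD[OF assms(2)]]
    suminf_diff[OF egf_convD[OF assms(1)] egf_convD[OF assms(2)], of \<mu> \<mu>]
  by (simp_all add: egf_conv_def egf_def diff_divide_distrib left_diff_distrib)

lemma egf_cmult:
  assumes "egf_conv f"
  shows "egf_conv (\<lambda>k. c * f k)" "egf (\<lambda>k. c * f k) \<mu> = c * egf f \<mu>"
  using summable_mult[OF egf_convD[OF assms], of c] suminf_mult[OF egf_convD[OF assms], of c \<mu>]
  by (simp_all add: egf_conv_def egf_def mult.assoc)

lemma egf_const: "egf (\<lambda>k. c) \<mu> = c * exp \<mu>"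
proof -
  have "egf (\<lambda>k. 1) \<mu> = exp \<mu>" by (simp add: egf_def exp_def divide_inverse mult.commute scaleR_conv_of_real)
  then show ?thesis using egf_cmult(2)[OF egf_conv_const[of 1], of c \<mu>] by simp
qed

lemma egf_mono:
  assumes "egf_conv f" "egf_conv g" "\<And>k. f k \<le> g k" "\<mu> \<ge> 0"
  shows "egf f \<mu> \<le> egf g \<mu>"
  unfolding egf_def using assms
  by (intro suminf_le egf_convD) (auto intro!: mult_right_mono divide_right_mono)

text \<open>Multiplication by \<mu> shifts coefficients; at n = 0 the truncated index is harmless,
  since the value is multiplied by 0.\<close>

lemma egf_shift:
  assumes "egf_conv g"
  shows "egf_conv (\<lambda>n. real n * g (n - 1))" "egf (\<lambda>n. real n * g (n - 1)) \<mu> = \<mu> * egf g \<mu>"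
proof -
  have eq: "real (Suc n) * g (Suc n - 1) / fact (Suc n) * \<mu> ^ Suc n = \<mu> * (g n / fact n * \<mu> ^ n)" for n \<mu>
    by (simp add: field_simps del: of_nat_Suc)
  have s: "summable (\<lambda>n. real (Suc n) * g (Suc n - 1) / fact (Suc n) * \<mu> ^ Suc n)" for \<mu>
    unfolding eq using egf_convD[OF assms] by (rule summable_mult)
  then show conv: "egf_conv (\<lambda>n. real n * g (n - 1))"
    unfolding egf_conv_def using summable_Suc_iff[of "\<lambda>n. real n * g (n - 1) / fact n * \<mu> ^ n" for \<mu>] by simp
  have "egf (\<lambda>n. real n * g (n - 1)) \<mu> = (\<Sum>n. real (Suc n) * g (Suc n - 1) / fact (Suc n) * \<mu> ^ Suc n)"
    unfolding egf_def using suminf_split_head[OF egf_convD[OF conv, of \<mu>]] by simp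
  then show "egf (\<lambda>n. real n * g (n - 1)) \<mu> = \<mu> * egf g \<mu>"
    unfolding eq by (simp only: suminf_mult[OF egf_convD[OF assms]] egf_def)
qed

text \<open>Differentiation is an index shift, so the derivative of the Poisson mean
  \<open>exp (- \<mu>) * egf g \<mu>\<close> is the mean of the forward difference of
  \<open>g\<close>.\<close>

lemma egf_deriv:
  assumes "egf_conv g"
  shows "(egf g has_real_derivative egf (\<lambda>k. g (Suc k)) \<mu>) (at \<mu>)"
proof -
  have "diffs (\<lambda>k. g k / fact k) = (\<lambda>k. g (Suc k) / fact k)"
    by (simp add: fun_eq_iff diffs_def field_simps del: of_nat_Suc)
  then show ?thesis
    using termdiffs_strong_converges_everywhere[of "\<lambda>k. g k / fact k" \<mu>] egf_convD[OF assms]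
    by (simp add: egf_def[abs_def])
qed

lemma egf_conv_Suc:
  assumes "egf_conv g"
  shows "egf_conv (\<lambda>k. g (Suc k))"
  unfolding egf_conv_def
proof
  fix \<mu> :: real
  have "summable (\<lambda>n. diffs (\<lambda>k. g k / fact k) n * \<mu> ^ n)"
    by (rule termdiff_converges_all) (rule egf_convD[OF assms])
  then show "summable (\<lambda>k. g (Suc k) / fact k * \<mu> ^ k)"
    by (simp add: diffs_def field_simps del: of_nat_Suc)
qed

lemma expectation_poisson:
  assumes \<mu>: "\<mu> > 0" and g: "\<And>k. \<bar>g k\<bar> \<le> C * 2 ^ k"
  shows "integrable (measure_pmf (poisson_pmf \<mu>)) g"
    and "measure_pmf.expectation (poisson_pmf \<mu>) g = exp (- \<mu>) * egf g \<mu>"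
proof -
  show int: "integrable (measure_pmf (poisson_pmf \<mu>)) g"
  proof (rule integrableI_bounded)
    have "(\<integral>\<^sup>+k. ennreal (norm (g k)) \<partial>measure_pmf (poisson_pmf \<mu>)) \<le>
      (\<integral>\<^sup>+k. ennreal C * ennreal (2 ^ k) \<partial>measure_pmf (poisson_pmf \<mu>))"
      using g by (intro nn_integral_mono) (simp add: ennreal_mult''[symmetric] ennreal_leI)
    also have "\<dots> < \<infinity>"
      by (simp add: nn_integral_cmult nn_integral_poisson_power2[OF \<mu>] ennreal_mult_less_top)
    finally show "(\<integral>\<^sup>+k. ennreal (norm (g k)) \<partial>measure_pmf (poisson_pmf \<mu>)) < \<infinity>" .
  qed simp
  have "(\<lambda>k. pmf (poisson_pmf \<mu>) k * g k) sums measure_pmf.expectation (poisson_pmf \<mu>) g"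
    by (rule has_sum_imp_sums) (rule has_sum_pmf_expectation[OF int])
  moreover have "(\<lambda>k. exp (- \<mu>) * (g k / fact k * \<mu> ^ k)) sums (exp (- \<mu>) * egf g \<mu>)"
    unfolding egf_def by (intro sums_mult summable_sums egf_convD egf_conv_bound[OF g])
  moreover have "pmf (poisson_pmf \<mu>) k * g k = exp (- \<mu>) * (g k / fact k * \<mu> ^ k)" for k
    using \<mu> by simp
  ultimately show "measure_pmf.expectation (poisson_pmf \<mu>) g = exp (- \<mu>) * egf g \<mu>"
    using sums_unique2 by fastforce
qed

text \<open>The left side is 2 (x + x^3 / 3 + x^5 / 5 + ...); putting 3 for the denominators from 5
  on gives a geometric series. The proof differentiates instead: right side minus left side has
  derivative 4 t^4 / (3 (1 - t^2)^2).\<close>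

lemma ln_quotient_le:
  fixes x :: real
  assumes "0 \<le> x" "x < 1"
  shows "ln (1 + x) - ln (1 - x) \<le> 2 * x + 2 * x ^ 3 / (3 * (1 - x\<^sup>2))"
proof -
  let ?f = "\<lambda>x::real. 2 * x + 2 * x ^ 3 / (3 * (1 - x\<^sup>2)) - (ln (1 + x) - ln (1 - x))"
  have "?f 0 \<le> ?f x"
  proof (rule DERIV_nonneg_imp_nondecreasing[OF assms(1)])
    fix t assume t: "0 \<le> t" "t \<le> x"
    then have t1: "t < 1" "t\<^sup>2 < 1" using assms by (auto simp: power2_eq_square intro: le_less_trans[OF mult_left_le_one_le])
    have "(?f has_real_derivative 2 + (6 * t\<^sup>2 * (3 * (1 - t\<^sup>2)) - 2 * t ^ 3 * (- 6 * t)) / (3 * (1 - t\<^sup>2))\<^sup>2 - (1 / (1 + t) + 1 / (1 - t))) (at t)"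
      using t t1 by (auto intro!: derivative_eq_intros simp: power2_eq_square power3_eq_cube field_simps)
    moreover have "2 + (6 * t\<^sup>2 * (3 * (1 - t\<^sup>2)) - 2 * t ^ 3 * (- 6 * t)) / (3 * (1 - t\<^sup>2))\<^sup>2 - (1 / (1 + t) + 1 / (1 - t))
      = 4 * t ^ 4 / (3 * (1 - t\<^sup>2)\<^sup>2)"
    proof -
      have u: "1 - t\<^sup>2 \<noteq> 0" "1 + t \<noteq> 0" "1 - t \<noteq> 0" using t t1 by auto
      have "1 / (1 + t) + 1 / (1 - t) = 2 / (1 - t\<^sup>2)"
        using u by (simp add: field_simps power2_eq_square)
      moreover have "2 + (6 * t\<^sup>2 * (3 * (1 - t\<^sup>2)) - 2 * t ^ 3 * (- 6 * t)) / (3 * (1 - t\<^sup>2))\<^sup>2 - 2 / (1 - t\<^sup>2)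
        = 4 * t ^ 4 / (3 * (1 - t\<^sup>2)\<^sup>2)"
      proof -
        have "2 + (6 * (1 - U) * (3 * U) + 12 * (1 - U) * (1 - U)) / (3 * U)\<^sup>2 - 2 / U = 4 * ((1 - U) * (1 - U)) / (3 * U\<^sup>2)"
          if "U \<noteq> 0" for U :: real
          using that by (simp add: field_simps power2_eq_square)
        from this[of "1 - t\<^sup>2"] u show ?thesis
          by (simp add: power2_eq_square power3_eq_cube power4_eq_xxxx mult_ac)
      qed
      ultimately show ?thesis by simp
    qed
    ultimately show "\<exists>y. (?f has_real_derivative y) (at t) \<and> 0 \<le> y"
      by (intro exI[of _ "4 * t ^ 4 / (3 * (1 - t\<^sup>2)\<^sup>2)"]) auto
  qed
  then show ?thesis by simp
qed

definition ln_plus_half :: "nat \<Rightarrow> real" where "ln_plus_half k = ln (real k + 1 / 2)"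

text \<open>Expansion at the midpoint y = k + 1: the quotient (k + 3 / 2) / (k + 1 / 2) is (1 + x) /
  (1 - x) with x = 1 / (2 y). Even orders drop out, so the error beyond 1 / (k + 1) is of third
  order.\<close>

lemma ln_plus_half_Suc_diff_le:
  "ln_plus_half (Suc k) - ln_plus_half k \<le> 1 / (real k + 1) + 1 / (12 * (real k + 1 / 2) * (real k + 1) * (real k + 3 / 2))"
proof -
  define y where "y = real k + 1"
  have y: "y \<ge> 1" by (simp add: y_def)
  define x where "x = 1 / (2 * y)"
  have x: "0 \<le> x" "x < 1" using y by (auto simp: x_def)
  have "1 + x = (y + 1 / 2) / y" "1 - x = (y - 1 / 2) / y" using y by (simp_all add: x_def field_simps)
  then have "ln (1 + x) = ln (y + 1 / 2) - ln y" "ln (1 - x) = ln (y - 1 / 2) - ln y"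
    using y by (simp_all add: ln_div)
  then have "ln_plus_half (Suc k) - ln_plus_half k = ln (1 + x) - ln (1 - x)"
    by (simp add: ln_plus_half_def y_def add_ac)
  also have "\<dots> \<le> 2 * x + 2 * x ^ 3 / (3 * (1 - x\<^sup>2))" by (rule ln_quotient_le[OF x])
  also have "\<dots> = 1 / y + 1 / (12 * (y - 1 / 2) * y * (y + 1 / 2))"
  proof -
    define A where "A = (y - 1 / 2) * (y + 1 / 2)"
    have n: "y \<noteq> 0" "A \<noteq> 0" using y by (auto simp: A_def)
    have 1: "1 - x\<^sup>2 = A / y\<^sup>2"
      using n(1) by (simp add: x_def A_def power2_eq_square field_simps)
    have 2: "2 * x ^ 3 / (3 * (A / y\<^sup>2)) = 1 / (12 * A * y)"
      using n by (simp add: x_def power2_eq_square power3_eq_cube field_simps)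
    have 3: "12 * (y - 1 / 2) * y * (y + 1 / 2) = 12 * A * y" by (simp only: A_def mult_ac)
    show ?thesis unfolding 1 2 3 by (simp add: x_def)
  qed
  finally show ?thesis by (simp add: y_def add_ac)
qed


text \<open>The coefficients of \<open>(\<mu> + 1 / 50) exp \<mu> - \<mu>\<^sup>2 egf (\<lambda>k. ln_plus_half (Suc k) - ln_plus_half k) \<mu>\<close>.
  Only those of index 2 to 6 can be negative.\<close>

definition gap_coeff :: "nat \<Rightarrow> real" where
  "gap_coeff n = real n + 1 / 50 - real n * (real (n - 1) * (ln_plus_half (Suc (n - 2)) - ln_plus_half (n - 2)))"

text \<open>For k = n - 2 the main term 1 / (k + 1) of the increment cancels the \<open>n\<close>
  exactly. What remains is 1 / 50 against n (n - 1) times the third-order error.\<close>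

lemma gap_coeff_ge:
  assumes "n \<ge> 2"
  shows "gap_coeff n \<ge> 1 / 50 - real n / (12 * (real n - 3 / 2) * (real n - 1 / 2))"
proof -
  define k where "k = n - 2"
  have n: "n = k + 2" using assms by (simp add: k_def)
  define x where "x = real k"
  have x: "x \<ge> 0" by (simp add: x_def)
  have n1: "real (n - 1) = x + 1" "real n = x + 2" by (simp_all add: n x_def)
  have "(x + 1) * (ln_plus_half (Suc k) - ln_plus_half k) \<le> (x + 1) * (1 / (x + 1) + 1 / (12 * (x + 1 / 2) * (x + 1) * (x + 3 / 2)))"
    using ln_plus_half_Suc_diff_le[of k] x unfolding x_def by (intro mult_left_mono) auto
  also have "\<dots> = 1 + 1 / (12 * (x + 1 / 2) * (x + 3 / 2))"
  proof -
    have *: "m * (1 / m + 1 / (12 * p * m * q)) = 1 + 1 / (12 * p * q)" if "m \<noteq> 0" for m p q :: real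
      using that by (simp add: distrib_left)
    show ?thesis by (rule *) (use x in simp)
  qed
  finally have "(x + 2) * ((x + 1) * (ln_plus_half (Suc k) - ln_plus_half k)) \<le> (x + 2) * (1 + 1 / (12 * (x + 1 / 2) * (x + 3 / 2)))"
    using x by (intro mult_left_mono) auto
  moreover have "gap_coeff n = (x + 2) + 1 / 50 - (x + 2) * ((x + 1) * (ln_plus_half (Suc k) - ln_plus_half k))"
    unfolding gap_coeff_def n1 k_def[symmetric] ..
  moreover have "(x + 2) * (1 + 1 / (12 * (x + 1 / 2) * (x + 3 / 2))) = (x + 2) + (x + 2) / (12 * (x + 1 / 2) * (x + 3 / 2))"
    by (simp add: distrib_left)
  moreover have "(x + 2) / (12 * (x + 1 / 2) * (x + 3 / 2)) = real n / (12 * (real n - 3 / 2) * (real n - 1 / 2))"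
  proof -
    have "x + 2 - 3 / 2 = x + 1 / 2" "x + 2 - 1 / 2 = x + 3 / 2" by simp_all
    then show ?thesis unfolding n1 by (simp only:)
  qed
  ultimately show ?thesis by linarith
qed

lemma gap_coeff_nonneg:
  assumes "n \<ge> 7"
  shows "gap_coeff n \<ge> 0"
proof -
  have n: "real n \<ge> 7" using assms by simp
  \<comment> \<open>The difference of the two sides is 12 n^2 - 74 n + 9, which is -3 at n = 6 and
    79 at n = 7; hence the threshold. The product used here is smaller by 79 and has the root
    7.\<close>
  have "50 * real n \<le> 12 * ((real n - 3 / 2) * (real n - 1 / 2))"
  proof -
    have "0 \<le> (real n - 7) * (12 * real n + 10)" using n by (intro mult_nonneg_nonneg) auto
    then have "0 \<le> 12 * (real n * real n) - 74 * real n - 70" by (simp add: algebra_simps)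
    then show ?thesis by (simp add: algebra_simps)
  qed
  moreover have "0 < 12 * (real n - 3 / 2) * (real n - 1 / 2)" using n by simp
  moreover have "real n / D \<le> 1 / 50" if "0 < D" "50 * real n \<le> D" for D
    using that by (simp add: field_simps)
  ultimately have "real n / (12 * (real n - 3 / 2) * (real n - 1 / 2)) \<le> 1 / 50"
    by (simp only: mult.assoc)
  then show ?thesis using gap_coeff_ge[of n] assms by linarith
qed

text \<open>Weighted AM-GM between the monomials and \<open>x ^ 6\<close>, with equality at \<open>x = 1\<close>.\<close>

lemma power_6_tangent_upper:
  fixes x :: real
  assumes "x \<ge> 0"
  shows "6 * x \<le> 5 + x ^ 6" "6 * x ^ 2 \<le> 4 + 2 * x ^ 6" "6 * x ^ 3 \<le> 3 + 3 * x ^ 6"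
    "6 * x ^ 4 \<le> 2 + 4 * x ^ 6" "6 * x ^ 5 \<le> 1 + 5 * x ^ 6"
proof -
  have "5 + x ^ 6 - 6 * x = (x - 1)\<^sup>2 * (x ^ 4 + 2 * x ^ 3 + 3 * x ^ 2 + 4 * x + 5)" by algebra
  also have "\<dots> \<ge> 0" using assms by (intro mult_nonneg_nonneg add_nonneg_nonneg) auto
  finally show "6 * x \<le> 5 + x ^ 6" by simp
  have "4 + 2 * x ^ 6 - 6 * x ^ 2 = 2 * (x ^ 2 - 1)\<^sup>2 * (x ^ 2 + 2)" by algebra
  also have "\<dots> \<ge> 0" by simp
  finally show "6 * x ^ 2 \<le> 4 + 2 * x ^ 6" by simp
  have "3 + 3 * x ^ 6 - 6 * x ^ 3 = 3 * (x ^ 3 - 1)\<^sup>2" by algebra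
  also have "\<dots> \<ge> 0" by simp
  finally show "6 * x ^ 3 \<le> 3 + 3 * x ^ 6" by simp
  have "2 + 4 * x ^ 6 - 6 * x ^ 4 = 2 * (x ^ 2 - 1)\<^sup>2 * (2 * x ^ 2 + 1)" by algebra
  also have "\<dots> \<ge> 0" by simp
  finally show "6 * x ^ 4 \<le> 2 + 4 * x ^ 6" by simp
  have "1 + 5 * x ^ 6 - 6 * x ^ 5 = (x - 1)\<^sup>2 * (5 * x ^ 4 + 4 * x ^ 3 + 3 * x ^ 2 + 2 * x + 1)" by algebra
  also have "\<dots> \<ge> 0" using assms by (intro mult_nonneg_nonneg add_nonneg_nonneg) auto
  finally show "6 * x ^ 5 \<le> 1 + 5 * x ^ 6" by simp
qed

text \<open>As a function of t = x^6, the monomial x^k is convex for k > 6, so its tangent at t = 1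
  lies below it.\<close>

lemma power_6_tangent_lower:
  fixes x :: real
  assumes "x \<ge> 0"
  shows "7 * x ^ 6 - 1 \<le> 6 * x ^ 7" "8 * x ^ 6 - 2 \<le> 6 * x ^ 8" "9 * x ^ 6 - 3 \<le> 6 * x ^ 9"
    "10 * x ^ 6 - 4 \<le> 6 * x ^ 10" "11 * x ^ 6 - 5 \<le> 6 * x ^ 11"
proof -
  have "6 * x ^ 7 - (7 * x ^ 6 - 1) = (x - 1)\<^sup>2 * (6 * x ^ 5 + 5 * x ^ 4 + 4 * x ^ 3 + 3 * x ^ 2 + 2 * x + 1)" by algebra
  also have "\<dots> \<ge> 0" using assms by (intro mult_nonneg_nonneg add_nonneg_nonneg) auto
  finally show "7 * x ^ 6 - 1 \<le> 6 * x ^ 7" by simp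
  have "6 * x ^ 8 - (8 * x ^ 6 - 2) = 2 * (x ^ 2 - 1)\<^sup>2 * (3 * x ^ 4 + 2 * x ^ 2 + 1)" by algebra
  also have "\<dots> \<ge> 0" by simp
  finally show "8 * x ^ 6 - 2 \<le> 6 * x ^ 8" by simp
  have "6 * x ^ 9 - (9 * x ^ 6 - 3) = 3 * (x ^ 3 - 1)\<^sup>2 * (2 * x ^ 3 + 1)" by algebra
  also have "\<dots> \<ge> 0" using assms by simp
  finally show "9 * x ^ 6 - 3 \<le> 6 * x ^ 9" by simp
  have "6 * x ^ 10 - (10 * x ^ 6 - 4) = 2 * (x ^ 2 - 1)\<^sup>2 * (3 * x ^ 6 + 6 * x ^ 4 + 4 * x ^ 2 + 2)" by algebra
  also have "\<dots> \<ge> 0" by simp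
  finally show "10 * x ^ 6 - 4 \<le> 6 * x ^ 10" by simp
  have "6 * x ^ 11 - (11 * x ^ 6 - 5) = (x - 1)\<^sup>2 * (6 * x ^ 9 + 12 * x ^ 8 + 18 * x ^ 7 + 24 * x ^ 6 + 30 * x ^ 5
    + 25 * x ^ 4 + 20 * x ^ 3 + 15 * x ^ 2 + 10 * x + 5)" by algebra
  also have "\<dots> \<ge> 0" using assms by (intro mult_nonneg_nonneg add_nonneg_nonneg) auto
  finally show "11 * x ^ 6 - 5 \<le> 6 * x ^ 11" by simp
qed

lemma sum_atMost_12:
  fixes f :: "nat \<Rightarrow> real"
  shows "(\<Sum>n\<le>12. f n) = f 0 + f 1 + f 2 + f 3 + f 4 + f 5 + f 6 + f 7 + f 8 + f 9 + f 10 + f 11 + f 12"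
  by (simp add: eval_nat_numeral)

text \<open>The rescaling by \<open>13 / 2\<close> places the equality case of the tangent bounds near the minimum of
  the polynomial.\<close>

lemma gap_coeff_sum_pos:
  assumes \<mu>: "\<mu> > 0"
  shows "(\<Sum>n\<le>12. gap_coeff n / fact n * \<mu> ^ n) > 0"
proof -
  define x where "x = \<mu> / (13 / 2)"
  have x: "x \<ge> 0" "x > 0" "\<mu> = 13 / 2 * x" using \<mu> by (simp_all add: x_def)
  \<comment> \<open>The values at 0 and 1 are exact; from 2 on the logarithms give way to the
    rational bound of \<open>gap_coeff_ge\<close>.\<close>
  define c where "c n = (if n = 0 then 1 / 50 else if n = 1 then 51 / 50 else 1 / 50 - real n / (12 * (real n - 3 / 2) * (real n - 1 / 2)))" for n
  have "c n \<le> gap_coeff n" for n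
  proof -
    consider "n = 0" | "n = 1" | "n \<ge> 2" by linarith
    then show ?thesis
    proof cases
      case 3
      then have "c n = 1 / 50 - real n / (12 * (real n - 3 / 2) * (real n - 1 / 2))" unfolding c_def by simp
      with gap_coeff_ge[OF 3] show ?thesis by simp
    qed (simp_all add: c_def gap_coeff_def)
  qed
  then have "(\<Sum>n\<le>12. c n / fact n * \<mu> ^ n) \<le> (\<Sum>n\<le>12. gap_coeff n / fact n * \<mu> ^ n)"
    using \<mu> by (intro sum_mono mult_right_mono divide_right_mono) auto
  moreover have "(\<Sum>n\<le>12. c n / fact n * \<mu> ^ n) > 0"
  proof -
    \<comment> \<open>Splitting off the constant term and a factor \<mu> leaves degree 11, with
      negative coefficients at x to x^5 and positive ones from x^6 on.\<close>
    define P where "P = c 1 + c 2 * (13 / 2) / 2 * x + c 3 * (13 / 2) ^ 2 / 6 * x ^ 2 + c 4 * (13 / 2) ^ 3 / 24 * x ^ 3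
      + c 5 * (13 / 2) ^ 4 / 120 * x ^ 4 + c 6 * (13 / 2) ^ 5 / 720 * x ^ 5 + c 7 * (13 / 2) ^ 6 / 5040 * x ^ 6
      + c 8 * (13 / 2) ^ 7 / 40320 * x ^ 7 + c 9 * (13 / 2) ^ 8 / 362880 * x ^ 8 + c 10 * (13 / 2) ^ 9 / 3628800 * x ^ 9
      + c 11 * (13 / 2) ^ 10 / 39916800 * x ^ 10 + c 12 * (13 / 2) ^ 11 / 479001600 * x ^ 11"
    have "(\<Sum>n\<le>12. c n / fact n * \<mu> ^ n) = c 0 + \<mu> * P"
      unfolding sum_atMost_12 P_def x(3) by (simp add: fact_numeral power_mult_distrib algebra_simps eval_nat_numeral)
    moreover have "P = 51 / 50 - 1183 * x / 1800 - 1183 * x ^ 2 / 3600 - 41743 * x ^ 3 / 201600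
        - 1742221 * x ^ 4 / 18144000 - 371293 * x ^ 5 / 114048000 + 29332147 * x ^ 6 / 532224000
        + 178591933 * x ^ 7 / 2322432000 + 815730721 * x ^ 8 / 11280384000
        + 710501457991 * x ^ 9 / 12859637760000 + 89194444226303 * x ^ 10 / 2446356971520000
        + 507181391512471 * x ^ 11 / 23691035934720000"
      unfolding P_def c_def by (simp add: power_divide)
    \<comment> \<open>The upper tangents serve the negative terms, the lower ones the terms above
      x^6. What remains is a constant of about 0.01 plus a positive multiple of x^6.\<close>
    then have "P \<ge> 0"
      using power_6_tangent_upper[OF x(1)] power_6_tangent_lower[OF x(1)] zero_le_power[OF x(1), of 6]
      by linarith
    ultimately show ?thesis using \<mu> by (simp add: c_def add_pos_nonneg)
  qed
  ultimately show ?thesis by linarith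
qed


lemma abs_ln_plus_half_le: "\<bar>ln_plus_half k\<bar> \<le> 3 * 2 ^ k"
proof -
  have "ln_plus_half k = ln (half_gamma (Suc k)) - ln (half_gamma k)"
    by (simp add: ln_plus_half_def half_gamma_Suc ln_mult_pos)
  then show ?thesis using abs_ln_half_gamma_le[of k] abs_ln_half_gamma_le[of "Suc k"]
    by simp
qed

lemma egf_conv_ln_plus_half: "egf_conv ln_plus_half"
  using abs_ln_plus_half_le by (rule egf_conv_bound)

lemma egf_conv_ln_half_gamma: "egf_conv (\<lambda>k. ln (half_gamma k))"
  by (rule egf_conv_bound[where C = 1]) (use abs_ln_half_gamma_le in simp)

text \<open>Two shifts absorb the factors \<mu>, so that the difference of the sides has the
  coefficients \<open>gap_coeff\<close>. Their partial sum up to 12 is positive, and no later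
  coefficient is negative.\<close>

lemma egf_ln_plus_half_diff_less:
  assumes \<mu>: "\<mu> > 0"
  shows "\<mu> * (\<mu> * egf (\<lambda>k. ln_plus_half (Suc k) - ln_plus_half k) \<mu>) < (\<mu> + 1 / 50) * exp \<mu>"
proof -
  let ?c = "\<lambda>k. ln_plus_half (Suc k) - ln_plus_half k"
  have c: "egf_conv ?c" by (intro egf_diff egf_conv_Suc egf_conv_ln_plus_half)
  note s1 = egf_shift[OF c]
  note s2 = egf_shift[OF s1(1)]
  note e1 = egf_shift[OF egf_conv_const[of 1]]
  have n: "egf_conv (\<lambda>n. real n * 1 + 1 / 50)" "egf (\<lambda>n. real n * 1 + 1 / 50) \<mu> = \<mu> * exp \<mu> + 1 / 50 * exp \<mu>"
    using egf_add[OF e1(1) egf_conv_const[of "1 / 50"]] by (simp_all only: e1(2) egf_const mult_1)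
  have gap_coeff_eq: "gap_coeff = (\<lambda>n. real n * 1 + 1 / 50 - real n * (real (n - 1) * ?c (n - 1 - 1)))"
    by (simp add: fun_eq_iff gap_coeff_def numeral_2_eq_2)
  have conv: "egf_conv gap_coeff"
    unfolding gap_coeff_eq by (rule egf_diff(1)[OF n(1) s2(1)])
  have val: "egf gap_coeff \<mu> = \<mu> * exp \<mu> + 1 / 50 * exp \<mu> - \<mu> * (\<mu> * egf ?c \<mu>)"
    unfolding gap_coeff_eq egf_diff(2)[OF n(1) s2(1)] n(2) s2(2) s1(2) ..
  have "0 < (\<Sum>n\<le>12. gap_coeff n / fact n * \<mu> ^ n)" by (rule gap_coeff_sum_pos[OF \<mu>])
  also have "\<dots> \<le> egf gap_coeff \<mu>"
    unfolding egf_def using \<mu> by (intro sum_le_suminf egf_convD conv) (auto intro!: mult_nonneg_nonneg divide_nonneg_nonneg gap_coeff_nonneg)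
  finally show ?thesis unfolding val by (simp add: algebra_simps)
qed

section \<open>Sign of the derivative of the risk potential\<close>

definition risk_gap :: "real \<Rightarrow> real" where
  "risk_gap \<mu> = exp (- \<mu>) * egf ln_plus_half \<mu> - ln \<mu> + 1 / 50 / \<mu>"

lemma risk_gap_deriv_neg:
  assumes \<mu>: "\<mu> > 0"
  shows "\<exists>d<0. (risk_gap has_real_derivative d) (at \<mu>)"
proof -
  let ?E = "egf (\<lambda>k. ln_plus_half (Suc k) - ln_plus_half k) \<mu>"
  have E: "?E = egf (\<lambda>k. ln_plus_half (Suc k)) \<mu> - egf ln_plus_half \<mu>"
    by (rule egf_diff(2)[OF egf_conv_Suc[OF egf_conv_ln_plus_half] egf_conv_ln_plus_half])
  have "(risk_gap has_real_derivative exp (- \<mu>) * ?E - 1 / \<mu> - 1 / 50 / \<mu>\<^sup>2) (at \<mu>)"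
    unfolding risk_gap_def[abs_def] E using \<mu>
    by (auto intro!: derivative_eq_intros egf_deriv[OF egf_conv_ln_plus_half] simp: power2_eq_square algebra_simps)
  moreover have "exp (- \<mu>) * ?E - 1 / \<mu> - 1 / 50 / \<mu>\<^sup>2 < 0"
  proof -
    have "\<mu>\<^sup>2 * ?E < (\<mu> + 1 / 50) * exp \<mu>"
      using egf_ln_plus_half_diff_less[OF \<mu>] by (simp only: power2_eq_square mult.assoc)
    then have "?E / exp \<mu> < (\<mu> + 1 / 50) / \<mu>\<^sup>2"
      using \<mu> by (simp add: divide_less_eq less_divide_eq mult.commute)
    moreover have "(\<mu> + 1 / 50) / \<mu>\<^sup>2 = 1 / \<mu> + 1 / 50 / \<mu>\<^sup>2"
      using \<mu> by (simp add: add_divide_distrib power2_eq_square)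
    moreover have "exp (- \<mu>) * ?E = ?E / exp \<mu>" by (simp add: exp_minus divide_inverse)
    ultimately show ?thesis by linarith
  qed
  ultimately show ?thesis by blast
qed

text \<open>By ln t \<le> t - 1, ln (k + 1 / 2) is at least 1 + ln \<mu> - \<mu> / (k + 1 / 2). It
  therefore suffices that the Poisson mean of 1 / (k + 1 / 2) is at most 1 / \<mu> + 2 /
  \<mu>^2.\<close>

lemma risk_gap_ge:
  assumes \<mu>: "\<mu> > 0"
  shows "risk_gap \<mu> \<ge> - 2 / \<mu>"
proof -
  define h where "h k = 1 / (real k + 1 / 2)" for k
  define p where "p k = 1 / (real k + 1)" for k
  \<comment> \<open>One and two coefficient shifts bound the Poisson means of \<open>p\<close> and
    \<open>q\<close> by 1 / \<mu> and 1 / \<mu>^2. The comparison \<open>hpq\<close> with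
    \<open>h\<close> is an equality at k = 0, which is where the factor 2 comes from.\<close>
  define q where "q k = 1 / ((real k + 1) * (real k + 2))" for k
  have bnd: "egf_conv g" if "\<And>k. 0 \<le> g k" "\<And>k. g k \<le> 2" for g
  proof (rule egf_conv_bound[where C = 2])
    fix k
    have "\<bar>g k\<bar> \<le> 2 * 1" using that[of k] by simp
    also have "\<dots> \<le> 2 * 2 ^ k" by (intro mult_left_mono) auto
    finally show "\<bar>g k\<bar> \<le> 2 * 2 ^ k" .
  qed
  have h: "egf_conv h" by (rule bnd) (auto simp: h_def field_simps)
  have p: "egf_conv p" by (rule bnd) (auto simp: p_def field_simps)
  have q: "egf_conv q" by (rule bnd) (auto simp: q_def divide_le_eq algebra_simps)
  have hpq: "h k \<le> p k + 2 * q k" for k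
  proof -
    have "1 / (x + 1 / 2) \<le> 1 / (x + 1) + 2 * (1 / ((x + 1) * (x + 2)))" if "x \<ge> 0" for x :: real
    proof -
      have "1 / (x + 1) + 2 * (1 / ((x + 1) * (x + 2))) = (x + 4) / ((x + 1) * (x + 2))"
        using that by (simp add: divide_simps)
      moreover have "(x + 1) * (x + 2) \<le> (x + 4) * (x + 1 / 2)" using that by (simp add: algebra_simps)
      moreover have "1 / a \<le> b / c" if "0 < a" "0 < c" "c \<le> b * a" for a b c :: real
        using that by (simp add: field_simps)
      ultimately show ?thesis using that by simp
    qed
    then show ?thesis by (simp add: h_def p_def q_def)
  qed
  have "egf h \<mu> \<le> egf (\<lambda>k. p k + 2 * q k) \<mu>"
    using \<mu> hpq by (intro egf_mono h egf_add egf_cmult p q) auto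
  also have "\<dots> = egf p \<mu> + 2 * egf q \<mu>"
    by (simp add: egf_add(2)[OF p egf_cmult(1)[OF q]] egf_cmult(2)[OF q])
  finally have 1: "egf h \<mu> \<le> egf p \<mu> + 2 * egf q \<mu>" .
  have 2: "\<mu> * egf p \<mu> \<le> exp \<mu>"
    unfolding egf_shift(2)[OF p, symmetric] egf_const[of 1, simplified, symmetric]
    using \<mu> by (intro egf_mono egf_shift p egf_conv_const) (auto simp: p_def)
  have 3: "\<mu> * (\<mu> * egf q \<mu>) \<le> exp \<mu>"
    unfolding egf_shift(2)[OF q, symmetric] egf_shift(2)[OF egf_shift(1)[OF q], symmetric] egf_const[of 1, simplified, symmetric]
  proof (intro egf_mono egf_shift egf_conv_const q)
    fix k :: nat
    consider "k = 0" | "k = 1" | n where "k = Suc (Suc n)" by (metis One_nat_def old.nat.exhaust)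
    then show "real k * (real (k - 1) * q (k - 1 - 1)) \<le> 1"
      by cases (auto simp: q_def field_simps)
  qed (use \<mu> in simp)
  have "\<mu> * egf h \<mu> \<le> \<mu> * (egf p \<mu> + 2 * egf q \<mu>)" using 1 \<mu> by (intro mult_left_mono) auto
  also have "\<dots> = \<mu> * egf p \<mu> + 2 / \<mu> * (\<mu> * (\<mu> * egf q \<mu>))" using \<mu> by (simp add: distrib_left)
  also have "\<dots> \<le> exp \<mu> + 2 / \<mu> * exp \<mu>" using 2 3 \<mu> by (intro add_mono mult_left_mono) auto
  finally have 4: "\<mu> * egf h \<mu> \<le> exp \<mu> + 2 / \<mu> * exp \<mu>" .
  have "egf (\<lambda>k. (1 + ln \<mu>) - \<mu> * h k) \<mu> \<le> egf ln_plus_half \<mu>"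
  proof (intro egf_mono egf_diff egf_conv_const egf_cmult h egf_conv_ln_plus_half)
    fix k
    have "ln (\<mu> / (real k + 1 / 2)) \<le> \<mu> / (real k + 1 / 2) - 1" using \<mu> by (intro ln_le_minus_one) auto
    then show "(1 + ln \<mu>) - \<mu> * h k \<le> ln_plus_half k" using \<mu> by (simp add: ln_div ln_plus_half_def h_def)
  qed (use \<mu> in simp)
  moreover have "egf (\<lambda>k. (1 + ln \<mu>) - \<mu> * h k) \<mu> = (1 + ln \<mu>) * exp \<mu> - \<mu> * egf h \<mu>"
    by (simp add: egf_diff(2)[OF egf_conv_const egf_cmult(1)[OF h]] egf_cmult(2)[OF h] egf_const)
  ultimately have "(ln \<mu> - 2 / \<mu>) * exp \<mu> \<le> egf ln_plus_half \<mu>" using 4 by (simp add: algebra_simps)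
  then have "exp (- \<mu>) * ((ln \<mu> - 2 / \<mu>) * exp \<mu>) \<le> exp (- \<mu>) * egf ln_plus_half \<mu>" by (intro mult_left_mono) auto
  moreover have "exp (- \<mu>) * (c * exp \<mu>) = c" for c by (simp add: exp_minus)
  ultimately have "ln \<mu> - 2 / \<mu> \<le> exp (- \<mu>) * egf ln_plus_half \<mu>" by simp
  moreover have "1 / 50 / \<mu> \<ge> 0" using \<mu> by simp
  moreover have "- 2 / \<mu> = - (2 / \<mu>)" by simp
  ultimately show ?thesis unfolding risk_gap_def by linarith
qed

text \<open>A decreasing function that is at least - 2 / M at every M is nonnegative. Using this at
  \<open>\<mu> + 1\<close> leaves one strict decrease to reach a positive value at
  \<open>\<mu>\<close>.\<close>

lemma risk_gap_pos:
  assumes \<mu>: "\<mu> > 0"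
  shows "risk_gap \<mu> > 0"
proof -
  have dec: "risk_gap y < risk_gap x" if "0 < x" "x < y" for x y
    using that(2)
  proof (rule DERIV_neg_imp_decreasing)
    fix t assume "x \<le> t" "t \<le> y"
    then show "\<exists>d. (risk_gap has_real_derivative d) (at t) \<and> d < 0"
      using risk_gap_deriv_neg[of t] that(1) by auto
  qed
  have "risk_gap (\<mu> + 1) \<ge> - e" if e: "e > 0" for e
  proof -
    define M where "M = max (\<mu> + 2) (2 / e)"
    have M: "M > \<mu> + 1" "M \<ge> 2 / e" "M > 0" using \<mu> by (auto simp: M_def)
    have "2 / M \<le> e" using M e by (simp add: field_simps)
    then have "- e \<le> - 2 / M" by simp
    also have "\<dots> \<le> risk_gap M" by (rule risk_gap_ge[OF M(3)])
    also have "\<dots> < risk_gap (\<mu> + 1)" using M \<mu> by (intro dec) auto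
    finally show ?thesis by simp
  qed
  then have "0 \<le> risk_gap (\<mu> + 1) + e" if "e > 0" for e using that by fastforce
  then have "0 \<le> risk_gap (\<mu> + 1)" by (rule field_le_epsilon)
  also have "\<dots> < risk_gap \<mu>" using \<mu> by (intro dec) auto
  finally show ?thesis .
qed

section \<open>Near minimaxity\<close>

text \<open>This is \<open>\<psi> \<mu> + 0.52 ln \<mu>\<close>, with derivative \<open>risk_gap\<close>.\<close>

definition risk_potential :: "real \<Rightarrow> real" where
  "risk_potential \<mu> = exp (- \<mu>) * egf (\<lambda>k. ln (half_gamma k)) \<mu> - \<mu> * ln \<mu> + \<mu> + 1 / 50 * ln \<mu>"

lemma risk_potential_less:
  assumes "0 < x" "x < y"
  shows "risk_potential x < risk_potential y"
  using assms(2)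
proof (rule DERIV_pos_imp_increasing)
  fix \<mu> assume "x \<le> \<mu>" "\<mu> \<le> y"
  then have \<mu>: "\<mu> > 0" using assms(1) by simp
  let ?g = "\<lambda>k. ln (half_gamma k)"
  have ln_plus_half_eq: "ln_plus_half = (\<lambda>k. ?g (Suc k) - ?g k)"
    by (simp add: fun_eq_iff ln_plus_half_def half_gamma_Suc ln_mult_pos)
  have E: "egf ln_plus_half \<mu> = egf (\<lambda>k. ?g (Suc k)) \<mu> - egf ?g \<mu>"
    unfolding ln_plus_half_eq by (rule egf_diff(2)[OF egf_conv_Suc[OF egf_conv_ln_half_gamma] egf_conv_ln_half_gamma])
  have "(risk_potential has_real_derivative risk_gap \<mu>) (at \<mu>)"
    unfolding risk_potential_def[abs_def] risk_gap_def E using \<mu>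
    by (auto intro!: derivative_eq_intros egf_deriv[OF egf_conv_ln_half_gamma] simp: algebra_simps)
  then show "\<exists>d. (risk_potential has_real_derivative d) (at \<mu>) \<and> 0 < d"
    using risk_gap_pos[OF \<mu>] by blast
qed

lemma expectation_poisson_id:
  assumes "\<mu> > 0"
  shows "measure_pmf.expectation (poisson_pmf \<mu>) real = \<mu>"
proof -
  have "\<bar>real k\<bar> \<le> 1 * 2 ^ k" for k using of_nat_less_two_power[of k, where 'a = real] by simp
  then have "measure_pmf.expectation (poisson_pmf \<mu>) real = exp (- \<mu>) * egf real \<mu>"
    by (rule expectation_poisson(2)[OF assms])
  also have "egf real \<mu> = \<mu> * exp \<mu>"
    using egf_shift(2)[OF egf_conv_const[of 1], of \<mu>] by (simp add: egf_const)
  finally show ?thesis by (simp add: exp_minus)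
qed

lemma expectation_poisson_ln_gamma_mass:
  assumes \<mu>: "\<mu> > 0" and c: "c > 0"
  shows "measure_pmf.expectation (poisson_pmf \<mu>) (\<lambda>k. ln (gamma_mass c k)) =
    exp (- \<mu>) * egf (\<lambda>k. ln (half_gamma k)) \<mu> - \<mu> * ln c - ln c / 2"
proof -
  have ln: "ln (gamma_mass c k) = ln (half_gamma k) - (real k * ln c + ln c / 2)" for k
    using c less_imp_neq[OF half_gamma_pos, of k]
    by (simp add: gamma_mass_def ln_div ln_mult ln_realpow ln_sqrt)
  have i1: "integrable (measure_pmf (poisson_pmf \<mu>)) (\<lambda>k. ln (half_gamma k))"
    and e1: "measure_pmf.expectation (poisson_pmf \<mu>) (\<lambda>k. ln (half_gamma k)) = exp (- \<mu>) * egf (\<lambda>k. ln (half_gamma k)) \<mu>"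
    using expectation_poisson[OF \<mu>, of "\<lambda>k. ln (half_gamma k)" 1] abs_ln_half_gamma_le by simp_all
  have i2: "integrable (measure_pmf (poisson_pmf \<mu>)) real"
  proof (rule expectation_poisson(1)[OF \<mu>])
    show "\<bar>real k\<bar> \<le> 1 * 2 ^ k" for k using of_nat_less_two_power[of k, where 'a = real] by simp
  qed
  show ?thesis
    unfolding ln using i1 i2 by (simp add: e1 expectation_poisson_id[OF \<mu>])
qed

lemma expectation_pair_poisson_vec_pmf_nth:
  assumes "\<And>i. a $ i > 0" "\<And>i. b $ i > 0"
  shows "measure_pmf.expectation (pair_pmf (poisson_vec_pmf a) (poisson_vec_pmf b)) (\<lambda>z. h (fst z $ i)) =
      measure_pmf.expectation (poisson_pmf (a $ i)) h"
    and "measure_pmf.expectation (pair_pmf (poisson_vec_pmf a) (poisson_vec_pmf b)) (\<lambda>z. h (snd z $ i)) =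
      measure_pmf.expectation (poisson_pmf (b $ i)) h"
    and "measure_pmf.expectation (pair_pmf (poisson_vec_pmf a) (poisson_vec_pmf b)) (\<lambda>z. h (fst z $ i + snd z $ i)) =
      measure_pmf.expectation (poisson_pmf (a $ i + b $ i)) (h :: nat \<Rightarrow> real)"
proof -
  have "map_pmf (\<lambda>z. fst z $ i) (pair_pmf (poisson_vec_pmf a) (poisson_vec_pmf b)) = map_pmf (\<lambda>x. x $ i) (map_pmf fst (pair_pmf (poisson_vec_pmf a) (poisson_vec_pmf b)))"
    by (simp add: pmf.map_comp o_def)
  then have 1: "poisson_pmf (a $ i) = map_pmf (\<lambda>z. fst z $ i) (pair_pmf (poisson_vec_pmf a) (poisson_vec_pmf b))"
    by (simp add: map_fst_pair_pmf map_pmf_poisson_vec_pmf_nth)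
  have "map_pmf (\<lambda>z. snd z $ i) (pair_pmf (poisson_vec_pmf a) (poisson_vec_pmf b)) = map_pmf (\<lambda>x. x $ i) (map_pmf snd (pair_pmf (poisson_vec_pmf a) (poisson_vec_pmf b)))"
    by (simp add: pmf.map_comp o_def)
  then have 2: "poisson_pmf (b $ i) = map_pmf (\<lambda>z. snd z $ i) (pair_pmf (poisson_vec_pmf a) (poisson_vec_pmf b))"
    by (simp add: map_snd_pair_pmf map_pmf_poisson_vec_pmf_nth)
  have "map_pmf (\<lambda>z. fst z $ i + snd z $ i) (pair_pmf (poisson_vec_pmf a) (poisson_vec_pmf b)) =
    map_pmf (\<lambda>x. x $ i) (map_pmf (\<lambda>(x, y). x + y) (pair_pmf (poisson_vec_pmf a) (poisson_vec_pmf b)))"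
    by (simp add: pmf.map_comp o_def case_prod_unfold)
  then have 3: "poisson_pmf (a $ i + b $ i) = map_pmf (\<lambda>z. fst z $ i + snd z $ i) (pair_pmf (poisson_vec_pmf a) (poisson_vec_pmf b))"
    by (simp add: map_pmf_add_poisson_vec_pmf[OF assms] map_pmf_poisson_vec_pmf_nth)
  show "measure_pmf.expectation (pair_pmf (poisson_vec_pmf a) (poisson_vec_pmf b)) (\<lambda>z. h (fst z $ i)) =
      measure_pmf.expectation (poisson_pmf (a $ i)) h" unfolding 1 by simp
  show "measure_pmf.expectation (pair_pmf (poisson_vec_pmf a) (poisson_vec_pmf b)) (\<lambda>z. h (snd z $ i)) =
      measure_pmf.expectation (poisson_pmf (b $ i)) h" unfolding 2 by simp
  show "measure_pmf.expectation (pair_pmf (poisson_vec_pmf a) (poisson_vec_pmf b)) (\<lambda>z. h (fst z $ i + snd z $ i)) =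
      measure_pmf.expectation (poisson_pmf (a $ i + b $ i)) h" unfolding 3 by simp
qed

text \<open>The total is again Poisson, with mean (r + s) l, so the expectation is a difference of
  the same function at r l and at (r + s) l, up to a multiple of ln ((r + s) / r).\<close>

lemma expectation_log_ratio_coord_less:
  fixes a b :: "real ^ 'd"
  assumes a: "\<And>i. a $ i > 0" and b: "\<And>i. b $ i > 0"
    and r: "r > 0" and s: "s > 0" and l: "l > 0" and ai: "a $ i = r * l" and bi: "b $ i = s * l"
  shows "integrable (measure_pmf (pair_pmf (poisson_vec_pmf a) (poisson_vec_pmf b))) (\<lambda>z. log_ratio_coord r s l (fst z $ i) (snd z $ i))"
    and "measure_pmf.expectation (pair_pmf (poisson_vec_pmf a) (poisson_vec_pmf b)) (\<lambda>z. log_ratio_coord r s l (fst z $ i) (snd z $ i)) <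
      0.52 * ln ((r + s) / r)"
proof -
  let ?P = "pair_pmf (poisson_vec_pmf a) (poisson_vec_pmf b)"
  have rs: "r + s > 0" using r s by simp
  have int: "integrable (measure_pmf ?P) (\<lambda>z. f (fst z $ i) (snd z $ i))"
    if f: "\<And>x y. \<bar>f x y\<bar> \<le> C * (2 ^ x * 2 ^ y)" for f :: "nat \<Rightarrow> nat \<Rightarrow> real" and C
  proof (rule integrable_pair_poisson_vec_pmf[OF a b, where C = C])
    fix x y :: "nat ^ 'd"
    have C: "C \<ge> 0" using f[of 0 0] by simp
    have "\<bar>f (x $ i) (y $ i)\<bar> \<le> C * (2 ^ (x $ i) * 2 ^ (y $ i))" by (rule f)
    also have "\<dots> \<le> C * (pow2_weight x * pow2_weight y)" by (intro mult_left_mono mult_mono power_le_pow2_weight C) auto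
    finally show "\<bar>f (fst (x, y) $ i) (snd (x, y) $ i)\<bar> \<le> C * (pow2_weight x * pow2_weight y)" by simp
  qed
  show "integrable (measure_pmf ?P) (\<lambda>z. log_ratio_coord r s l (fst z $ i) (snd z $ i))"
    using abs_log_ratio_coord_le[OF r s l] by (rule int)
  have p2: "(2::real) ^ x \<le> 2 ^ x * 2 ^ y" "(2::real) ^ y \<le> 2 ^ x * 2 ^ y" for x y :: nat by simp_all
  have i1: "integrable (measure_pmf ?P) (\<lambda>z. ln (gamma_mass r (fst z $ i)))"
  proof (rule int[of "\<lambda>x y. ln (gamma_mass r x)"])
    show "\<bar>ln (gamma_mass r x)\<bar> \<le> (1 + 2 * \<bar>ln r\<bar>) * (2 ^ x * 2 ^ y)" for x y
      using abs_ln_gamma_mass_le[OF r, of x] mult_left_mono[OF p2(1)[of x y], of "1 + 2 * \<bar>ln r\<bar>"] by linarith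
  qed
  have i2: "integrable (measure_pmf ?P) (\<lambda>z. ln (gamma_mass (r + s) (fst z $ i + snd z $ i)))"
  proof (rule int[of "\<lambda>x y. ln (gamma_mass (r + s) (x + y))"])
    show "\<bar>ln (gamma_mass (r + s) (x + y))\<bar> \<le> (1 + 2 * \<bar>ln (r + s)\<bar>) * (2 ^ x * 2 ^ y)" for x y
      using abs_ln_gamma_mass_le[OF rs, of "x + y"] by (simp add: power_add)
  qed
  have i3: "integrable (measure_pmf ?P) (\<lambda>z. real (snd z $ i))"
  proof (rule int[of "\<lambda>x y. real y"])
    show "\<bar>real y\<bar> \<le> 1 * (2 ^ x * 2 ^ y)" for x y
      using order_trans[OF less_imp_le[OF of_nat_less_two_power] p2(2)] by simp
  qed
  define A where "A \<mu> = exp (- \<mu>) * egf (\<lambda>k. ln (half_gamma k)) \<mu>" for \<mu>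
  have e1: "measure_pmf.expectation ?P (\<lambda>z. ln (gamma_mass r (fst z $ i))) = A (r * l) - r * l * ln r - ln r / 2"
    using expectation_pair_poisson_vec_pmf_nth(1)[OF a b, of "\<lambda>k. ln (gamma_mass r k)" i]
      expectation_poisson_ln_gamma_mass[OF a r, of i] by (simp add: ai A_def)
  have "a $ i + b $ i > 0" using a[of i] b[of i] by simp
  then have e2: "measure_pmf.expectation ?P (\<lambda>z. ln (gamma_mass (r + s) (fst z $ i + snd z $ i))) =
      A ((r + s) * l) - (r + s) * l * ln (r + s) - ln (r + s) / 2"
    using expectation_pair_poisson_vec_pmf_nth(3)[OF a b, of "\<lambda>k. ln (gamma_mass (r + s) k)" i]
      expectation_poisson_ln_gamma_mass[OF _ rs, of "a $ i + b $ i"] by (simp add: ai bi A_def distrib_right[symmetric])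
  have e3: "measure_pmf.expectation ?P (\<lambda>z. real (snd z $ i)) = s * l"
    using expectation_pair_poisson_vec_pmf_nth(2)[OF a b, of real i] expectation_poisson_id[OF b, of i] by (simp add: bi)
  have "measure_pmf.expectation ?P (\<lambda>z. log_ratio_coord r s l (fst z $ i) (snd z $ i)) =
    (A (r * l) - r * l * ln r - ln r / 2) - (A ((r + s) * l) - (r + s) * l * ln (r + s) - ln (r + s) / 2)
      + s * l * ln l - s * l"
    unfolding log_ratio_coord_def using i1 i2 i3 by (simp add: e1 e2 e3)
  \<comment> \<open>The terms ln r / 2 and ln (r + s) / 2 of the gamma masses give 0.5 ln ((r + s) /
    r); the 1 / 50 in \<open>risk_potential\<close> accounts for the other 0.02.\<close>
  also have "\<dots> = risk_potential (r * l) - risk_potential ((r + s) * l) + 0.52 * ln ((r + s) / r)"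
  proof -
    have L: "ln (r * l) = ln r + ln l" "ln ((r + s) * l) = ln (r + s) + ln l" "ln ((r + s) / r) = ln (r + s) - ln r"
      using r s l rs by (simp_all add: ln_mult_pos ln_divide_pos)
    show ?thesis unfolding risk_potential_def A_def[symmetric] L by (simp add: field_simps)
  qed
  also have "\<dots> < 0.52 * ln ((r + s) / r)"
    using risk_potential_less[of "r * l" "(r + s) * l"] r s l by simp
  finally show "measure_pmf.expectation ?P (\<lambda>z. log_ratio_coord r s l (fst z $ i) (snd z $ i)) < 0.52 * ln ((r + s) / r)" .
qed

lemma kl_risk_jeffreys_less:
  fixes r s lam :: "real ^ 'd"
  assumes r: "\<And>i. r $ i > 0" and s: "\<And>i. s $ i > 0" and lam: "lam \<in> orthant"
  shows "kl_risk r s (predictive r s jeffreys) lam < ereal (1.04 * minimax_lower_bound r s)"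
proof -
  define a where "a = (\<chi> i. r $ i * lam $ i)"
  define b where "b = (\<chi> i. s $ i * lam $ i)"
  have l: "lam $ i > 0" for i using lam by (simp add: orthant_def)
  have a: "a $ i > 0" and b: "b $ i > 0" for i using r[of i] s[of i] l[of i] by (auto simp: a_def b_def)
  have ai: "a $ i = r $ i * lam $ i" and bi: "b $ i = s $ i * lam $ i" for i by (simp_all add: a_def b_def)
  let ?P = "pair_pmf (poisson_vec_pmf a) (poisson_vec_pmf b)"
  note L = expectation_log_ratio_coord_less[OF a b r s l ai bi]
  have "measure_pmf.expectation ?P (\<lambda>(x, y). ln (poisson_prob s lam y / predictive r s jeffreys x y)) =
    measure_pmf.expectation ?P (\<lambda>z. \<Sum>i\<in>UNIV. log_ratio_coord (r $ i) (s $ i) (lam $ i) (fst z $ i) (snd z $ i))"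
    by (simp add: ln_ratio_jeffreys[OF r s lam] case_prod_unfold)
  also have "\<dots> = (\<Sum>i\<in>UNIV. measure_pmf.expectation ?P (\<lambda>z. log_ratio_coord (r $ i) (s $ i) (lam $ i) (fst z $ i) (snd z $ i)))"
    by (rule Bochner_Integration.integral_sum) (rule L(1))
  also have "\<dots> < (\<Sum>i\<in>UNIV. 0.52 * ln ((r $ i + s $ i) / r $ i))"
    by (rule sum_strict_mono) (simp, simp, rule L(2))
  also have "\<dots> = 1.04 * minimax_lower_bound r s"
    by (simp add: minimax_lower_bound_def sum_distrib_left)
  finally show ?thesis
    unfolding kl_risk_jeffreys[OF r s lam] a_def[symmetric] b_def[symmetric] by simp
qed

text \<open>The risk is strictly smaller at every parameter, so near minimaxity is inherited from
  the Jeffreys prior and any point of the orthant witnesses strict domination.\<close>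

lemma shrinkage_dominates_jeffreys:
  fixes r s \<eta> :: "real ^ 'd"
  assumes r: "\<And>i. r $ i > 0" and s: "\<And>i. s $ i > 0"
    and \<alpha>: "0 < \<alpha>" "\<alpha> \<le> (real CARD('d) - 2) / 2"
  defines "q \<equiv> predictive r s (shrinkage_prior (theta_diff r s) (f_sym \<eta> \<alpha>))"
  shows "dominates r s q (predictive r s jeffreys)" and "nearly_minimax r s q"
proof -
  have less: "kl_risk r s q lam < kl_risk r s (predictive r s jeffreys) lam" if "lam \<in> orthant" for lam
    unfolding q_def by (rule kl_risk_shrinkage_less[OF r s that \<alpha>])
  have "(\<chi> i. 1) \<in> (orthant :: (real ^ 'd) set)" by (simp add: orthant_def)
  then show "dominates r s q (predictive r s jeffreys)"
    unfolding dominates_def using less less_imp_le by blast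
  show "nearly_minimax r s q"
    unfolding nearly_minimax_def using less kl_risk_jeffreys_less[OF r s] less_trans by blast
qed

theorem proposition1:
  fixes \<eta> :: "real ^ 'd" and \<alpha> :: real
  assumes "CARD('d) \<ge> 3"
    and "0 < \<alpha>" and "\<alpha> \<le> (real CARD('d) - 2) / 2"
  shows
    "(\<forall>r s :: real. r > 0 \<longrightarrow> s > 0 \<longrightarrow>
       (let rv = (\<chi> i. r) :: real ^ 'd; sv = (\<chi> i. s) :: real ^ 'd;
            q = predictive rv sv (shrinkage_prior theta_same (f_sym \<eta> \<alpha>))
        in dominates rv sv q (predictive rv sv jeffreys) \<and> nearly_minimax rv sv q)) \<and>
     (\<forall>r s :: real ^ 'd. (\<forall>i. r $ i > 0) \<longrightarrow> (\<forall>i. s $ i > 0) \<longrightarrow>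
       (let q = predictive r s (shrinkage_prior (theta_diff r s) (f_sym \<eta> \<alpha>))
        in dominates r s q (predictive r s jeffreys) \<and> nearly_minimax r s q))"
  unfolding Let_def
proof (intro conjI allI impI)
  fix r s :: real
  assume r: "r > 0" and s: "s > 0"
  have r': "((\<chi> i. r) :: real ^ 'd) $ i > 0" and s': "((\<chi> i. s) :: real ^ 'd) $ i > 0" for i :: 'd
    using r s by simp_all
  show "dominates ((\<chi> i. r) :: real ^ 'd) (\<chi> i. s) (predictive (\<chi> i. r) (\<chi> i. s) (shrinkage_prior theta_same (f_sym \<eta> \<alpha>)))
      (predictive (\<chi> i. r) (\<chi> i. s) jeffreys)"
    "nearly_minimax ((\<chi> i. r) :: real ^ 'd) (\<chi> i. s) (predictive (\<chi> i. r) (\<chi> i. s) (shrinkage_prior theta_same (f_sym \<eta> \<alpha>)))"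
    unfolding predictive_same_duration[OF r s]
    by (rule shrinkage_dominates_jeffreys[OF r' s' assms(2,3)])+
next
  fix r s :: "real ^ 'd"
  assume "\<forall>i. r $ i > 0" "\<forall>i. s $ i > 0"
  then have r: "r $ i > 0" and s: "s $ i > 0" for i by simp_all
  show "dominates r s (predictive r s (shrinkage_prior (theta_diff r s) (f_sym \<eta> \<alpha>))) (predictive r s jeffreys)"
    "nearly_minimax r s (predictive r s (shrinkage_prior (theta_diff r s) (f_sym \<eta> \<alpha>)))"
    by (rule shrinkage_dominates_jeffreys[OF r s assms(2,3)])+
qed

end
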